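(* Let $P$ be a full-dimensional rational polytope in $\mathbb{R}^d$. Then for all positive real values of $t$, the codimension one quasi-coefficient $e_{d-1}(t)$ of the Ehrhart function $L_P(t)$ is $$e_{d-1}(t) = -\sum_{\substack{F \subset P \text{ face},\\ \dim(F) = d-1}} \mathrm{vol}^*(F)\,\overline{B}^+_1\big(\langle v_F,x_F\rangle t\big),$$ where $x_F$ is any point in $F$ and $v_F$ is the primitive integer vector in the direction of $N_P(F)$.
   Context: A polytope is the convex hull of finitely many points; it is rational if its vertices have rational coordinates; its denominator $m$ is the smallest positive integer such that $mP$ has integer vertices. $L_P(t)=|tP\cap\mathbb{Z}^d|$ for real $t>0$; for $P$ full-dimensional and rational with denominator $m$ there are unique functions $e_0,\dots,e_d$ on $(0,\infty)$ (the quasi-coefficients) with $e_k(t+m)=e_k(t)$ and $L_P(t)=\sum_{k=0}^de_k(t)t^k$ for all real $t>0$. $N_P(F)$ is the outward unit normal vector of $P$ at the facet $F$. $\mathrm{vol}^*(F)$ is the relative volume: the $(d-1)$-dimensional volume of $F$ divided by the determinant of the lattice $\mathrm{lin}(F)\cap\mathbb{Z}^d$, where $\mathrm{lin}(F)$ is the linear subspace parallel to the affine hull of $F$. $\overline{B}_1(x)=x-\lfloor x\rfloor-\tfrac12$ for $x\notin\mathbb{Z}$ and $\overline{B}_1(x)=0$ for $x\in\mathbb{Z}$; $\overline{B}_1^+(x)=\lim_{\epsilon\to0^+}\overline{B}_1(x+\epsilon)$, i.e. $\overline{B}_1^+=\overline{B}_1$ off $\mathbb{Z}$ and $\overline{B}_1^+=-\tfrac12$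 on $\mathbb{Z}$. *)

theory Defs
  imports "HOL-Analysis.Analysis"
begin

section \<open>Rational polytopes and the Ehrhart function\<close>

definition int_lattice :: "(real ^ 'n) set" where
  "int_lattice = {x. \<forall>i. x $ i \<in> \<int>}"

definition rational_polytope :: "(real ^ 'n) set \<Rightarrow> bool" where
  "rational_polytope P \<longleftrightarrow>
     polytope P \<and> (\<forall>x. x extreme_point_of P \<longrightarrow> (\<forall>i. x $ i \<in> \<rat>))"

definition polytope_denom :: "(real ^ 'n) set \<Rightarrow> nat" where
  "polytope_denom P =
     (LEAST m. m > 0 \<and>
        (\<forall>x. x extreme_point_of ((\<lambda>y. real m *\<^sub>R y) ` P) \<longrightarrow> x \<in> int_lattice))"

definition ehrhart :: "(real ^ 'n) set \<Rightarrow> real \<Rightarrow> nat" where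
  "ehrhart P t = card ((\<lambda>x. t *\<^sub>R x) ` P \<inter> int_lattice)"

text \<open>
  The quasi-coefficients are functions on the positive reals; the values \<open>e k t\<close> with
  \<open>t \<le> 0\<close> or \<open>k > d\<close> are unconstrained and carry no meaning.
\<close>

definition quasi_coefficients :: "(real ^ 'n) set \<Rightarrow> (nat \<Rightarrow> real \<Rightarrow> real) \<Rightarrow> bool" where
  "quasi_coefficients P e \<longleftrightarrow>
     (\<forall>k \<le> CARD('n). \<forall>t > 0. e k (t + real (polytope_denom P)) = e k t) \<and>
     (\<forall>t > 0. real (ehrhart P t) = (\<Sum>k \<le> CARD('n). e k t * t ^ k))"


section \<open>Facet normals\<close>

text \<open>The description is unique when \<open>P\<close> is full-dimensional and \<open>F\<close> is a facet of \<open>P\<close>.\<close>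

definition outward_unit_normal :: "(real ^ 'n) set \<Rightarrow> (real ^ 'n) set \<Rightarrow> real ^ 'n" where
  "outward_unit_normal P F =
     (THE u. norm u = 1 \<and> (\<exists>b. P \<subseteq> {x. u \<bullet> x \<le> b} \<and> F \<subseteq> {x. u \<bullet> x = b}))"

definition primitive_vector :: "real ^ 'n \<Rightarrow> bool" where
  "primitive_vector v \<longleftrightarrow>
     (\<exists>z :: int ^ 'n. v = (\<chi> i. of_int (z $ i)) \<and> Gcd (range (\<lambda>i. z $ i)) = 1)"

definition primitive_normal :: "(real ^ 'n) set \<Rightarrow> (real ^ 'n) set \<Rightarrow> real ^ 'n" where
  "primitive_normal P F =
     (THE v. primitive_vector v \<and> (\<exists>c > 0. v = c *\<^sub>R outward_unit_normal P F))"


section \<open>Relative volume\<close>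

definition parallel_space :: "'a::euclidean_space set \<Rightarrow> 'a set" where
  "parallel_space S = {x - y | x y. x \<in> affine hull S \<and> y \<in> affine hull S}"

definition orthonormal_basis_of :: "'a::euclidean_space set \<Rightarrow> 'a set \<Rightarrow> bool" where
  "orthonormal_basis_of B V \<longleftrightarrow>
     pairwise orthogonal B \<and> (\<forall>b \<in> B. norm b = 1) \<and> span B = V"

text \<open>
  The \<open>k\<close>-dimensional volume of a set with \<open>k\<close>-dimensional affine hull: the
  \<open>k\<close>-dimensional Lebesgue measure of the set in Cartesian coordinates on its affine hull,
  with coordinates indexed by the basis vectors themselves. It does not depend on the chosen
  origin and orthonormal basis. A single point has volume 1.
\<close>

definition affine_volume :: "'a::euclidean_space set \<Rightarrow> real" where
  "affine_volume S =
     (let a = (SOME a. a \<in> S);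
          B = (SOME B. orthonormal_basis_of B (parallel_space S))
      in measure (\<Pi>\<^sub>M b\<in>B. lborel)
           {c \<in> B \<rightarrow>\<^sub>E UNIV. a + (\<Sum>b\<in>B. c b *\<^sub>R b) \<in> S})"

definition lattice_basis :: "'a::euclidean_space set \<Rightarrow> 'a set \<Rightarrow> bool" where
  "lattice_basis B L \<longleftrightarrow>
     independent B \<and> L = {(\<Sum>b\<in>B. of_int (z b) *\<^sub>R b) | z :: 'a \<Rightarrow> int. True}"

text \<open>
  The determinant of a lattice, not necessarily of full rank, is the volume of a fundamental
  parallelepiped, taken in the linear span of the lattice; it is 1 for the zero lattice.
\<close>

definition lattice_det :: "'a::euclidean_space set \<Rightarrow> real" where
  "lattice_det L =
     (let B = (SOME B. lattice_basis B L)
      in affine_volume {(\<Sum>b\<in>B. c b *\<^sub>R b) | c. \<forall>b\<in>B. 0 \<le> c b \<and> c b < 1})"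

definition relative_volume :: "(real ^ 'n) set \<Rightarrow> real" where
  "relative_volume F = affine_volume F / lattice_det (parallel_space F \<inter> int_lattice)"


section \<open>The periodized Bernoulli polynomial\<close>

definition B1_bar :: "real \<Rightarrow> real" where
  "B1_bar x = (if x \<in> \<int> then 0 else x - of_int \<lfloor>x\<rfloor> - 1 / 2)"

definition B1_bar_plus :: "real \<Rightarrow> real" where
  "B1_bar_plus x = Lim (at_right 0) (\<lambda>\<epsilon>. B1_bar (x + \<epsilon>))"

lemma B1_bar_plus_eq: "B1_bar_plus x = (if x \<in> \<int> then - 1 / 2 else B1_bar x)"
proof -
  have ev: "\<forall>\<^sub>F \<epsilon> in at_right 0. x + \<epsilon> - of_int \<lfloor>x\<rfloor> - 1 / 2 = B1_bar (x + \<epsilon>)"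
  proof (rule eventually_at_rightI)
    show "(0::real) < of_int \<lfloor>x\<rfloor> + 1 - x" by linarith
    fix \<epsilon> assume "\<epsilon> \<in> {0 <..< of_int \<lfloor>x\<rfloor> + 1 - x}"
    then have e: "\<epsilon> > 0" "x + \<epsilon> < of_int \<lfloor>x\<rfloor> + 1" by auto
    then have fl: "\<lfloor>x + \<epsilon>\<rfloor> = \<lfloor>x\<rfloor>" by linarith
    have "x + \<epsilon> \<notin> \<int>"
    proof
      assume "x + \<epsilon> \<in> \<int>"
      then have "x + \<epsilon> = of_int \<lfloor>x\<rfloor>" using fl by (metis floor_of_int Ints_cases)
      then show False using e(1) by linarith
    qed
    then show "x + \<epsilon> - of_int \<lfloor>x\<rfloor> - 1 / 2 = B1_bar (x + \<epsilon>)"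
      by (simp add: B1_bar_def fl)
  qed
  have "((\<lambda>\<epsilon>. x + \<epsilon> - of_int \<lfloor>x\<rfloor> - 1 / 2) \<longlongrightarrow> x + 0 - of_int \<lfloor>x\<rfloor> - 1 / 2) (at_right 0)"
    by (intro tendsto_intros)
  then have "((\<lambda>\<epsilon>. B1_bar (x + \<epsilon>)) \<longlongrightarrow> x - of_int \<lfloor>x\<rfloor> - 1 / 2) (at_right 0)"
    using Lim_transform_eventually[OF _ ev] by simp
  then have "B1_bar_plus x = x - of_int \<lfloor>x\<rfloor> - 1 / 2"
    unfolding B1_bar_plus_def by (intro tendsto_Lim) auto
  then show ?thesis
    by (auto simp: B1_bar_def elim: Ints_cases)
qed

end

theory Submission
  imports Defs
begin

text \<open>
  Write \<open>P\<close> as an intersection of halfspaces \<open>v\<^sub>i \<bullet> x \<le> b\<^sub>i\<close> with primitive normals. The number of lattice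
  points \<open>z\<close> with \<open>v\<^sub>i \<bullet> z \<le> \<kappa>\<^sub>i\<close> for all \<open>i\<close> changes, when the integer \<open>\<kappa>\<^sub>i\<close> increases by 1, by the number of
  lattice points of a slice near the \<open>i\<close>-th facet of \<open>s P\<close>. As long as \<open>\<kappa>\<close> stays within bounded distance of
  \<open>s b\<close>, all these slices have \<open>\<nu>\<^sub>i s\<^sup>d\<^sup>-\<^sup>1 + O(s\<^sup>d\<^sup>-\<^sup>2)\<close> points, \<open>\<nu>\<^sub>i\<close> being the relative volume of the facet,
  because two slices differ only in points close to two facets.

  On the other hand \<open>vol(s P)\<close> is the mean over \<open>u\<close> in the unit cell of the number of lattice points of
  \<open>s P - u\<close>, where \<open>\<kappa>\<^sub>i = \<lfloor>s b\<^sub>i - v\<^sub>i \<bullet> u\<rfloor>\<close>. Since \<open>\<lfloor>c - v\<^sub>i \<bullet> u\<rfloor>\<close> has mean \<open>c - 1/2\<close>, this gives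
  \<open>L(s) = vol(P) s\<^sup>d + (\<Sum>i. (\<lfloor>s b\<^sub>i\<rfloor> - s b\<^sub>i + 1/2) \<nu>\<^sub>i) s\<^sup>d\<^sup>-\<^sup>1 + O(s\<^sup>d\<^sup>-\<^sup>2)\<close>, and the coefficients are compared along
  \<open>s = t + j m\<close>.
\<close>

section \<open>Sublattices and primitive vectors\<close>

text \<open>Comparing \<open>ehrhart P s\<close> with the volume by a Riemann sum leaves an error of
  order s^(d-1), the very order of the coefficient sought, so the dependence of the count on the
  translate must be known to first order. Therefore slices are compared for all bounds in a window
  of fixed width: a translate of s P is not a dilate of P, and for real s the hyperplane of a facet
  of s P often contains no lattice point, so the points on the facet itself cannot stand for a
  slice. Slices at different levels of \<open>v i\<close> become comparable through a lattice vector
  \<open>w i\<close> with \<open>v i \<bullet> w i = 1\<close>, which exists because the normal is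
  primitive. The same vector yields their size: the cylinder over the facet along \<open>w i\<close>
  has unit height for \<open>v i\<close>, so the lattice points of each translate lie on a single
  integer level, and its volume is the relative volume because the hyperplane lattice has
  determinant \<open>norm (v i)\<close>. Along t + j m the quasi-coefficients are constant, and so
  is the rounding term, since m b_i is an integer: the facet contains a vertex of P, and m times it
  is integral.\<close>

lemma int_lattice_closed:
  fixes x y :: "real ^ 'n"
  shows "0 \<in> (int_lattice :: (real ^ 'n) set)"
    and "x \<in> int_lattice \<Longrightarrow> y \<in> int_lattice \<Longrightarrow> x + y \<in> int_lattice"
    and "x \<in> int_lattice \<Longrightarrow> y \<in> int_lattice \<Longrightarrow> x - y \<in> int_lattice"
    and "x \<in> int_lattice \<Longrightarrow> - x \<in> int_lattice"
    and "x \<in> int_lattice \<Longrightarrow> r \<in> \<int> \<Longrightarrow> r *\<^sub>R x \<in> int_lattice"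
  by (auto simp: int_lattice_def)

lemma int_lattice_inner: "x \<in> int_lattice \<Longrightarrow> y \<in> int_lattice \<Longrightarrow> x \<bullet> y \<in> \<int>"
  for x y :: "real ^ 'n"
  by (auto simp: int_lattice_def inner_vec_def intro!: Ints_sum Ints_mult)

lemma axis_in_int_lattice: "axis i 1 \<in> int_lattice"
  by (auto simp: int_lattice_def axis_def)

lemma int_lattice_components:
  assumes "x \<in> int_lattice"
  obtains f where "\<And>i. x $ i = of_int (f i)"
proof -
  have "\<forall>i. \<exists>k. x $ i = of_int k" using assms by (auto simp: int_lattice_def elim: Ints_cases)
  then show ?thesis using that by metis
qed

text \<open>The generator is the least positive element: dividing any element by it leaves a smaller
  nonnegative element, which must be 0. The trivial subgroup has generator 0.\<close>

lemma int_subgroup_generator: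
  fixes A :: "int set"
  assumes "0 \<in> A" and diff: "\<And>x y. x \<in> A \<Longrightarrow> y \<in> A \<Longrightarrow> x - y \<in> A"
  obtains g where "g \<in> A" "\<And>x. x \<in> A \<Longrightarrow> g dvd x"
proof (cases "A \<subseteq> {0}")
  case True
  then show ?thesis using that[of 0] assms(1) by auto
next
  case False
  have neg: "- x \<in> A" if "x \<in> A" for x
    using diff[OF assms(1) that] by simp
  have add: "x + y \<in> A" if "x \<in> A" "y \<in> A" for x y
    using diff[OF that(1) neg[OF that(2)]] by simp
  from False obtain a where a: "a \<in> A" "a \<noteq> 0" by auto
  then have "\<exists>n::nat. n > 0 \<and> int n \<in> A"
    using neg[OF a(1)] by (cases "a > 0") (auto intro: exI[of _ "nat \<bar>a\<bar>"])
  then obtain n :: nat where n: "n > 0" "int n \<in> A" "\<And>k. k < n \<Longrightarrow> \<not> (k > 0 \<and> int k \<in> A)"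
    using exists_least_iff[of "\<lambda>n. n > 0 \<and> int n \<in> A"] by auto
  have mult_nat: "int k * int n \<in> A" for k
    by (induction k) (auto simp: assms(1) algebra_simps intro: add n)
  have mult: "k * int n \<in> A" for k
    using mult_nat[of "nat k"] neg[OF mult_nat[of "nat (- k)"]] by (cases "k \<ge> 0") auto
  have "int n dvd x" if "x \<in> A" for x
  proof -
    have "x mod int n \<in> A"
      using diff[OF that mult[of "x div int n"]] by (simp add: minus_div_mult_eq_mod)
    moreover have "0 \<le> x mod int n" "x mod int n < int n" using n(1) by auto
    ultimately have "x mod int n = 0"
      using n(3)[of "nat (x mod int n)"] by (cases "x mod int n = 0") (auto simp: nat_less_iff)
    then show ?thesis by auto
  qed
  then show ?thesis using that[of "int n"] n by auto
qed

lemma real_int_subgroup_generator: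
  fixes A :: "real set"
  assumes "A \<subseteq> \<int>" "0 \<in> A" and diff: "\<And>x y. x \<in> A \<Longrightarrow> y \<in> A \<Longrightarrow> x - y \<in> A"
  obtains g where "g \<in> A" "\<And>x. x \<in> A \<Longrightarrow> \<exists>q. x = of_int q * g"
proof -
  define A' where "A' = {k::int. of_int k \<in> A}"
  obtain g where g: "g \<in> A'" "\<And>x. x \<in> A' \<Longrightarrow> g dvd x"
  proof (rule int_subgroup_generator[of A'])
    show "0 \<in> A'" using assms by (auto simp: A'_def)
    show "x - y \<in> A'" if "x \<in> A'" "y \<in> A'" for x y
      using diff[of "of_int x" "of_int y"] that by (auto simp: A'_def)
  qed auto
  show ?thesis
  proof (rule that[of "of_int g"])
    show "of_int g \<in> A" using g by (auto simp: A'_def)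
    show "\<exists>q. x = of_int q * of_int g" if "x \<in> A" for x
    proof -
      from that assms obtain k where k: "x = of_int k" by (auto elim: Ints_cases)
      then have "g dvd k" using g that by (auto simp: A'_def)
      then show ?thesis using k by (auto simp: dvd_def mult.commute)
    qed
  qed
qed

section \<open>Bases of sublattices\<close>

lemma lattice_basis_subset:
  assumes "lattice_basis B L"
  shows "B \<subseteq> L"
proof
  fix b assume b: "b \<in> B"
  have "finite B" using assms independent_imp_finite by (auto simp: lattice_basis_def)
  then have "b = (\<Sum>c\<in>B. of_int (if c = b then 1 else 0) *\<^sub>R c)"
    using b by (simp add: if_distrib[of of_int] if_distrib[of "\<lambda>r. r *\<^sub>R _"] cong: if_cong)
  then show "b \<in> L"
    using assms unfolding lattice_basis_def by (force intro: exI[of _ "\<lambda>c. if c = b then 1 else 0"])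
qed

text \<open>Elimination of one coordinate at a time; \<open>S\<close> holds the coordinates that may
  still be nonzero. The i-th coordinates of \<open>L\<close> form a subgroup of the integers with
  generator \<open>g\<close>, and the vectors with vanishing i-th coordinate have a basis by
  induction. If \<open>g \<noteq> 0\<close>, a vector \<open>h\<close> of \<open>L\<close> with
  \<open>h $ i = g\<close> completes this basis: subtracting a multiple of \<open>h\<close> clears
  the coordinate, and \<open>h\<close> is independent because the span of the rest has i-th
  coordinate 0.\<close>

lemma lattice_basis_exists_aux:
  fixes L :: "(real ^ 'n) set" and S :: "'n set"
  assumes "finite S" "0 \<in> L" "\<And>x y. x \<in> L \<Longrightarrow> y \<in> L \<Longrightarrow> x - y \<in> L" "L \<subseteq> int_lattice"
    and "\<And>x i. x \<in> L \<Longrightarrow> i \<notin> S \<Longrightarrow> x $ i = 0"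
  shows "\<exists>B. lattice_basis B L"
  using assms
proof (induction S arbitrary: L rule: finite_induct)
  case empty
  then have "L = {0}" by (auto simp: vec_eq_iff)
  then show ?case by (auto simp: lattice_basis_def independent_empty intro!: exI[of _ "{}"])
next
  case (insert i S)
  define L' where "L' = {x \<in> L. x $ i = 0}"
  have "\<exists>B. lattice_basis B L'"
  proof (rule insert.IH)
    show "0 \<in> L'" "L' \<subseteq> int_lattice" using insert by (auto simp: L'_def)
    show "x - y \<in> L'" if "x \<in> L'" "y \<in> L'" for x y using that insert by (auto simp: L'_def)
    show "x $ j = 0" if "x \<in> L'" "j \<notin> S" for x j
      using that insert.prems(4)[of x j] by (cases "j = i") (auto simp: L'_def)
  qed
  then obtain B where ind: "independent B" and B: "L' = {(\<Sum>b\<in>B. of_int (z b) *\<^sub>R b) | z. True}"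
    by (auto simp: lattice_basis_def)
  have finB: "finite B" using ind independent_imp_finite by blast
  define A where "A = (\<lambda>x. x $ i) ` L"
  obtain g where g: "g \<in> A" "\<And>x. x \<in> A \<Longrightarrow> \<exists>q. x = of_int q * g"
  proof (rule real_int_subgroup_generator[of A])
    show "A \<subseteq> \<int>" using insert.prems by (auto simp: A_def int_lattice_def)
    show "0 \<in> A" using insert.prems by (force simp: A_def)
    show "x - y \<in> A" if xy: "x \<in> A" "y \<in> A" for x y
    proof -
      obtain x' y' where "x' \<in> L" "y' \<in> L" "x = x' $ i" "y = y' $ i" using xy by (auto simp: A_def)
      then show ?thesis using insert.prems(2)[of x' y'] by (auto simp: A_def intro!: image_eqI[of _ _ "x' - y'"])
    qed
  qed auto
  have Ladd: "x + y \<in> L" if "x \<in> L" "y \<in> L" for x y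
    using insert.prems(2)[OF that(1) insert.prems(2)[OF insert.prems(1) that(2)]] by simp
  show ?case
  proof (cases "g = 0")
    case True
    then have "L' = L" using g by (auto simp: L'_def A_def)
    then show ?thesis using ind B by (auto simp: lattice_basis_def)
  next
    case False
    from g(1) obtain h where h: "h \<in> L" "h $ i = g" by (auto simp: A_def)
    have BL: "b \<in> L'" if "b \<in> B" for b
      using lattice_basis_subset[of B L'] ind B that by (auto simp: lattice_basis_def)
    have B0: "b $ i = 0" if "b \<in> span B" for b
      using that
    proof (induction rule: span_induct)
      case base
      show ?case by (auto simp: subspace_def)
    qed (use BL in \<open>auto simp: L'_def\<close>)
    have hB: "h \<notin> span B" using B0[of h] h False by auto
    then have hB': "h \<notin> B" using span_base by blast
    have hk: "of_int k *\<^sub>R h \<in> L" for k :: int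
    proof -
      have 1: "of_nat n *\<^sub>R h \<in> L" for n
        by (induction n) (auto simp: insert.prems(1) algebra_simps intro: Ladd h)
      show ?thesis
      proof (cases "k \<ge> 0")
        case True then show ?thesis using 1[of "nat k"] by simp
      next
        case False
        then show ?thesis using insert.prems(2)[OF insert.prems(1) 1[of "nat (- k)"]] by simp
      qed
    qed
    have "L = {(\<Sum>b\<in>insert h B. of_int (z b) *\<^sub>R b) | z. True}" (is "L = ?R")
    proof (intro equalityI subsetI)
      fix x assume x: "x \<in> L"
      then obtain q where q: "x $ i = of_int q * g" using g(2)[of "x $ i"] by (auto simp: A_def)
      have "x - of_int q *\<^sub>R h \<in> L'"
        using insert.prems(2)[OF x hk[of q]] q h by (auto simp: L'_def)
      then obtain z where z: "x - of_int q *\<^sub>R h = (\<Sum>b\<in>B. of_int (z b) *\<^sub>R b)" unfolding B by auto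
      have "x = (\<Sum>b\<in>insert h B. of_int ((z(h := q)) b) *\<^sub>R b)"
      proof -
        have "(\<Sum>b\<in>B. of_int ((z(h := q)) b) *\<^sub>R b) = (\<Sum>b\<in>B. of_int (z b) *\<^sub>R b)"
          using hB' by (intro sum.cong) auto
        then show ?thesis using hB' finB z by (simp add: algebra_simps)
      qed
      then show "x \<in> ?R" by blast
    next
      fix x assume "x \<in> ?R"
      then obtain z where z: "x = (\<Sum>b\<in>insert h B. of_int (z b) *\<^sub>R b)" by auto
      have "(\<Sum>b\<in>B. of_int (z b) *\<^sub>R b) \<in> L'" unfolding B by blast
      then show "x \<in> L" using z hB' finB hk Ladd by (auto simp: L'_def)
    qed
    moreover have "independent (insert h B)" using hB ind by (simp add: independent_insert)
    ultimately show ?thesis by (auto simp: lattice_basis_def)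
  qed
qed

lemma lattice_basis_exists:
  fixes L :: "(real ^ 'n) set"
  assumes "0 \<in> L" "\<And>x y. x \<in> L \<Longrightarrow> y \<in> L \<Longrightarrow> x - y \<in> L" "L \<subseteq> int_lattice"
  shows "\<exists>B. lattice_basis B L"
  using lattice_basis_exists_aux[of UNIV L] assms by auto

section \<open>Primitive integer vectors\<close>

lemma primitive_vector_in_int_lattice: "primitive_vector v \<Longrightarrow> v \<in> int_lattice"
  by (auto simp: primitive_vector_def int_lattice_def)

text \<open>The values \<open>v \<bullet> w\<close> on lattice vectors form a subgroup of the
  integers. Its generator divides every coordinate of \<open>v\<close>, as the axis vectors show,
  hence divides their gcd 1. Later \<open>w\<close> serves as the step from one integer level of
  \<open>v\<close> to the next.\<close>

lemma primitive_vector_bezout: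
  fixes v :: "real ^ 'n"
  assumes "primitive_vector v"
  obtains w where "w \<in> int_lattice" "v \<bullet> w = 1"
proof -
  from assms obtain z :: "int ^ 'n" where z: "v = (\<chi> i. of_int (z $ i))" "Gcd (range (\<lambda>i. z $ i)) = 1"
    by (auto simp: primitive_vector_def)
  define A where "A = (\<lambda>w. v \<bullet> w) ` int_lattice"
  have vZ: "v \<in> int_lattice" using assms by (rule primitive_vector_in_int_lattice)
  obtain g where g: "g \<in> A" "\<And>x. x \<in> A \<Longrightarrow> \<exists>q. x = of_int q * g"
  proof (rule real_int_subgroup_generator[of A])
    show "A \<subseteq> \<int>" using vZ int_lattice_inner by (auto simp: A_def)
    show "0 \<in> A" using int_lattice_closed(1) by (force simp: A_def)
    show "x - y \<in> A" if "x \<in> A" "y \<in> A" for x y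
      using that int_lattice_closed(3) by (force simp: A_def inner_diff_right[symmetric] simp del: inner_diff_right)
  qed auto
  have "g \<in> \<int>" using g(1) vZ int_lattice_inner by (auto simp: A_def)
  then obtain k where k: "g = of_int k" by (auto elim: Ints_cases)
  have "k dvd z $ i" for i
  proof -
    have "of_int (z $ i) \<in> A"
      using axis_in_int_lattice[of i] z by (auto simp: A_def inner_axis intro!: image_eqI[of _ _ "axis i 1"])
    from g(2)[OF this] obtain q where "of_int (z $ i) = of_int q * g" by auto
    then have "z $ i = q * k" unfolding k by (metis of_int_eq_iff of_int_mult)
    then show ?thesis by simp
  qed
  then have "k dvd Gcd (range (\<lambda>i. z $ i))" by (intro Gcd_greatest) auto
  then have "k = 1 \<or> k = - 1" using z(2) by auto
  from g(1) obtain w where w: "w \<in> int_lattice" "v \<bullet> w = g" by (auto simp: A_def)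
  show ?thesis
    using \<open>k = 1 \<or> k = - 1\<close> that[of w] that[of "- w"] w k int_lattice_closed(4)[of w] by auto
qed

text \<open>Pairing with the Bezout vectors of \<open>v\<close> and \<open>v'\<close> makes
  \<open>c\<close> an integer that divides 1. This is what makes the primitive normal of a facet
  unique.\<close>

lemma primitive_vector_parallel:
  fixes v v' :: "real ^ 'n"
  assumes "primitive_vector v" "primitive_vector v'" "v' = c *\<^sub>R v"
  shows "c = 1 \<or> c = - 1"
proof -
  obtain w where w: "w \<in> int_lattice" "v \<bullet> w = 1" using primitive_vector_bezout[OF assms(1)] .
  obtain w' where w': "w' \<in> int_lattice" "v' \<bullet> w' = 1" using primitive_vector_bezout[OF assms(2)] .
  note Z = primitive_vector_in_int_lattice[OF assms(1)] primitive_vector_in_int_lattice[OF assms(2)]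
  have "c = v' \<bullet> w" using w assms(3) by simp
  then have "c \<in> \<int>" using int_lattice_inner Z w by metis
  then obtain k where k: "c = of_int k" by (auto elim: Ints_cases)
  have "v \<bullet> w' \<in> \<int>" using int_lattice_inner Z w' by metis
  then obtain l where l: "v \<bullet> w' = of_int l" by (auto elim: Ints_cases)
  have "of_int k * of_int l = (1::real)" using w'(2) assms(3) k l by simp
  then have "k * l = 1" by (metis of_int_1 of_int_eq_iff of_int_mult)
  then have "k = 1 \<or> k = - 1" using zmult_eq_1_iff by auto
  then show ?thesis using k by auto
qed

lemma clear_denominators:
  fixes A :: "real set"
  assumes "finite A" "A \<subseteq> \<rat>"
  obtains N :: nat where "N > 0" "\<And>a. a \<in> A \<Longrightarrow> real N * a \<in> \<int>"
proof -
  have "\<exists>N::nat. N > 0 \<and> (\<forall>a\<in>A. real N * a \<in> \<int>)"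
    using assms
  proof (induction A rule: finite_induct)
    case (insert a A)
    then obtain N :: nat where N: "N > 0" "\<And>a. a \<in> A \<Longrightarrow> real N * a \<in> \<int>" by auto
    obtain p q :: int where pq: "q > 0" "a = of_int p / of_int q"
      using insert.prems by (metis Rats_cases' insert_subset)
    have "real (nat q * N) * b \<in> \<int>" if "b \<in> insert a A" for b
    proof (cases "b = a")
      case True
      have "real (nat q * N) * b = of_int (p * int N)" using pq by (simp add: True)
      then show ?thesis by (simp only: Ints_of_int)
    next
      case False
      then have "real N * b \<in> \<int>" using that N by auto
      then have "real (nat q) * (real N * b) \<in> \<int>" by (rule Ints_mult[OF Ints_of_nat])
      then show ?thesis by (simp only: of_nat_mult mult.assoc)
    qed
    moreover have "nat q * N > 0" using pq N by simp
    ultimately show ?case by blast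
  qed (auto intro: exI[of _ 1])
  then show ?thesis using that by blast
qed

text \<open>A common denominator clears the fractions, and the gcd of the resulting integers is
  divided out. The factor is positive, so an outward normal stays outward.\<close>

lemma primitive_multiple_exists:
  fixes v :: "real ^ 'n"
  assumes rat: "\<And>i. v $ i \<in> \<rat>" and nz: "v \<noteq> 0"
  obtains c where "c > 0" "primitive_vector (c *\<^sub>R v)"
proof -
  have "finite (range (\<lambda>i. v $ i))" "range (\<lambda>i. v $ i) \<subseteq> \<rat>" using rat by auto
  then obtain M :: nat where M0: "M > 0" and M: "\<And>a. a \<in> range (\<lambda>i. v $ i) \<Longrightarrow> real M * a \<in> \<int>"
    using clear_denominators by blast
  have MZ: "real M *\<^sub>R v \<in> int_lattice" using M by (simp add: int_lattice_def)
  from int_lattice_components[OF MZ] obtain z where z: "\<And>i. real M * v $ i = of_int (z i)"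
    by auto
  define G where "G = Gcd (range z)"
  have "\<exists>i. z i \<noteq> 0"
  proof (rule ccontr)
    assume "\<not> ?thesis"
    then have "v = 0" using z M0 by (auto simp: vec_eq_iff)
    then show False using nz by simp
  qed
  then have "G \<noteq> 0" by (auto simp: G_def)
  then have G0: "G > 0" using Gcd_int_greater_eq_0[of "range z"] unfolding G_def by linarith
  have Gd: "G dvd z i" for i by (simp add: G_def)
  have "Gcd (range (\<lambda>i. z i div G)) = 1"
  proof -
    have "range z = (*) G ` range (\<lambda>i. z i div G)" using Gd by (auto simp: image_image)
    then have "G = normalize (G * Gcd (range (\<lambda>i. z i div G)))"
      unfolding G_def by (metis Gcd_mult)
    then have "G = G * Gcd (range (\<lambda>i. z i div G))"
      using G0 by (simp add: normalize_mult)
    then show ?thesis using G0 by simp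
  qed
  moreover have "(real M / of_int G) *\<^sub>R v = (\<chi> i. of_int ((\<chi> i. z i div G) $ i))"
    using z Gd G0 by (auto simp: vec_eq_iff real_of_int_div)
  ultimately have "primitive_vector ((real M / of_int G) *\<^sub>R v)"
    unfolding primitive_vector_def by (intro exI[of _ "\<chi> i. z i div G"]) simp
  then show ?thesis using that[of "real M / of_int G"] M0 G0 by auto
qed

section \<open>Averaging over a fundamental domain\<close>

lemma countable_int_lattice: "countable (int_lattice :: (real ^ 'n) set)"
proof (rule countable_subset)
  show "int_lattice \<subseteq> (\<lambda>f. \<chi> i. of_int (f i)) ` (UNIV :: ('n \<Rightarrow> int) set)"
  proof
    fix x :: "real ^ 'n" assume "x \<in> int_lattice"
    from int_lattice_components[OF this] obtain f where "\<And>i. x $ i = of_int (f i)" by blast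
    then show "x \<in> (\<lambda>f. \<chi> i. of_int (f i)) ` UNIV" by (intro image_eqI[of _ _ f]) (auto simp: vec_eq_iff)
  qed
  have "countable (PiE (UNIV :: 'n set) (\<lambda>_. UNIV :: int set))" by (rule countable_PiE) auto
  then show "countable ((\<lambda>f. \<chi> i. (of_int (f i) :: real)) ` (UNIV :: ('n \<Rightarrow> int) set))"
    by (intro countable_image) (simp add: PiE_UNIV_domain)
qed

text \<open>The tiling is exact rather than up to null sets, so that sums over the lattice can be
  rearranged pointwise.\<close>

definition fundamental_domain :: "(real ^ 'n) set \<Rightarrow> bool" where
  "fundamental_domain D \<longleftrightarrow> D \<in> sets borel \<and> (\<forall>x. \<exists>!z. z \<in> int_lattice \<and> x - z \<in> D)"

text \<open>The indicators of the lattice translates of \<open>D\<close> sum to 1 at every point.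
  Inserting this sum, exchanging sum and integral, and translating each term back to
  \<open>D\<close> gives the formula. The lattice sum is written as an integral for the counting
  measure so that Fubini applies.\<close>

lemma nn_integral_unfold:
  fixes D :: "(real ^ 'n) set"
  assumes D: "fundamental_domain D" and f[measurable]: "f \<in> borel_measurable borel"
  shows "(\<integral>\<^sup>+ x. f x \<partial>lborel) =
    (\<integral>\<^sup>+ u. (\<integral>\<^sup>+ z. f (z + u) \<partial>count_space int_lattice) * indicator D u \<partial>lborel)"
proof -
  let ?Z = "int_lattice :: (real ^ 'n) set"
  note Z = countable_int_lattice
  have D'[measurable]: "D \<in> sets borel" using D by (simp add: fundamental_domain_def)
  interpret Z: sigma_finite_measure "count_space ?Z"
    by (rule sigma_finite_measure_count_space_countable[OF Z])
  interpret P': pair_sigma_finite "count_space ?Z" lborel ..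
  have m1: "(\<lambda>(z, x). f x * indicator D (x - z)) \<in> borel_measurable (count_space ?Z \<Otimes>\<^sub>M lborel)"
    by (rule measurable_pair_measure_countable1[OF Z]) simp
  have m2: "(\<lambda>(z, u). f (z + u) * indicator D u) \<in> borel_measurable (count_space ?Z \<Otimes>\<^sub>M lborel)"
    by (rule measurable_pair_measure_countable1[OF Z]) simp
  have "f x = (\<integral>\<^sup>+ z. f x * indicator D (x - z) \<partial>count_space ?Z)" for x
  proof -
    obtain z0 where z0: "z0 \<in> ?Z" "x - z0 \<in> D" "\<And>z. z \<in> ?Z \<Longrightarrow> x - z \<in> D \<Longrightarrow> z = z0"
      using D unfolding fundamental_domain_def by metis
    have "(\<integral>\<^sup>+ z. f x * indicator D (x - z) \<partial>count_space ?Z) = (\<integral>\<^sup>+ z. f x * indicator {z0} z \<partial>count_space ?Z)"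
    proof (rule nn_integral_cong)
      fix z assume "z \<in> space (count_space ?Z)"
      then have "x - z \<in> D \<longleftrightarrow> z = z0" using z0(2) z0(3)[of z] by auto
      then show "f x * indicator D (x - z) = f x * indicator {z0} z" by (simp add: indicator_def)
    qed
    also have "\<dots> = f x"
      using z0(1) by (subst nn_integral_cmult) auto
    finally show ?thesis by simp
  qed
  then have "(\<integral>\<^sup>+ x. f x \<partial>lborel) = (\<integral>\<^sup>+ x. (\<integral>\<^sup>+ z. f x * indicator D (x - z) \<partial>count_space ?Z) \<partial>lborel)"
    by simp
  also have "\<dots> = (\<integral>\<^sup>+ z. (\<integral>\<^sup>+ x. f x * indicator D (x - z) \<partial>lborel) \<partial>count_space ?Z)"
    by (rule P'.Fubini'[OF m1])
  also have "\<dots> = (\<integral>\<^sup>+ z. (\<integral>\<^sup>+ u. f (z + u) * indicator D u \<partial>lborel) \<partial>count_space ?Z)"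
  proof (rule nn_integral_cong)
    fix z :: "real ^ 'n"
    have "(\<integral>\<^sup>+ x. f x * indicator D (x - z) \<partial>lborel) =
      (\<integral>\<^sup>+ x. f x * indicator D (x - z) \<partial>distr lborel borel ((+) z))"
      by (simp add: lborel_distr_plus)
    also have "\<dots> = (\<integral>\<^sup>+ u. f (z + u) * indicator D u \<partial>lborel)"
      by (subst nn_integral_distr) auto
    finally show "(\<integral>\<^sup>+ x. f x * indicator D (x - z) \<partial>lborel) = \<dots>" .
  qed
  also have "\<dots> = (\<integral>\<^sup>+ u. (\<integral>\<^sup>+ z. f (z + u) * indicator D u \<partial>count_space ?Z) \<partial>lborel)"
    by (rule P'.Fubini'[OF m2, symmetric])
  also have "\<dots> = (\<integral>\<^sup>+ u. (\<integral>\<^sup>+ z. f (z + u) \<partial>count_space int_lattice) * indicator D u \<partial>lborel)"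
    by (intro nn_integral_cong nn_integral_multc) auto
  finally show ?thesis .
qed

section \<open>The centred unit cube as fundamental domain\<close>

definition unit_cell :: "(real ^ 'n) set" where
  "unit_cell = {x. \<forall>i. - 1 / 2 \<le> x $ i \<and> x $ i < 1 / 2}"

lemma unit_cell_borel [measurable]: "unit_cell \<in> sets borel"
proof -
  have "(\<lambda>x :: real ^ 'n. x $ i) \<in> borel_measurable borel" for i
    by (intro borel_measurable_continuous_onI continuous_intros)
  then have "{x \<in> space borel. \<forall>i. - 1 / 2 \<le> x $ i \<and> (x :: real ^ 'n) $ i < 1 / 2} \<in> sets borel"
    by measurable
  then show ?thesis by (simp add: unit_cell_def)
qed

lemma fundamental_domain_unit_cell: "fundamental_domain (unit_cell :: (real ^ 'n) set)"
  unfolding fundamental_domain_def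
proof (intro conjI allI unit_cell_borel)
  fix x :: "real ^ 'n"
  show "\<exists>!z. z \<in> int_lattice \<and> x - z \<in> unit_cell"
  proof (rule ex1I[of _ "\<chi> i. of_int \<lfloor>x $ i + 1 / 2\<rfloor>"])
    show "(\<chi> i. of_int \<lfloor>x $ i + 1 / 2\<rfloor>) \<in> int_lattice \<and> x - (\<chi> i. of_int \<lfloor>x $ i + 1 / 2\<rfloor>) \<in> unit_cell"
      unfolding int_lattice_def unit_cell_def by (auto; linarith)
    fix z assume z: "z \<in> int_lattice \<and> x - z \<in> unit_cell"
    have "z $ i = of_int \<lfloor>x $ i + 1 / 2\<rfloor>" for i
    proof -
      obtain k where k: "z $ i = of_int k" using z by (auto simp: int_lattice_def elim: Ints_cases)
      have "- 1 / 2 \<le> x $ i - z $ i" "x $ i - z $ i < 1 / 2" using z by (auto simp: unit_cell_def)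
      then have "\<lfloor>x $ i + 1 / 2\<rfloor> = k" using k by linarith
      then show ?thesis using k by simp
    qed
    then show "z = (\<chi> i. of_int \<lfloor>x $ i + 1 / 2\<rfloor>)" by (simp add: vec_eq_iff)
  qed
qed

lemma unit_cell_norm: "u \<in> unit_cell \<Longrightarrow> norm (u :: real ^ 'n) \<le> real CARD('n)"
proof -
  assume u: "u \<in> unit_cell"
  have "norm u \<le> (\<Sum>i\<in>UNIV. \<bar>u $ i\<bar>)" by (rule norm_le_l1_cart)
  also have "\<dots> \<le> (\<Sum>i\<in>(UNIV :: 'n set). 1)"
  proof (rule sum_mono)
    fix i
    have "- 1 / 2 \<le> u $ i" "u $ i < 1 / 2" using u by (auto simp: unit_cell_def)
    then show "\<bar>u $ i\<bar> \<le> 1" by linarith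
  qed
  finally show ?thesis by simp
qed

text \<open>The half-open cell tiles exactly; the closed cube is symmetric under negation and has a
  known volume. Up to a null set they are interchangeable. Centring at the origin is what gives
  linear functionals mean 0.\<close>

lemma AE_unit_cell_eq_cbox:
  "AE u :: real ^ 'n in lborel. u \<in> unit_cell \<longleftrightarrow> u \<in> cbox (\<chi> i. - 1 / 2) (\<chi> i. 1 / 2)"
proof -
  have "AE u :: real ^ 'n in lborel. u $ i \<noteq> 1 / 2" for i
  proof -
    have "negligible {x :: real ^ 'n. axis i 1 \<bullet> x = 1 / 2}" by (rule negligible_hyperplane) (simp add: axis_eq_0_iff)
    then have "{x :: real ^ 'n. axis i 1 \<bullet> x = 1 / 2} \<in> null_sets lebesgue" by (simp add: negligible_iff_null_sets)
    then have "AE u in lebesgue. u \<notin> {x :: real ^ 'n. axis i 1 \<bullet> x = 1 / 2}" by (rule AE_not_in)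
    then show ?thesis by (simp add: AE_completion_iff inner_axis')
  qed
  then have "AE u :: real ^ 'n in lborel. \<forall>i. u $ i \<noteq> 1 / 2" by (simp add: AE_all_countable)
  then show ?thesis
    by (rule AE_mp) (auto intro!: AE_I2 simp: unit_cell_def mem_box_cart less_le)
qed

text \<open>Unfold the integral over \<open>D\<close> along \<open>D'\<close>: by periodicity the
  inner sum is \<open>f u\<close> times the number of points of the orbit of \<open>u\<close> in
  \<open>D\<close>, which is 1.\<close>

lemma nn_integral_fundamental_domain_cong:
  fixes D D' :: "(real ^ 'n) set"
  assumes D: "fundamental_domain D" and D': "fundamental_domain D'"
    and f[measurable]: "f \<in> borel_measurable borel"
    and per: "\<And>z u. z \<in> int_lattice \<Longrightarrow> f (z + u) = f u"
  shows "(\<integral>\<^sup>+ u. f u * indicator D u \<partial>lborel) = (\<integral>\<^sup>+ u. f u * indicator D' u \<partial>lborel)"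
proof -
  let ?Z = "int_lattice :: (real ^ 'n) set"
  have [measurable]: "D \<in> sets borel" "D' \<in> sets borel" using D D' by (auto simp: fundamental_domain_def)
  have "(\<integral>\<^sup>+ u. f u * indicator D u \<partial>lborel) =
     (\<integral>\<^sup>+ u. (\<integral>\<^sup>+ z. f (z + u) * indicator D (z + u) \<partial>count_space ?Z) * indicator D' u \<partial>lborel)"
    by (rule nn_integral_unfold[OF D']) simp
  also have "\<dots> = (\<integral>\<^sup>+ u. f u * indicator D' u \<partial>lborel)"
  proof (rule nn_integral_cong)
    fix u :: "real ^ 'n"
    obtain z0 where z0: "z0 \<in> ?Z" "u - z0 \<in> D" "\<And>z. z \<in> ?Z \<Longrightarrow> u - z \<in> D \<Longrightarrow> z = z0"
      using D unfolding fundamental_domain_def by metis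
    have "(\<integral>\<^sup>+ z. f (z + u) * indicator D (z + u) \<partial>count_space ?Z) = (\<integral>\<^sup>+ z. f u * indicator {- z0} z \<partial>count_space ?Z)"
    proof (rule nn_integral_cong)
      fix z assume "z \<in> space (count_space ?Z)"
      then have z: "z \<in> ?Z" by simp
      have "z + u \<in> D \<longleftrightarrow> z = - z0"
        using z0(3)[of "- z"] int_lattice_closed(4)[OF z] z0(2) by (auto simp: algebra_simps)
      then show "f (z + u) * indicator D (z + u) = f u * indicator {- z0} z"
        using per[OF z] by (auto simp: indicator_def)
    qed
    also have "\<dots> = f u" using int_lattice_closed(4)[OF z0(1)] by (subst nn_integral_cmult) auto
    finally show "(\<integral>\<^sup>+ z. f (z + u) * indicator D (z + u) \<partial>count_space ?Z) * indicator D' u = f u * indicator D' u"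
      by simp
  qed
  finally show ?thesis .
qed

lemma emeasure_unit_cell: "emeasure lborel (unit_cell :: (real ^ 'n) set) = 1"
proof -
  have "emeasure lborel (unit_cell :: (real ^ 'n) set) = emeasure lborel (cbox (\<chi> i. - 1 / 2) (\<chi> i. 1 / 2) :: (real ^ 'n) set)"
    by (rule emeasure_eq_AE[OF AE_unit_cell_eq_cbox]) simp_all
  also have "\<dots> = 1"
  proof -
    have b: "((\<chi> i. 1 / 2) - (\<chi> i. - 1 / 2)) \<bullet> b = 1" "(\<chi> i. - 1 / 2) \<bullet> b \<le> (\<chi> i. 1 / 2) \<bullet> b"
      if "b \<in> Basis" for b :: "real ^ 'n"
    proof -
      obtain i where "b = axis i 1" using \<open>b \<in> Basis\<close> by (auto simp: Basis_vec_def)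
      then show "((\<chi> i. 1 / 2) - (\<chi> i. - 1 / 2)) \<bullet> b = 1" "(\<chi> i. - 1 / 2) \<bullet> b \<le> (\<chi> i. 1 / 2) \<bullet> b"
        by (simp_all only: inner_axis vector_minus_component vec_lambda_beta) simp_all
    qed
    have "(\<Prod>b\<in>(Basis :: (real ^ 'n) set). ((\<chi> i. 1 / 2) - (\<chi> i. - 1 / 2)) \<bullet> b) = 1"
      by (rule prod.neutral) (use b(1) in blast)
    then show ?thesis by (subst emeasure_lborel_cbox[OF b(2)]) simp_all
  qed
  finally show ?thesis .
qed

lemma emeasure_fundamental_domain:
  fixes D :: "(real ^ 'n) set"
  assumes "fundamental_domain D"
  shows "emeasure lborel D = 1"
proof -
  have "(\<integral>\<^sup>+ u. 1 * indicator D u \<partial>lborel) = (\<integral>\<^sup>+ u. 1 * indicator (unit_cell :: (real ^ 'n) set) u \<partial>lborel)"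
    by (rule nn_integral_fundamental_domain_cong[OF assms fundamental_domain_unit_cell]) auto
  then show ?thesis using assms emeasure_unit_cell by (auto simp: fundamental_domain_def)
qed

definition cell_measure :: "(real ^ 'n) measure" where
  "cell_measure = restrict_space lborel unit_cell"

lemma emeasure_space_cell_measure: "emeasure (cell_measure :: (real ^ 'n) measure) (space cell_measure) = 1"
  by (simp add: cell_measure_def space_restrict_space emeasure_restrict_space emeasure_unit_cell)

lemma measure_space_cell_measure: "measure (cell_measure :: (real ^ 'n) measure) (space cell_measure) = 1"
  by (simp add: measure_def emeasure_space_cell_measure)

lemma finite_measure_cell_measure: "finite_measure (cell_measure :: (real ^ 'n) measure)"
  by (rule finite_measureI) (simp add: emeasure_space_cell_measure)

lemma space_cell_measure: "space cell_measure = unit_cell"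
  by (simp add: cell_measure_def space_restrict_space)

lemma borel_measurable_cell_measure: "f \<in> borel_measurable borel \<Longrightarrow> f \<in> borel_measurable (cell_measure :: (real ^ 'n) measure)"
  unfolding cell_measure_def by (rule measurable_restrict_space1) simp

lemma finite_int_lattice_bounded:
  assumes "bounded A"
  shows "finite {z :: real ^ 'n. z \<in> int_lattice \<and> z \<in> A}"
proof -
  obtain r where r: "\<And>x. x \<in> A \<Longrightarrow> norm x \<le> r" using assms by (auto simp: bounded_iff)
  define F where "F = {f :: 'n \<Rightarrow> int. \<forall>i. f i \<in> {- \<lceil>r\<rceil>..\<lceil>r\<rceil>}}"
  have "F = PiE UNIV (\<lambda>_. {- \<lceil>r\<rceil>..\<lceil>r\<rceil>})" by (auto simp: F_def PiE_UNIV_domain)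
  then have "finite F" by (simp add: finite_PiE)
  moreover have "{z. z \<in> int_lattice \<and> z \<in> A} \<subseteq> (\<lambda>f. \<chi> i. of_int (f i)) ` F"
  proof clarify
    fix z assume z: "z \<in> int_lattice" "z \<in> A"
    from int_lattice_components[OF z(1)] obtain f where f: "\<And>i. z $ i = of_int (f i)" by blast
    have "f i \<in> {- \<lceil>r\<rceil>..\<lceil>r\<rceil>}" for i
    proof -
      have "\<bar>z $ i\<bar> \<le> r" using component_le_norm_cart[of z i] r[OF z(2)] by linarith
      then show ?thesis unfolding f by (auto; linarith)
    qed
    then show "z \<in> (\<lambda>f. \<chi> i. of_int (f i)) ` F"
      using f by (intro image_eqI[of _ _ f]) (auto simp: vec_eq_iff F_def)
  qed
  ultimately show ?thesis using finite_surj by blast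
qed

text \<open>Unfolding of the indicator of \<open>X\<close>. Boundedness keeps the counted sets
  finite, where \<open>card\<close> agrees with the counting measure; on infinite sets it would be
  0.\<close>

lemma measure_eq_integral_count:
  fixes X :: "(real ^ 'n) set"
  assumes X[measurable]: "X \<in> sets borel" and bX: "bounded X"
  defines "cnt \<equiv> (\<lambda>u. real (card {z \<in> int_lattice. z + u \<in> X}))"
  shows "integrable cell_measure cnt" and "measure lborel X = integral\<^sup>L cell_measure cnt"
proof -
  let ?Z = "int_lattice :: (real ^ 'n) set"
  have fin: "finite {z \<in> ?Z. z + u \<in> X}" for u
  proof -
    have "bounded ((\<lambda>x. x - u) ` X)" using bX by (simp add: bounded_translation_minus)
    then have "finite {z. z \<in> ?Z \<and> z \<in> (\<lambda>x. x - u) ` X}" by (rule finite_int_lattice_bounded)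
    then show ?thesis by (rule rev_finite_subset) (auto simp: image_iff intro!: bexI[of _ "_ + u"])
  qed
  have nn: "(\<integral>\<^sup>+ z. indicator X (z + u) \<partial>count_space ?Z) = ennreal (cnt u)" for u
  proof -
    have "(\<integral>\<^sup>+ z. indicator X (z + u) \<partial>count_space ?Z) = (\<integral>\<^sup>+ z. indicator {z \<in> ?Z. z + u \<in> X} z \<partial>count_space ?Z)"
      by (intro nn_integral_cong) (auto simp: indicator_def)
    also have "\<dots> = emeasure (count_space ?Z) {z \<in> ?Z. z + u \<in> X}" by (rule nn_integral_indicator) auto
    also have "\<dots> = ennreal (cnt u)" using fin by (simp add: emeasure_count_space_finite cnt_def ennreal_of_nat_eq_real_of_nat)
    finally show ?thesis .
  qed
  interpret Z: sigma_finite_measure "count_space ?Z"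
    by (rule sigma_finite_measure_count_space_countable[OF countable_int_lattice])
  have m0: "(\<lambda>(z, u). indicator X (z + u) :: ennreal) \<in> borel_measurable (count_space ?Z \<Otimes>\<^sub>M borel)"
    by (rule measurable_pair_measure_countable1[OF countable_int_lattice]) simp
  have "(\<lambda>u. \<integral>\<^sup>+ z. indicator X (z + u) \<partial>count_space ?Z) \<in> borel_measurable borel"
  proof (rule Z.borel_measurable_nn_integral)
    show "(\<lambda>(u, z). indicator X (z + u) :: ennreal) \<in> borel_measurable (borel \<Otimes>\<^sub>M count_space ?Z)"
      using measurable_compose[OF measurable_pair_swap' m0] by (simp add: case_prod_beta')
  qed
  then have "(\<lambda>u. enn2real (ennreal (cnt u))) \<in> borel_measurable borel"
    unfolding nn by (rule borel_measurable_enn2real)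
  then have m: "cnt \<in> borel_measurable borel" by (simp add: cnt_def)
  have "emeasure lborel X = (\<integral>\<^sup>+ x. indicator X x \<partial>lborel)" by (simp only: nn_integral_indicator sets_lborel X)
  also have "\<dots> = (\<integral>\<^sup>+ u. (\<integral>\<^sup>+ z. indicator X (z + u) \<partial>count_space ?Z) * indicator unit_cell u \<partial>lborel)"
    by (rule nn_integral_unfold[OF fundamental_domain_unit_cell]) simp
  also have "\<dots> = (\<integral>\<^sup>+ u. ennreal (cnt u) * indicator unit_cell u \<partial>lborel)"
    by (simp only: nn)
  also have "\<dots> = (\<integral>\<^sup>+ u. ennreal (cnt u) \<partial>cell_measure)"
    unfolding cell_measure_def by (rule nn_integral_restrict_space[symmetric]) simp
  finally have e: "(\<integral>\<^sup>+ u. ennreal (cnt u) \<partial>cell_measure) = emeasure lborel X" by simp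
  moreover have fin': "emeasure lborel X < \<infinity>" using bX by (rule emeasure_bounded_finite)
  ultimately have "(\<integral>\<^sup>+ u. ennreal (cnt u) \<partial>cell_measure) < \<infinity>" by simp
  then show "integrable cell_measure cnt"
    by (intro integrableI_nonneg borel_measurable_cell_measure m AE_I2) (auto simp: cnt_def)
  have "integral\<^sup>L cell_measure cnt = enn2real (\<integral>\<^sup>+ u. ennreal (cnt u) \<partial>cell_measure)"
    by (intro integral_eq_nn_integral borel_measurable_cell_measure m AE_I2) (simp add: cnt_def)
  then show "measure lborel X = integral\<^sup>L cell_measure cnt" unfolding e by (simp only: measure_def)
qed

section \<open>Mean values over the unit cell\<close>

lemma lborel_distr_uminus_euclidean:
  "distr lborel borel uminus = (lborel :: 'a::euclidean_space measure)"
  by (subst lborel_affine[of "- 1" 0]) (auto simp: density_1 one_ennreal_def[symmetric])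

lemma fundamental_domain_translate:
  fixes D :: "(real ^ 'n) set"
  assumes "fundamental_domain D"
  shows "fundamental_domain {x. x - a \<in> D}"
  unfolding fundamental_domain_def
proof (intro conjI allI)
  have [measurable]: "D \<in> sets borel" using assms by (simp add: fundamental_domain_def)
  show "{x. x - a \<in> D} \<in> sets borel" by measurable
  fix x
  have "\<exists>!z. z \<in> int_lattice \<and> (x - a) - z \<in> D" using assms by (simp add: fundamental_domain_def)
  moreover have "(x - a) - z = (x - z) - a" for z by simp
  ultimately show "\<exists>!z. z \<in> int_lattice \<and> x - z \<in> {x. x - a \<in> D}" by simp
qed

lemma fundamental_domain_uminus:
  fixes D :: "(real ^ 'n) set"
  assumes "fundamental_domain D"
  shows "fundamental_domain {x. - x \<in> D}"
  unfolding fundamental_domain_def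
proof (intro conjI allI)
  have [measurable]: "D \<in> sets borel" using assms by (simp add: fundamental_domain_def)
  show "{x. - x \<in> D} \<in> sets borel" by measurable
  fix x
  have "\<exists>!z. z \<in> int_lattice \<and> (- x) - z \<in> D" using assms by (simp add: fundamental_domain_def)
  then obtain z where z: "z \<in> int_lattice" "- x - z \<in> D"
    and uniq: "\<And>z'. z' \<in> int_lattice \<Longrightarrow> - x - z' \<in> D \<Longrightarrow> z' = z" by blast
  show "\<exists>!z. z \<in> int_lattice \<and> x - z \<in> {x. - x \<in> D}"
  proof (rule ex1I[of _ "- z"])
    have "- (x - - z) = - x - z" by simp
    then show "- z \<in> int_lattice \<and> x - - z \<in> {x. - x \<in> D}" using z int_lattice_closed(4) by (metis mem_Collect_eq)
    fix z' assume z': "z' \<in> int_lattice \<and> x - z' \<in> {x. - x \<in> D}"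
    have "- (x - z') = - x - - z'" by simp
    then have "- z' = z" using z' int_lattice_closed(4)[of z'] by (intro uniq) auto
    then show "z' = - z" by auto
  qed
qed

lemma frac_add_int: "k \<in> \<int> \<Longrightarrow> frac (x + k) = frac (x :: real)"
  by (auto simp: frac_def elim!: Ints_cases)

text \<open>Let \<open>J\<close> be the integral for \<open>frac (v \<bullet> u)\<close>.
  Translation by \<open>c *\<^sub>R w\<close> removes \<open>c\<close> and reflection removes the
  sign; both move the cell to another fundamental domain, on which the periodic integrand has the
  same integral. Since \<open>frac y + frac (- y) = 1\<close> off the integers, \<open>J + J\<close>
  is the volume of the cell.\<close>

lemma nn_integral_frac_cell:
  fixes v w :: "real ^ 'n"
  assumes v: "v \<in> int_lattice" and w: "w \<in> int_lattice" "v \<bullet> w = 1"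
  shows "(\<integral>\<^sup>+ u. ennreal (frac (c - v \<bullet> u)) * indicator unit_cell u \<partial>lborel) = ennreal (1 / 2)"
proof -
  let ?C = "unit_cell :: (real ^ 'n) set"
  define J where "J = (\<integral>\<^sup>+ u. ennreal (frac (v \<bullet> u)) * indicator ?C u \<partial>lborel)"
  have fm[measurable]: "(frac :: real \<Rightarrow> real) \<in> borel_measurable borel" unfolding frac_def by measurable
  have per: "ennreal (frac (b - v \<bullet> (z + u))) = ennreal (frac (b - v \<bullet> u))" if "z \<in> int_lattice" for z u b
    using frac_add_int[of "- (v \<bullet> z)" "b - v \<bullet> u"] int_lattice_inner[OF v that]
    by (simp add: inner_add_right algebra_simps)
  have J_neg: "(\<integral>\<^sup>+ u. ennreal (frac (- (v \<bullet> u))) * indicator ?C u \<partial>lborel) = J"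
  proof -
    have "(\<integral>\<^sup>+ u. ennreal (frac (- (v \<bullet> u))) * indicator ?C u \<partial>lborel) =
      (\<integral>\<^sup>+ u. ennreal (frac (0 - v \<bullet> u)) * indicator {x. - x \<in> ?C} u \<partial>lborel)"
      using nn_integral_fundamental_domain_cong[OF fundamental_domain_unit_cell
        fundamental_domain_uminus[OF fundamental_domain_unit_cell], of "\<lambda>u. ennreal (frac (0 - v \<bullet> u))"] per[of _ 0]
      by simp
    also have "\<dots> = (\<integral>\<^sup>+ u. ennreal (frac (0 - v \<bullet> u)) * indicator {x. - x \<in> ?C} u \<partial>distr lborel borel uminus)"
      by (simp add: lborel_distr_uminus_euclidean)
    also have "\<dots> = (\<integral>\<^sup>+ u. ennreal (frac (v \<bullet> u)) * indicator ?C u \<partial>lborel)"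
      by (subst nn_integral_distr) (auto simp: indicator_def)
    finally show ?thesis by (simp add: J_def)
  qed
  have Jc: "(\<integral>\<^sup>+ u. ennreal (frac (c - v \<bullet> u)) * indicator ?C u \<partial>lborel) = J" for c
  proof -
    have "(\<integral>\<^sup>+ u. ennreal (frac (c - v \<bullet> u)) * indicator ?C u \<partial>lborel) =
      (\<integral>\<^sup>+ u. ennreal (frac (c - v \<bullet> u)) * indicator {x. x - c *\<^sub>R w \<in> ?C} u \<partial>lborel)"
      using nn_integral_fundamental_domain_cong[OF fundamental_domain_unit_cell
        fundamental_domain_translate[OF fundamental_domain_unit_cell], of "\<lambda>u. ennreal (frac (c - v \<bullet> u))" "c *\<^sub>R w"]
        per[of _ c] by simp
    also have "\<dots> = (\<integral>\<^sup>+ u. ennreal (frac (c - v \<bullet> u)) * indicator {x. x - c *\<^sub>R w \<in> ?C} u \<partial>distr lborel borel ((+) (c *\<^sub>R w)))"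
      by (simp add: lborel_distr_plus)
    also have "\<dots> = (\<integral>\<^sup>+ u. ennreal (frac (- (v \<bullet> u))) * indicator ?C u \<partial>lborel)"
      by (subst nn_integral_distr) (auto simp: indicator_def inner_add_right w(2))
    finally show ?thesis by (simp add: J_neg)
  qed
  \<comment> \<open>The identity fails only where \<open>v \<bullet> u\<close> is an integer, on
    countably many hyperplanes of measure 0.\<close>
  have ae: "AE u in lborel. frac (v \<bullet> u) + frac (- (v \<bullet> u)) = 1"
  proof -
    have "AE u in lborel. v \<bullet> u \<noteq> of_int k" for k :: int
    proof -
      have "negligible {x. v \<bullet> x = of_int k}" using w(2) by (intro negligible_hyperplane) auto
      then have "{x. v \<bullet> x = of_int k} \<in> null_sets lebesgue" by (simp add: negligible_iff_null_sets)
      then have "AE u in lebesgue. u \<notin> {x. v \<bullet> x = of_int k}" by (rule AE_not_in)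
      then show ?thesis by (simp add: AE_completion_iff)
    qed
    then have "AE u in lborel. \<forall>k :: int. v \<bullet> u \<noteq> of_int k" by (simp add: AE_all_countable)
    then show ?thesis
      by (rule AE_mp) (auto intro!: AE_I2 simp: frac_neg elim!: Ints_cases)
  qed
  have "J + J = (\<integral>\<^sup>+ u. ennreal (frac (v \<bullet> u)) * indicator ?C u + ennreal (frac (- (v \<bullet> u))) * indicator ?C u \<partial>lborel)"
    by (subst nn_integral_add) (simp_all add: J_def[symmetric] J_neg)
  also have "\<dots> = (\<integral>\<^sup>+ u. indicator ?C u \<partial>lborel)"
  proof (rule nn_integral_cong_AE, rule AE_mp[OF ae], rule AE_I2, rule impI)
    fix u assume h: "frac (v \<bullet> u) + frac (- (v \<bullet> u)) = 1"
    have "ennreal (frac (v \<bullet> u)) + ennreal (frac (- (v \<bullet> u))) = 1"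
      using h by (subst ennreal_plus[symmetric]) simp_all
    then show "ennreal (frac (v \<bullet> u)) * indicator ?C u + ennreal (frac (- (v \<bullet> u))) * indicator ?C u = indicator ?C u"
      by (simp add: indicator_def)
  qed
  also have "\<dots> = 1" by (simp add: emeasure_unit_cell)
  finally have JJ: "J + J = 1" .
  then obtain r where r: "J = ennreal r" "r \<ge> 0" by (cases J) auto
  then have "r + r = 1" using JJ by (simp add: ennreal_plus[symmetric] del: ennreal_plus)
  then have "r = 1 / 2" by simp
  then show ?thesis using Jc[of c] r(1) by (simp only:)
qed

lemma integral_inner_cell:
  fixes v :: "real ^ 'n"
  shows "integrable cell_measure (\<lambda>u. v \<bullet> u)" and "integral\<^sup>L cell_measure (\<lambda>u. v \<bullet> u) = 0"
proof -
  interpret finite_measure "cell_measure :: (real ^ 'n) measure" by (rule finite_measure_cell_measure)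
  show int: "integrable cell_measure (\<lambda>u. v \<bullet> u)"
  proof (rule integrable_const_bound[where B = "norm v * real CARD('n)"])
    show "AE u in cell_measure. norm (v \<bullet> u) \<le> norm v * real CARD('n)"
    proof (rule AE_I2)
      fix u :: "real ^ 'n" assume "u \<in> space cell_measure"
      then have "norm u \<le> real CARD('n)" using unit_cell_norm by (auto simp: space_cell_measure)
      then show "norm (v \<bullet> u) \<le> norm v * real CARD('n)"
        using Cauchy_Schwarz_ineq2[of v u] by (metis mult_left_mono norm_ge_zero order_trans real_norm_def)
    qed
  qed (rule borel_measurable_cell_measure, simp)
  \<comment> \<open>Negation preserves the closed cube and changes the sign of the integrand, so the
    integral equals its own negative.\<close>
  let ?B = "cbox (\<chi> i. - 1 / 2) (\<chi> i. 1 / 2) :: (real ^ 'n) set"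
  have "integral\<^sup>L cell_measure (\<lambda>u. v \<bullet> u) = (LINT u|lborel. indicator unit_cell u *\<^sub>R (v \<bullet> u))"
    unfolding cell_measure_def by (subst integral_restrict_space) auto
  also have "\<dots> = (LINT u|lborel. indicator ?B u *\<^sub>R (v \<bullet> u))"
    by (rule integral_cong_AE, simp, simp, rule AE_mp[OF AE_unit_cell_eq_cbox]) (rule AE_I2, simp add: indicator_def)
  finally have 1: "integral\<^sup>L cell_measure (\<lambda>u. v \<bullet> u) = (LINT u|lborel. indicator ?B u *\<^sub>R (v \<bullet> u))" .
  have "(LINT u|lborel. indicator ?B u *\<^sub>R (v \<bullet> u)) = (LINT u|distr lborel borel uminus. indicator ?B u *\<^sub>R (v \<bullet> u))"
    by (simp add: lborel_distr_uminus_euclidean)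
  also have "\<dots> = (LINT u|lborel. indicator ?B (- u) *\<^sub>R (v \<bullet> (- u)))"
    by (rule integral_distr) auto
  also have "\<dots> = (LINT u|lborel. - (indicator ?B u *\<^sub>R (v \<bullet> u)))"
  proof (rule Bochner_Integration.integral_cong[OF refl])
    fix u :: "real ^ 'n"
    have "(- 1 / 2 \<le> - (u $ i) \<and> - (u $ i) \<le> 1 / 2) = (- 1 / 2 \<le> u $ i \<and> u $ i \<le> 1 / 2)" for i by linarith
    then have "- u \<in> ?B \<longleftrightarrow> u \<in> ?B" by (simp only: mem_box_cart vector_uminus_component vec_lambda_beta)
    then show "indicator ?B (- u) *\<^sub>R (v \<bullet> (- u)) = - (indicator ?B u *\<^sub>R (v \<bullet> u))" by (simp add: indicator_def)
  qed
  also have "\<dots> = - (LINT u|lborel. indicator ?B u *\<^sub>R (v \<bullet> u))" by (rule integral_minus)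
  finally show "integral\<^sup>L cell_measure (\<lambda>u. v \<bullet> u) = 0" using 1 by simp
qed

text \<open>The floor of \<open>y = c - v \<bullet> u\<close> is \<open>y - frac y\<close>: the
  linear part has mean \<open>c\<close> by symmetry of the cell, the fractional part has mean
  1/2.\<close>

lemma integral_floor_cell:
  fixes v w :: "real ^ 'n"
  assumes v: "v \<in> int_lattice" and w: "w \<in> int_lattice" "v \<bullet> w = 1"
  shows "integrable cell_measure (\<lambda>u. real_of_int \<lfloor>c - v \<bullet> u\<rfloor>)"
    and "integral\<^sup>L cell_measure (\<lambda>u. real_of_int \<lfloor>c - v \<bullet> u\<rfloor>) = c - 1 / 2"
proof -
  interpret finite_measure "cell_measure :: (real ^ 'n) measure" by (rule finite_measure_cell_measure)
  have fm[measurable]: "(frac :: real \<Rightarrow> real) \<in> borel_measurable borel" unfolding frac_def by measurable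
  have m: "(\<lambda>u. frac (c - v \<bullet> u)) \<in> borel_measurable cell_measure"
    by (rule borel_measurable_cell_measure) simp
  have int: "integrable cell_measure (\<lambda>u. frac (c - v \<bullet> u))"
    by (rule integrable_const_bound[where B = 1, OF _ m]) (simp add: frac_lt_1 less_imp_le)
  have "integral\<^sup>L cell_measure (\<lambda>u. frac (c - v \<bullet> u)) = enn2real (\<integral>\<^sup>+ u. ennreal (frac (c - v \<bullet> u)) \<partial>cell_measure)"
    by (intro integral_eq_nn_integral m AE_I2) simp
  also have "(\<integral>\<^sup>+ u. ennreal (frac (c - v \<bullet> u)) \<partial>cell_measure) =
     (\<integral>\<^sup>+ u. ennreal (frac (c - v \<bullet> u)) * indicator unit_cell u \<partial>lborel)"
    unfolding cell_measure_def by (rule nn_integral_restrict_space) simp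
  also have "\<dots> = ennreal (1 / 2)" by (rule nn_integral_frac_cell[OF assms])
  finally have fr: "integral\<^sup>L cell_measure (\<lambda>u. frac (c - v \<bullet> u)) = 1 / 2" by (simp only: enn2real_ennreal)
  have eq: "real_of_int \<lfloor>c - v \<bullet> u\<rfloor> = c - v \<bullet> u - frac (c - v \<bullet> u)" for u by (simp add: frac_def)
  show "integrable cell_measure (\<lambda>u. real_of_int \<lfloor>c - v \<bullet> u\<rfloor>)"
    unfolding eq by (intro Bochner_Integration.integrable_diff integral_inner_cell int) simp
  have "integral\<^sup>L cell_measure (\<lambda>u. c - v \<bullet> u) = c"
    using integral_inner_cell[of v] by (simp add: Bochner_Integration.integral_diff measure_space_cell_measure)
  then show "integral\<^sup>L cell_measure (\<lambda>u. real_of_int \<lfloor>c - v \<bullet> u\<rfloor>) = c - 1 / 2"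
    unfolding eq using integral_inner_cell(1)[of v] int fr
    by (subst Bochner_Integration.integral_diff) auto
qed

section \<open>Volumes of skew cylinders\<close>

lemma orthonormal_basis_of_finite:
  assumes "orthonormal_basis_of B V"
  shows "finite B" "independent B"
proof -
  have "0 \<notin> B" using assms by (auto simp: orthonormal_basis_of_def)
  then show "independent B"
    using assms pairwise_orthogonal_independent by (auto simp: orthonormal_basis_of_def)
  then show "finite B" by (rule independent_imp_finite)
qed

lemma orthonormal_basis_of_exists:
  assumes "subspace V"
  shows "\<exists>B. orthonormal_basis_of B V"
  using orthonormal_basis_subspace[OF assms] by (metis orthonormal_basis_of_def)

lemma orthonormal_inner:
  assumes "orthonormal_basis_of B V" "b \<in> B" "b' \<in> B"
  shows "b \<bullet> b' = (if b = b' then 1 else 0)"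
  using assms by (auto simp: orthonormal_basis_of_def pairwise_def orthogonal_def norm_eq_1)

lemma orthonormal_sum_inner:
  assumes B: "orthonormal_basis_of B V" and b: "b \<in> B"
  shows "(\<Sum>b'\<in>B. c b' *\<^sub>R b') \<bullet> b = c b"
proof -
  have "(\<Sum>b'\<in>B. c b' *\<^sub>R b') \<bullet> b = (\<Sum>b'\<in>B. if b' = b then c b' else 0)"
    unfolding inner_sum_left by (intro sum.cong) (auto simp: orthonormal_inner[OF B _ b])
  also have "\<dots> = c b" using b orthonormal_basis_of_finite(1)[OF B] by simp
  finally show ?thesis .
qed

lemma orthonormal_expansion:
  assumes B: "orthonormal_basis_of B V" and x: "x \<in> V"
  shows "(\<Sum>b\<in>B. (x \<bullet> b) *\<^sub>R b) = x"
proof -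
  have "x \<in> span B" using B x by (simp add: orthonormal_basis_of_def)
  then obtain c where c: "x = (\<Sum>b\<in>B. c b *\<^sub>R b)"
    using span_finite[OF orthonormal_basis_of_finite(1)[OF B]] by auto
  have "x \<bullet> b = c b" if "b \<in> B" for b unfolding c by (rule orthonormal_sum_inner[OF B that])
  then show ?thesis using c by simp
qed

text \<open>
  Evaluating the convolution of the image measure with the indicator of the unit ball in both
  orders shows that the two measures agree, because \<open>f\<close> preserves the ball.
\<close>

lemma lborel_distr_orthogonal:
  fixes f :: "'a::euclidean_space \<Rightarrow> 'a"
  assumes "orthogonal_transformation f"
  shows "distr lborel borel f = lborel"
proof (rule measure_eqI)
  show "sets (distr lborel borel f) = sets lborel" by simp
  fix A assume "A \<in> sets (distr lborel borel f)"
  then have A[measurable]: "A \<in> sets borel" by simp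
  note lin = orthogonal_transformation_linear[OF assms]
  have fm[measurable]: "f \<in> borel_measurable borel"
    using lin by (intro borel_measurable_continuous_onI linear_continuous_on) (simp add: linear_conv_bounded_linear)
  have surj: "surj f" using assms by (rule orthogonal_transformation_surj)
  let ?B = "ball (0 :: 'a) 1"
  have Bm[measurable]: "?B \<in> sets borel" by simp
  have ball: "emeasure lborel (ball a 1) = emeasure lborel ?B" for a :: 'a
    by (simp add: emeasure_ball)
  \<comment> \<open>Every shift \<open>y\<close> is some \<open>f y'\<close>, so it can be moved
    inside \<open>f\<close>, where translation invariance of Lebesgue measure removes it.\<close>
  have inner: "(\<integral>\<^sup>+ x. indicator A (f x + y) \<partial>lborel) = emeasure (distr lborel borel f) A" for y
  proof -
    obtain y' where y': "y = f y'" using surj by (metis surjD)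
    have "emeasure (distr lborel borel f) A = (\<integral>\<^sup>+ x. indicator A x \<partial>distr lborel borel f)"
      by simp
    also have "\<dots> = (\<integral>\<^sup>+ x. indicator A (f x) \<partial>lborel)"
      by (rule nn_integral_distr) auto
    also have "\<dots> = (\<integral>\<^sup>+ x. indicator A (f x) \<partial>distr lborel borel ((+) y'))"
      by (simp only: lborel_distr_plus)
    also have "\<dots> = (\<integral>\<^sup>+ x. indicator A (f (y' + x)) \<partial>lborel)"
      by (rule nn_integral_distr) auto
    also have "\<dots> = (\<integral>\<^sup>+ x. indicator A (f x + y) \<partial>lborel)"
      by (simp add: linear_add[OF lin] y' add.commute)
    finally show ?thesis by simp
  qed
  have "emeasure (distr lborel borel f) A * emeasure lborel ?B =
    (\<integral>\<^sup>+ y. (\<integral>\<^sup>+ x. indicator A (f x + y) \<partial>lborel) * indicator ?B y \<partial>lborel)"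
    unfolding inner by (rule nn_integral_cmult_indicator[symmetric]) simp
  also have "\<dots> = (\<integral>\<^sup>+ y. (\<integral>\<^sup>+ x. indicator A (f x + y) * indicator ?B y \<partial>lborel) \<partial>lborel)"
    by (intro nn_integral_cong nn_integral_multc[symmetric]) measurable
  also have "\<dots> = (\<integral>\<^sup>+ x. (\<integral>\<^sup>+ y. indicator A (f x + y) * indicator ?B y \<partial>lborel) \<partial>lborel)"
    by (rule lborel_pair.Fubini') measurable
  also have "\<dots> = (\<integral>\<^sup>+ x. (\<integral>\<^sup>+ y. indicator A y * indicator ?B (y - f x) \<partial>lborel) \<partial>lborel)"
  proof (rule nn_integral_cong)
    fix x
    have "(\<integral>\<^sup>+ y. indicator A y * indicator ?B (y - f x) \<partial>lborel) =
      (\<integral>\<^sup>+ y. indicator A y * indicator ?B (y - f x) \<partial>distr lborel borel ((+) (f x)) :: ennreal)"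
      by (simp only: lborel_distr_plus)
    also have "\<dots> = (\<integral>\<^sup>+ y. indicator A (f x + y) * indicator ?B (f x + y - f x) \<partial>lborel)"
      by (rule nn_integral_distr) measurable
    finally show "(\<integral>\<^sup>+ y. indicator A (f x + y) * indicator ?B y \<partial>lborel) =
      (\<integral>\<^sup>+ y. indicator A y * indicator ?B (y - f x) \<partial>lborel :: ennreal)" by simp
  qed
  also have "\<dots> = (\<integral>\<^sup>+ y. (\<integral>\<^sup>+ x. indicator A y * indicator ?B (y - f x) \<partial>lborel) \<partial>lborel)"
    by (rule lborel_pair.Fubini') measurable
  also have "\<dots> = (\<integral>\<^sup>+ y. emeasure lborel ?B * indicator A y \<partial>lborel)"
  proof (rule nn_integral_cong)
    fix y
    obtain y' where y': "y = f y'" using surj by (metis surjD)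
    have "indicator ?B (y - f x) = (indicator (ball y' 1) x :: ennreal)" for x
      using orthogonal_transformation_norm[OF assms, of "y' - x"]
      by (simp add: indicator_def y' linear_diff[OF lin] dist_norm norm_minus_commute)
    then have "(\<integral>\<^sup>+ x. indicator A y * indicator ?B (y - f x) \<partial>lborel) =
       (\<integral>\<^sup>+ x. indicator A y * indicator (ball y' 1) x \<partial>lborel)" by simp
    also have "\<dots> = indicator A y * emeasure lborel ?B"
      by (subst nn_integral_cmult) (simp_all add: ball[of y'] borel_measurable_indicator)
    finally show "(\<integral>\<^sup>+ x. indicator A y * indicator ?B (y - f x) \<partial>lborel) = emeasure lborel ?B * indicator A y"
      by (simp add: mult.commute)
  qed
  also have "\<dots> = emeasure lborel A * emeasure lborel ?B"
    by (subst nn_integral_cmult_indicator) (simp_all add: mult.commute)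
  finally have eq: "emeasure (distr lborel borel f) A * emeasure lborel ?B = emeasure lborel A * emeasure lborel ?B" .
  have "emeasure lborel ?B \<noteq> \<infinity>" using emeasure_bounded_finite[of ?B] by auto
  moreover have "emeasure lborel ?B \<noteq> 0"
    by (subst emeasure_ball) (auto simp: unit_ball_vol_pos less_imp_neq[symmetric])
  ultimately show "emeasure (distr lborel borel f) A = emeasure lborel A"
    using eq by (simp add: mult.commute[of _ "emeasure lborel ?B"] ennreal_mult_cancel_left)
qed

lemma product_sigma_finite_lborel: "product_sigma_finite (\<lambda>_ :: 'i. lborel :: real measure)"
  by standard

text \<open>Lebesgue measure is the product measure in standard coordinates. A bijection from the
  standard basis onto \<open>B\<close> extends to an orthogonal map, which preserves Lebesgue
  measure and carries one description to the other. This links \<open>affine_volume\<close>,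
  measured in orthonormal coordinates of a hyperplane, with volumes of solid sets.\<close>

lemma lborel_orthonormal_coordinates:
  fixes B :: "(real ^ 'n) set"
  assumes B: "orthonormal_basis_of B UNIV"
  shows "distr (\<Pi>\<^sub>M b\<in>B. lborel) borel (\<lambda>c. \<Sum>b\<in>B. c b *\<^sub>R b) = lborel"
proof -
  note fin = orthonormal_basis_of_finite(1)[OF B]
  interpret P: product_sigma_finite "\<lambda>_ :: real ^ 'n. lborel :: real measure"
    by (rule product_sigma_finite_lborel)
  let ?T = "\<lambda>c :: real ^ 'n \<Rightarrow> real. \<Sum>b\<in>B. c b *\<^sub>R b"
  let ?S = "\<lambda>x :: real ^ 'n. \<lambda>b\<in>B. x \<bullet> b"
  have card: "card B = card (Basis :: (real ^ 'n) set)"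
    using orthonormal_basis_of_finite[OF B] B dim_eq_card[of B UNIV]
    by (simp add: orthonormal_basis_of_def)
  obtain \<pi> where \<pi>: "bij_betw \<pi> (Basis :: (real ^ 'n) set) B"
    using card fin finite_same_card_bij[of "Basis :: (real ^ 'n) set" B] by auto
  define f where "f = (\<lambda>x :: real ^ 'n. \<Sum>i\<in>Basis. (x \<bullet> i) *\<^sub>R \<pi> i)"
  have \<pi>B: "\<pi> i \<in> B" if "i \<in> Basis" for i using \<pi> that by (auto simp: bij_betw_def)
  have \<pi>i: "\<pi> i \<bullet> \<pi> j = (if i = j then 1 else 0)" if "i \<in> Basis" "j \<in> Basis" for i j
    using orthonormal_inner[OF B \<pi>B \<pi>B, OF that] that \<pi> by (auto simp: bij_betw_def inj_on_eq_iff)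
  have f\<pi>: "f x \<bullet> \<pi> j = x \<bullet> j" if j: "j \<in> Basis" for x j
  proof -
    have "f x \<bullet> \<pi> j = (\<Sum>i\<in>Basis. if i = j then x \<bullet> i else 0)"
      unfolding f_def inner_sum_left using \<pi>i[OF _ j] by (intro sum.cong) auto
    then show ?thesis using j by simp
  qed
  have "f x \<bullet> f y = x \<bullet> y" for x y
  proof -
    have "f x \<bullet> f y = (\<Sum>i\<in>Basis. (y \<bullet> i) * (f x \<bullet> \<pi> i))"
      by (subst (2) f_def) (simp add: inner_sum_right)
    also have "\<dots> = (\<Sum>i\<in>Basis. (x \<bullet> i) * (y \<bullet> i))" using f\<pi> by (intro sum.cong) auto
    finally show ?thesis by (simp add: euclidean_inner[of x y])
  qed
  moreover have "linear f"
    unfolding f_def by (intro linearI) (simp_all add: inner_add_left scaleR_add_left sum.distrib scaleR_sum_right)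
  ultimately have orth: "orthogonal_transformation f" by (simp add: orthogonal_transformation_def)
  have fm[measurable]: "f \<in> borel_measurable borel"
    unfolding f_def by measurable
  have Sm: "?S \<in> measurable lborel (\<Pi>\<^sub>M b\<in>B. lborel)" by measurable
  have "distr lborel (\<Pi>\<^sub>M b\<in>B. lborel) ?S = (\<Pi>\<^sub>M b\<in>B. lborel)"
  proof (rule P.PiM_eqI[OF fin])
    fix A :: "real ^ 'n \<Rightarrow> real set" assume A: "\<And>b. b \<in> B \<Longrightarrow> A b \<in> sets lborel"
    then have A': "\<And>i. i \<in> Basis \<Longrightarrow> A (\<pi> i) \<in> sets lborel" using \<pi>B by simp
    have Am: "{x :: real ^ 'n. \<forall>b\<in>B. x \<bullet> b \<in> A b} \<in> sets borel"
    proof -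
      have "{x \<in> space borel. \<forall>b\<in>B. (x :: real ^ 'n) \<bullet> b \<in> A b} \<in> sets borel"
      proof (rule sets.sets_Collect_finite_All[OF _ fin])
        fix b assume "b \<in> B"
        then have [measurable]: "A b \<in> sets borel" using A by simp
        show "{x \<in> space borel. (x :: real ^ 'n) \<bullet> b \<in> A b} \<in> sets borel" by measurable
      qed
      then show ?thesis by simp
    qed
    have "emeasure (distr lborel (\<Pi>\<^sub>M b\<in>B. lborel) ?S) (Pi\<^sub>E B A) = emeasure lborel (?S -` Pi\<^sub>E B A \<inter> space lborel)"
      using fin A by (intro emeasure_distr Sm sets_PiM_I_finite) auto
    also have "?S -` Pi\<^sub>E B A \<inter> space lborel = {x. \<forall>b\<in>B. x \<bullet> b \<in> A b}"
      by (auto simp: PiE_iff)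
    also have "emeasure lborel \<dots> = emeasure (distr lborel borel f) {x. \<forall>b\<in>B. x \<bullet> b \<in> A b}"
      by (simp only: lborel_distr_orthogonal[OF orth])
    also have "\<dots> = emeasure lborel (f -` {x. \<forall>b\<in>B. x \<bullet> b \<in> A b} \<inter> space lborel)"
      using Am by (intro emeasure_distr) auto
    also have "f -` {x. \<forall>b\<in>B. x \<bullet> b \<in> A b} \<inter> space lborel = {x. \<forall>i\<in>Basis. x \<bullet> i \<in> A (\<pi> i)}"
    proof -
      have "(\<forall>b\<in>B. f x \<bullet> b \<in> A b) \<longleftrightarrow> (\<forall>i\<in>Basis. x \<bullet> i \<in> A (\<pi> i))" for x
        using f\<pi> \<pi> by (force simp: bij_betw_def)
      then show ?thesis by auto
    qed
    also have "emeasure lborel \<dots> = emeasure (distr (\<Pi>\<^sub>M b\<in>Basis. lborel) borel (\<lambda>c :: real ^ 'n \<Rightarrow> real. \<Sum>b\<in>Basis. c b *\<^sub>R b)) \<dots>"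
      by (simp only: lborel_eq[symmetric])
    also have "\<dots> = emeasure (\<Pi>\<^sub>M b\<in>(Basis :: (real ^ 'n) set). lborel) (Pi\<^sub>E Basis (\<lambda>i. A (\<pi> i)))"
    proof (subst emeasure_distr)
      show "{x :: real ^ 'n. \<forall>i\<in>Basis. x \<bullet> i \<in> A (\<pi> i)} \<in> sets borel"
      proof -
        have "{x \<in> space borel. \<forall>i\<in>Basis. (x :: real ^ 'n) \<bullet> i \<in> A (\<pi> i)} \<in> sets borel"
        proof (rule sets.sets_Collect_finite_All[OF _ finite_Basis])
          fix b :: "real ^ 'n" assume "b \<in> Basis"
          then have [measurable]: "A (\<pi> b) \<in> sets borel" using A' by simp
          show "{x \<in> space borel. (x :: real ^ 'n) \<bullet> b \<in> A (\<pi> b)} \<in> sets borel" by measurable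
        qed
        then show ?thesis by simp
      qed
    qed (auto intro!: arg_cong2[where f = emeasure] simp: space_PiM PiE_iff)
    also have "\<dots> = (\<Prod>i\<in>Basis. emeasure lborel (A (\<pi> i)))"
      using A' by (intro P.emeasure_PiM) auto
    also have "\<dots> = (\<Prod>b\<in>B. emeasure lborel (A b))"
      using prod.reindex_bij_betw[OF \<pi>, of "\<lambda>b. emeasure lborel (A b)"] by simp
    finally show "emeasure (distr lborel (\<Pi>\<^sub>M b\<in>B. lborel) ?S) (Pi\<^sub>E B A) = (\<Prod>b\<in>B. emeasure lborel (A b))" .
  qed simp
  then have "distr (\<Pi>\<^sub>M b\<in>B. lborel) borel ?T = distr (distr lborel (\<Pi>\<^sub>M b\<in>B. lborel) ?S) borel ?T"
    by simp
  also have "\<dots> = distr lborel borel (?T \<circ> ?S)"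
    by (rule distr_distr) (use Sm in auto)
  also have "?T \<circ> ?S = (\<lambda>x. x)"
  proof
    fix x
    have "(?T \<circ> ?S) x = (\<Sum>b\<in>B. (x \<bullet> b) *\<^sub>R b)" by simp
    then show "(?T \<circ> ?S) x = x" using orthonormal_expansion[OF B, of x] by simp
  qed
  also have "distr lborel borel (\<lambda>x. x) = lborel" by (rule distr_id2) simp
  finally show ?thesis .
qed

lemma PiM_lborel_translate:
  fixes a :: "'i \<Rightarrow> real"
  assumes fin: "finite B"
  shows "distr (\<Pi>\<^sub>M b\<in>B. lborel) (\<Pi>\<^sub>M b\<in>B. lborel) (\<lambda>c. \<lambda>b\<in>B. c b + a b) = (\<Pi>\<^sub>M b\<in>B. lborel)"
proof -
  interpret P: product_sigma_finite "\<lambda>_ :: 'i. lborel :: real measure"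
    by (rule product_sigma_finite_lborel)
  show ?thesis
  proof (rule P.PiM_eqI[OF fin])
    fix A :: "'i \<Rightarrow> real set" assume A: "\<And>b. b \<in> B \<Longrightarrow> A b \<in> sets lborel"
    have A': "(\<lambda>x. x + a b) -` A b \<in> sets borel" if "b \<in> B" for b
      using A[OF that] by (intro measurable_sets_borel) auto
    have "emeasure (distr (\<Pi>\<^sub>M b\<in>B. lborel) (\<Pi>\<^sub>M b\<in>B. lborel) (\<lambda>c. \<lambda>b\<in>B. c b + a b)) (Pi\<^sub>E B A) =
       emeasure (\<Pi>\<^sub>M b\<in>B. lborel) (Pi\<^sub>E B (\<lambda>b. (\<lambda>x. x + a b) -` A b))"
    proof -
      have "(\<lambda>c. \<lambda>b\<in>B. c b + a b) -` Pi\<^sub>E B A \<inter> space (\<Pi>\<^sub>M b\<in>B. lborel) = Pi\<^sub>E B (\<lambda>b. (\<lambda>x. x + a b) -` A b)"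
        by (auto simp: space_PiM PiE_iff)
      then show ?thesis
        using fin A by (subst emeasure_distr) (simp_all add: sets_PiM_I_finite)
    qed
    also have "\<dots> = (\<Prod>b\<in>B. emeasure lborel ((\<lambda>x. x + a b) -` A b))"
      using fin A' by (intro P.emeasure_PiM) auto
    also have "\<dots> = (\<Prod>b\<in>B. emeasure lborel (A b))"
    proof (rule prod.cong[OF refl])
      fix b assume b: "b \<in> B"
      have "emeasure lborel (A b) = emeasure (distr lborel borel ((+) (a b))) (A b)"
        by (simp add: lborel_distr_plus)
      also have "\<dots> = emeasure lborel ((+) (a b) -` A b)"
        using A[OF b] by (subst emeasure_distr) auto
      also have "(+) (a b) = (\<lambda>x. x + a b)" by (auto simp: add.commute)
      finally show "emeasure lborel ((\<lambda>x. x + a b) -` A b) = emeasure lborel (A b)" by simp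
    qed
    finally show "emeasure (distr (\<Pi>\<^sub>M b\<in>B. lborel) (\<Pi>\<^sub>M b\<in>B. lborel) (\<lambda>c. \<lambda>b\<in>B. c b + a b)) (Pi\<^sub>E B A) =
       (\<Prod>b\<in>B. emeasure lborel (A b))" .
  qed simp
qed

text \<open>Cavalieri: all slices of the skew cylinder parallel to \<open>S\<close> are translates of \<open>S\<close>.\<close>

lemma measure_skew_cylinder:
  fixes n w :: "real ^ 'n"
  assumes n: "norm n = 1" and nw: "n \<bullet> w > 0"
    and S: "S \<in> sets borel" "S \<noteq> {}" "S \<subseteq> {x. n \<bullet> x = \<beta>}" and V: "parallel_space S = {x. n \<bullet> x = 0}"
    and X: "{x + r *\<^sub>R w | x r. x \<in> S \<and> 0 \<le> r \<and> r < 1} \<in> sets borel"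
  shows "measure lborel {x + r *\<^sub>R w | x r. x \<in> S \<and> 0 \<le> r \<and> r < 1} = (n \<bullet> w) * affine_volume S"
proof -
  let ?X = "{x + r *\<^sub>R w | x r. x \<in> S \<and> 0 \<le> r \<and> r < 1}"
  define B where "B = (SOME B. orthonormal_basis_of B (parallel_space S))"
  define a where "a = (SOME a. a \<in> S)"
  have a: "a \<in> S" unfolding a_def using S(2) by (simp add: some_in_eq)
  have "subspace (parallel_space S)" unfolding V by (rule subspace_hyperplane)
  from someI_ex[OF orthonormal_basis_of_exists[OF this]]
  have B: "orthonormal_basis_of B {x. n \<bullet> x = 0}" unfolding B_def[symmetric] V[symmetric] .
  note fin = orthonormal_basis_of_finite(1)[OF B]
  have nB0: "n \<bullet> b = 0" if "b \<in> B" for b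
    using B that span_base[of b B] by (auto simp: orthonormal_basis_of_def)
  have nB: "n \<notin> B" using nB0[of n] n by (auto simp: norm_eq_1)
  \<comment> \<open>Adjoining the unit normal gives coordinates of the whole space in which the
    coordinate along \<open>n\<close> is the height.\<close>
  have B': "orthonormal_basis_of (insert n B) UNIV"
    unfolding orthonormal_basis_of_def
  proof (intro conjI)
    show "pairwise orthogonal (insert n B)"
      using B nB0 by (auto simp: orthonormal_basis_of_def pairwise_insert orthogonal_def inner_commute)
    show "\<forall>b\<in>insert n B. norm b = 1" using B n by (auto simp: orthonormal_basis_of_def)
    have "x \<in> span (insert n B)" for x
    proof -
      have "n \<bullet> (x - (n \<bullet> x) *\<^sub>R n) = 0" using n by (simp add: inner_diff_right norm_eq_1)
      then have "x - (n \<bullet> x) *\<^sub>R n \<in> span B" using B by (simp add: orthonormal_basis_of_def)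
      then show ?thesis by (auto simp: span_insert)
    qed
    then show "span (insert n B) = UNIV" by auto
  qed
  let ?M = "\<Pi>\<^sub>M b\<in>B. (lborel :: real measure)"
  define T where "T = (\<lambda>c. \<Sum>b\<in>B. c b *\<^sub>R b)"
  have Tm[measurable]: "T \<in> borel_measurable ?M"
    unfolding T_def using fin by measurable
  interpret P: product_sigma_finite "\<lambda>_ :: real ^ 'n. lborel :: real measure"
    by (rule product_sigma_finite_lborel)
  define G where "G = (\<lambda>p. {c \<in> space ?M. p + T c \<in> S})"
  have Gm: "G p \<in> sets ?M" for p
    unfolding G_def using S(1) by measurable
  \<comment> \<open>Base points of equal height differ by a vector of the hyperplane, hence by a
    translation of the coordinates along \<open>B\<close>.\<close>
  have G_shift: "emeasure ?M (G p) = emeasure ?M (G q)" if pq: "n \<bullet> p = n \<bullet> q" for p q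
  proof -
    have "q - p = (\<Sum>b\<in>B. ((q - p) \<bullet> b) *\<^sub>R b)"
      using orthonormal_expansion[OF B, of "q - p"] pq by (simp add: inner_diff_right)
    then have qp: "q - p = T (\<lambda>b. (q - p) \<bullet> b)" by (simp add: T_def)
    have "emeasure ?M (G p) = emeasure (distr ?M ?M (\<lambda>c. \<lambda>b\<in>B. c b + (q - p) \<bullet> b)) (G p)"
      by (simp only: PiM_lborel_translate[OF fin])
    also have "\<dots> = emeasure ?M ((\<lambda>c. \<lambda>b\<in>B. c b + (q - p) \<bullet> b) -` G p \<inter> space ?M)"
      by (rule emeasure_distr[OF _ Gm]) measurable
    also have "(\<lambda>c. \<lambda>b\<in>B. c b + (q - p) \<bullet> b) -` G p \<inter> space ?M = G q"
    proof -
      have "T (\<lambda>b\<in>B. c b + (q - p) \<bullet> b) = T c + (q - p)" for c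
        by (subst qp) (simp add: T_def scaleR_add_left sum.distrib)
      then have "p + T (\<lambda>b\<in>B. c b + (q - p) \<bullet> b) = q + T c" for c by simp
      moreover have "(\<lambda>b\<in>B. c b + (q - p) \<bullet> b) \<in> space ?M" for c by (simp add: space_PiM PiE_iff)
      ultimately show ?thesis unfolding G_def by (intro set_eqI) (simp only: vimage_eq Int_iff mem_Collect_eq, blast)
    qed
    finally show ?thesis .
  qed
  have av: "affine_volume S = measure ?M (G a)"
    unfolding affine_volume_def a_def[symmetric] B_def[symmetric] Let_def G_def T_def space_PiM by simp
  have slice: "emeasure ?M {c \<in> space ?M. r *\<^sub>R n + T c \<in> ?X} =
    emeasure ?M (G a) * indicator {\<beta>..<\<beta> + n \<bullet> w} r" for r
  proof -
    have nT: "n \<bullet> T c = 0" for c using nB0 by (simp add: T_def inner_sum_right)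
    \<comment> \<open>At height \<open>r\<close> the parameter along \<open>w\<close> is forced to
      be \<open>\<rho>\<close>, and the slice is \<open>S\<close> translated by
      \<open>\<rho> *\<^sub>R w\<close>. So exactly the heights in an interval of length
      \<open>n \<bullet> w\<close> contribute.\<close>
    define \<rho> where "\<rho> = (r - \<beta>) / (n \<bullet> w)"
    have \<rho>: "r = \<beta> + \<rho> * (n \<bullet> w)" using nw by (simp add: \<rho>_def)
    have nn: "n \<bullet> n = 1" using n by (simp add: norm_eq_1)
    have iff: "r *\<^sub>R n + T c \<in> ?X \<longleftrightarrow> 0 \<le> \<rho> \<and> \<rho> < 1 \<and> (r *\<^sub>R n - \<rho> *\<^sub>R w) + T c \<in> S" for c
    proof
      assume "r *\<^sub>R n + T c \<in> ?X"
      then obtain x r' where x: "r *\<^sub>R n + T c = x + r' *\<^sub>R w" "x \<in> S" "0 \<le> r'" "r' < 1" by auto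
      from arg_cong[OF x(1), of "\<lambda>y. n \<bullet> y"] have "r = \<beta> + r' * (n \<bullet> w)"
        using nT S(3) x(2) nn by (auto simp: inner_add_right)
      then have "r' = \<rho>" using nw \<rho> by simp
      moreover have "x = (r *\<^sub>R n - r' *\<^sub>R w) + T c" using x(1) by (simp add: algebra_simps)
      ultimately show "0 \<le> \<rho> \<and> \<rho> < 1 \<and> (r *\<^sub>R n - \<rho> *\<^sub>R w) + T c \<in> S" using x by simp
    next
      assume h: "0 \<le> \<rho> \<and> \<rho> < 1 \<and> (r *\<^sub>R n - \<rho> *\<^sub>R w) + T c \<in> S"
      moreover have "r *\<^sub>R n + T c = ((r *\<^sub>R n - \<rho> *\<^sub>R w) + T c) + \<rho> *\<^sub>R w" by simp
      ultimately show "r *\<^sub>R n + T c \<in> ?X" by blast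
    qed
    have ind: "0 \<le> \<rho> \<and> \<rho> < 1 \<longleftrightarrow> r \<in> {\<beta>..<\<beta> + n \<bullet> w}"
      using nw by (auto simp: \<rho>_def field_simps)
    show ?thesis
    proof (cases "r \<in> {\<beta>..<\<beta> + n \<bullet> w}")
      case True
      then have "{c \<in> space ?M. r *\<^sub>R n + T c \<in> ?X} = G (r *\<^sub>R n - \<rho> *\<^sub>R w)"
        using iff ind by (auto simp: G_def)
      moreover have "n \<bullet> (r *\<^sub>R n - \<rho> *\<^sub>R w) = n \<bullet> a"
        using S(3) a \<rho> nn by (auto simp: inner_diff_right)
      ultimately show ?thesis using True G_shift[of "r *\<^sub>R n - \<rho> *\<^sub>R w" a] by simp
    next
      case False
      then have e: "{c \<in> space ?M. r *\<^sub>R n + T c \<in> ?X} = {}" using iff ind by blast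
      show ?thesis unfolding e using False by simp
    qed
  qed
  have "emeasure lborel ?X = emeasure (distr (\<Pi>\<^sub>M b\<in>insert n B. lborel) borel (\<lambda>c. \<Sum>b\<in>insert n B. c b *\<^sub>R b)) ?X"
    by (simp only: lborel_orthonormal_coordinates[OF B'])
  also have "\<dots> = (\<integral>\<^sup>+ x. indicator ?X x \<partial>distr (\<Pi>\<^sub>M b\<in>insert n B. lborel) borel (\<lambda>c. \<Sum>b\<in>insert n B. c b *\<^sub>R b))"
    using X by simp
  also have "\<dots> = (\<integral>\<^sup>+ c. indicator ?X (\<Sum>b\<in>insert n B. c b *\<^sub>R b) \<partial>(\<Pi>\<^sub>M b\<in>insert n B. lborel))"
    by (rule nn_integral_distr) (use X fin in measurable)
  also have "\<dots> = (\<integral>\<^sup>+ r. (\<integral>\<^sup>+ c. indicator ?X (\<Sum>b\<in>insert n B. (c(n := r)) b *\<^sub>R b) \<partial>?M) \<partial>lborel)"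
    by (rule P.product_nn_integral_insert_rev[OF fin nB]) (use X fin in measurable)
  also have "\<dots> = (\<integral>\<^sup>+ r. emeasure ?M (G a) * indicator {\<beta>..<\<beta> + n \<bullet> w} r \<partial>lborel)"
  proof (rule nn_integral_cong)
    fix r
    have "(\<Sum>b\<in>insert n B. (c(n := r)) b *\<^sub>R b) = r *\<^sub>R n + T c" for c
      using nB fin by (auto simp: T_def intro!: sum.cong)
    then have "(\<integral>\<^sup>+ c. indicator ?X (\<Sum>b\<in>insert n B. (c(n := r)) b *\<^sub>R b) \<partial>?M) =
       (\<integral>\<^sup>+ c. indicator {c \<in> space ?M. r *\<^sub>R n + T c \<in> ?X} c \<partial>?M)"
      by (intro nn_integral_cong) (simp add: indicator_def)
    also have "\<dots> = emeasure ?M {c \<in> space ?M. r *\<^sub>R n + T c \<in> ?X}"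
      by (rule nn_integral_indicator) (use X in measurable)
    finally show "(\<integral>\<^sup>+ c. indicator ?X (\<Sum>b\<in>insert n B. (c(n := r)) b *\<^sub>R b) \<partial>?M) =
       emeasure ?M (G a) * indicator {\<beta>..<\<beta> + n \<bullet> w} r" unfolding slice .
  qed
  also have "\<dots> = emeasure ?M (G a) * ennreal (n \<bullet> w)"
    using nw by (subst nn_integral_cmult) auto
  finally show ?thesis
    unfolding av measure_def using nw by (simp add: enn2real_mult mult.commute)
qed

section \<open>Dilation and measurability of cylinders\<close>

lemma measure_lborel_dilate:
  fixes S :: "'a::euclidean_space set"
  assumes S[measurable]: "S \<in> sets borel" and c: "c > 0"
  shows "measure lborel {x. (1 / c) *\<^sub>R x \<in> S} = c ^ DIM('a) * measure lborel S"
proof -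
  let ?T = "{x. (1 / c) *\<^sub>R x \<in> S}"
  have T[measurable]: "?T \<in> sets borel" by measurable
  have "emeasure lborel ?T = emeasure (density (distr lborel borel (\<lambda>x. 0 + c *\<^sub>R x)) (\<lambda>_. ennreal (\<bar>c\<bar> ^ DIM('a)))) ?T"
    using c by (subst lborel_affine[of c 0]) auto
  also have "\<dots> = ennreal (\<bar>c\<bar> ^ DIM('a)) * emeasure (distr lborel borel (\<lambda>x. 0 + c *\<^sub>R x)) ?T"
    by (rule emeasure_density_const) simp
  also have "emeasure (distr lborel borel (\<lambda>x. 0 + c *\<^sub>R x)) ?T = emeasure lborel ((\<lambda>x. 0 + c *\<^sub>R x) -` ?T \<inter> space lborel)"
    by (rule emeasure_distr) auto
  also have "(\<lambda>x. 0 + c *\<^sub>R x) -` ?T \<inter> space lborel = S" using c by auto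
  finally show ?thesis using c by (simp add: measure_def enn2real_mult)
qed

text \<open>The parameter \<open>r\<close> is determined by \<open>v \<bullet> y\<close>, so the
  existential quantifiers can be solved; in the explicit form the set is visibly Borel.\<close>

lemma skew_cylinder_eq:
  fixes v w :: "'a::real_inner"
  assumes S: "S \<subseteq> {x. v \<bullet> x = \<beta>}" and q: "v \<bullet> w > 0"
  shows "{x + r *\<^sub>R w | x r. x \<in> S \<and> 0 \<le> r \<and> r < 1} =
    {y. 0 \<le> (v \<bullet> y - \<beta>) / (v \<bullet> w) \<and> (v \<bullet> y - \<beta>) / (v \<bullet> w) < 1 \<and> y - ((v \<bullet> y - \<beta>) / (v \<bullet> w)) *\<^sub>R w \<in> S}"
    (is "?L = ?R")
proof
  show "?L \<subseteq> ?R"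
  proof
    fix y assume "y \<in> ?L"
    then obtain x r where x: "y = x + r *\<^sub>R w" "x \<in> S" "0 \<le> r" "r < 1" by blast
    have "v \<bullet> x = \<beta>" using x S by auto
    then have "(v \<bullet> y - \<beta>) / (v \<bullet> w) = r" using q x(1) by (simp add: inner_add_right)
    then show "y \<in> ?R" using x by simp
  qed
  show "?R \<subseteq> ?L"
  proof
    fix y assume y: "y \<in> ?R"
    have "y = (y - ((v \<bullet> y - \<beta>) / (v \<bullet> w)) *\<^sub>R w) + ((v \<bullet> y - \<beta>) / (v \<bullet> w)) *\<^sub>R w" by simp
    then show "y \<in> ?L" using y by blast
  qed
qed

lemma skew_cylinder_borel:
  fixes v w :: "'a::euclidean_space"
  assumes "S \<subseteq> {x. v \<bullet> x = \<beta>}" "v \<bullet> w > 0" and S[measurable]: "S \<in> sets borel"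
  shows "{x + r *\<^sub>R w | x r. x \<in> S \<and> 0 \<le> r \<and> r < 1} \<in> sets borel"
  unfolding skew_cylinder_eq[OF assms(1,2)] by measurable

section \<open>The lattice in a hyperplane with primitive normal\<close>

lemma span_lattice_hyperplane:
  fixes v w :: "real ^ 'n"
  assumes v: "v \<in> int_lattice" and w: "w \<in> int_lattice" "v \<bullet> w = 1"
  shows "span ({x. v \<bullet> x = 0} \<inter> int_lattice) = {x. v \<bullet> x = 0}"
proof
  show "span ({x. v \<bullet> x = 0} \<inter> int_lattice) \<subseteq> {x. v \<bullet> x = 0}"
    by (rule span_minimal) (auto intro: subspace_hyperplane)
  show "{x. v \<bullet> x = 0} \<subseteq> span ({x. v \<bullet> x = 0} \<inter> int_lattice)"
  proof
    fix x assume x: "x \<in> {x. v \<bullet> x = 0}"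
    \<comment> \<open>Each axis vector is projected along \<open>w\<close> into the hyperplane and
      stays a lattice vector. In the combination with coefficients \<open>x $ i\<close> the
      corrections cancel because \<open>v \<bullet> x = 0\<close>.\<close>
    have L: "axis i 1 - (v $ i) *\<^sub>R w \<in> {x. v \<bullet> x = 0} \<inter> int_lattice" for i
      using axis_in_int_lattice[of i] int_lattice_closed(3,5) v w
      by (auto simp: inner_diff_right inner_axis int_lattice_def)
    have "(\<Sum>i\<in>UNIV. (x $ i) *\<^sub>R (axis i 1 - (v $ i) *\<^sub>R w)) =
      (\<Sum>i\<in>UNIV. (x $ i) *\<^sub>R axis i 1) - (\<Sum>i\<in>UNIV. x $ i * v $ i) *\<^sub>R w"
      by (simp add: scaleR_diff_right sum_subtractf scaleR_sum_left)
    also have "(\<Sum>i\<in>UNIV. (x $ i) *\<^sub>R axis i 1) = x"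
      using basis_expansion[of x] by (simp add: scalar_mult_eq_scaleR)
    also have "(\<Sum>i\<in>UNIV. x $ i * v $ i) = 0"
      using x by (simp add: inner_vec_def mult.commute)
    finally have "x = (\<Sum>i\<in>UNIV. (x $ i) *\<^sub>R (axis i 1 - (v $ i) *\<^sub>R w))" by simp
    also have "\<dots> \<in> span ({x. v \<bullet> x = 0} \<inter> int_lattice)"
      using L by (intro span_sum span_scale span_base)
    finally show "x \<in> span ({x. v \<bullet> x = 0} \<inter> int_lattice)" .
  qed
qed

text \<open>
  Together with \<open>w\<close>, a basis of the lattice in the hyperplane is a basis of the whole lattice,
  so the skew cylinder over its fundamental parallelepiped has volume 1.
\<close>

lemma lattice_det_hyperplane:
  fixes v w :: "real ^ 'n"
  assumes v: "v \<in> int_lattice" and w: "w \<in> int_lattice" "v \<bullet> w = 1"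
  shows "lattice_det ({x. v \<bullet> x = 0} \<inter> int_lattice) = norm v"
proof -
  define L where "L = {x. v \<bullet> x = 0} \<inter> (int_lattice :: (real ^ 'n) set)"
  define B where "B = (SOME B. lattice_basis B L)"
  have "\<exists>B. lattice_basis B L"
    by (rule lattice_basis_exists) (auto simp: L_def inner_diff_right int_lattice_closed)
  then have LB: "lattice_basis B L" unfolding B_def by (rule someI_ex)
  then have ind: "independent B" and L: "L = {(\<Sum>b\<in>B. of_int (z b) *\<^sub>R b) | z. True}"
    by (auto simp: lattice_basis_def)
  have fin: "finite B" using ind by (rule independent_imp_finite)
  have LI: "(\<Sum>b\<in>B. of_int (z b) *\<^sub>R b) \<in> L" for z
    unfolding L by (intro CollectI exI[of _ z] conjI refl TrueI)
  have BL: "b \<in> L" if "b \<in> B" for b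
    using lattice_basis_subset[OF LB] that by blast
  have sumB: "(\<Sum>b\<in>B. f b *\<^sub>R b) \<in> span B" for f
    by (intro span_sum span_scale span_base)
  have spanB: "span B = {x. v \<bullet> x = 0}"
  proof -
    have "L \<subseteq> span B" unfolding L by (auto simp: sumB)
    then have "span L = span B" using BL by (intro span_eq[THEN iffD2] conjI) (auto intro: span_base)
    then show ?thesis using span_lattice_hyperplane[OF assms] by (simp add: L_def)
  qed
  \<comment> \<open>Coordinate functionals of \<open>B\<close>. Being linear on the whole space they
    are measurable there; they serve as coordinates on the hyperplane.\<close>
  have "\<forall>b. \<exists>g :: real ^ 'n \<Rightarrow> real. linear g \<and> (\<forall>x\<in>B. g x = (if x = b then 1 else 0))"
  proof
    fix b
    show "\<exists>g :: real ^ 'n \<Rightarrow> real. linear g \<and> (\<forall>x\<in>B. g x = (if x = b then 1 else 0))"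
      by (rule linear_independent_extend[OF ind])
  qed
  from choice[OF this] obtain g :: "real ^ 'n \<Rightarrow> real ^ 'n \<Rightarrow> real" where
    g': "\<forall>b. linear (g b) \<and> (\<forall>x\<in>B. g b x = (if x = b then 1 else 0))" ..
  have g: "linear (g b)" "x \<in> B \<Longrightarrow> g b x = (if x = b then 1 else 0)" for b x
    using g' by blast+
  have gm[measurable]: "g b \<in> borel_measurable borel" for b
    using g(1)[of b] by (intro borel_measurable_continuous_onI linear_continuous_on) (simp add: linear_conv_bounded_linear)
  have g_sum: "g b (\<Sum>c\<in>B. f c *\<^sub>R c) = f b" if b: "b \<in> B" for b f
  proof -
    have "g b (\<Sum>c\<in>B. f c *\<^sub>R c) = (\<Sum>c\<in>B. f c * g b c)"
      using g(1)[of b] by (simp add: linear_sum linear_scale)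
    also have "\<dots> = (\<Sum>c\<in>B. if c = b then f c else 0)" using g(2) by (intro sum.cong) auto
    finally show ?thesis using b fin by simp
  qed
  have expand: "(\<Sum>b\<in>B. g b x *\<^sub>R b) = x" if x: "v \<bullet> x = 0" for x
  proof -
    have "x \<in> span B" using x spanB by simp
    then obtain f where f: "x = (\<Sum>b\<in>B. f b *\<^sub>R b)" using span_finite[OF fin] by auto
    then show ?thesis using g_sum by simp
  qed
  have L_iff: "x \<in> L \<longleftrightarrow> (\<forall>b\<in>B. g b x \<in> \<int>)" if x: "v \<bullet> x = 0" for x
  proof
    assume "x \<in> L"
    then show "\<forall>b\<in>B. g b x \<in> \<int>" unfolding L using g_sum by auto
  next
    assume "\<forall>b\<in>B. g b x \<in> \<int>"
    then have "\<forall>b\<in>B. g b x = of_int \<lfloor>g b x\<rfloor>" by (auto elim: Ints_cases)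
    then have "(\<Sum>b\<in>B. g b x *\<^sub>R b) = (\<Sum>b\<in>B. of_int \<lfloor>g b x\<rfloor> *\<^sub>R b)" by (intro sum.cong) auto
    then have "x = (\<Sum>b\<in>B. of_int \<lfloor>g b x\<rfloor> *\<^sub>R b)" using expand[OF x] by simp
    then show "x \<in> L" using LI by metis
  qed
  define D where "D = {(\<Sum>b\<in>B. c b *\<^sub>R b) | c. \<forall>b\<in>B. 0 \<le> c b \<and> c b < 1}"
  have D_iff: "x \<in> D \<longleftrightarrow> v \<bullet> x = 0 \<and> (\<forall>b\<in>B. 0 \<le> g b x \<and> g b x < 1)" for x
  proof
    assume "x \<in> D"
    then obtain c where c: "x = (\<Sum>b\<in>B. c b *\<^sub>R b)" "\<forall>b\<in>B. 0 \<le> c b \<and> c b < 1" by (auto simp: D_def)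
    have "x \<in> span B" unfolding c(1) by (rule sumB)
    then show "v \<bullet> x = 0 \<and> (\<forall>b\<in>B. 0 \<le> g b x \<and> g b x < 1)" using c g_sum spanB by auto
  next
    assume x: "v \<bullet> x = 0 \<and> (\<forall>b\<in>B. 0 \<le> g b x \<and> g b x < 1)"
    then have "x = (\<Sum>b\<in>B. g b x *\<^sub>R b)" using expand[of x] by simp
    then show "x \<in> D" unfolding D_def by (intro CollectI exI[of _ "\<lambda>b. g b x"] conjI) (use x in auto)
  qed
  have Db: "D \<in> sets borel"
  proof -
    have "{x \<in> space borel. v \<bullet> x = 0 \<and> (\<forall>b\<in>B. 0 \<le> g b x \<and> g b x < 1)} \<in> sets borel"
      by (intro sets.sets_Collect_conj sets.sets_Collect_finite_All fin; measurable)
    moreover have "D = {x \<in> space borel. v \<bullet> x = 0 \<and> (\<forall>b\<in>B. 0 \<le> g b x \<and> g b x < 1)}"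
      by (intro set_eqI) (simp only: D_iff mem_Collect_eq space_borel UNIV_I simp_thms)
    ultimately show ?thesis by simp
  qed
  have D0: "0 \<in> D" using g(1) by (simp add: D_iff linear_0)
  have D_sub: "D \<subseteq> {x. v \<bullet> x = 0}" using D_iff by blast
  define X where "X = {x + r *\<^sub>R w | x r. x \<in> D \<and> 0 \<le> r \<and> r < 1}"
  have vw0: "v \<bullet> w > 0" using w by simp
  have Xb: "X \<in> sets borel" unfolding X_def by (rule skew_cylinder_borel[OF D_sub vw0 Db])
  have X_iff: "y \<in> X \<longleftrightarrow> 0 \<le> v \<bullet> y \<and> v \<bullet> y < 1 \<and> (\<forall>b\<in>B. 0 \<le> g b (y - (v \<bullet> y) *\<^sub>R w) \<and> g b (y - (v \<bullet> y) *\<^sub>R w) < 1)" for y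
    unfolding X_def skew_cylinder_eq[OF D_sub vw0] using w(2) by (simp add: D_iff inner_diff_right)
  have "fundamental_domain X"
    unfolding fundamental_domain_def
  proof (intro conjI allI Xb)
    fix x :: "real ^ 'n"
    \<comment> \<open>\<open>y\<close> and, below, \<open>\<mu>\<close> are the projections of
      \<open>x\<close> and \<open>z'\<close> along \<open>w\<close> to the hyperplane. Membership of
      \<open>x - z'\<close> in \<open>X\<close> separates into a condition on the level
      \<open>v \<bullet> z'\<close> and one on the coordinates of \<open>\<mu>\<close>; each is met
      by rounding down and by nothing else.\<close>
    define y where "y = x - (v \<bullet> x) *\<^sub>R w"
    define \<zeta> where "\<zeta> = (\<Sum>b\<in>B. of_int \<lfloor>g b y\<rfloor> *\<^sub>R b)"
    define z where "z = of_int \<lfloor>v \<bullet> x\<rfloor> *\<^sub>R w + \<zeta>"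
    have \<zeta>L: "\<zeta> \<in> L" unfolding \<zeta>_def by (rule LI)
    have key: "x - z' \<in> X \<longleftrightarrow> z' = z" if z': "z' \<in> int_lattice" for z'
    proof -
      define \<mu> where "\<mu> = z' - (v \<bullet> z') *\<^sub>R w"
      have vz: "v \<bullet> z' \<in> \<int>" using int_lattice_inner[OF v z'] .
      then obtain l where l: "v \<bullet> z' = of_int l" by (auto elim: Ints_cases)
      have v\<mu>: "v \<bullet> \<mu> = 0" using w(2) by (simp add: \<mu>_def inner_diff_right)
      have \<mu>L: "\<mu> \<in> L"
        using v\<mu> int_lattice_closed(3)[OF z' int_lattice_closed(5)[OF w(1) vz]] by (simp add: L_def \<mu>_def)
      have diff: "(x - z') - (v \<bullet> (x - z')) *\<^sub>R w = y - \<mu>"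
        by (simp add: y_def \<mu>_def inner_diff_right algebra_simps)
      have "x - z' \<in> X \<longleftrightarrow> (0 \<le> v \<bullet> x - of_int l \<and> v \<bullet> x - of_int l < 1) \<and> (\<forall>b\<in>B. 0 \<le> g b y - g b \<mu> \<and> g b y - g b \<mu> < 1)"
        unfolding X_iff diff using g(1) by (simp add: inner_diff_right l linear_diff)
      also have "(0 \<le> v \<bullet> x - of_int l \<and> v \<bullet> x - of_int l < 1) \<longleftrightarrow> l = \<lfloor>v \<bullet> x\<rfloor>" by linarith
      also have "(\<forall>b\<in>B. 0 \<le> g b y - g b \<mu> \<and> g b y - g b \<mu> < 1) \<longleftrightarrow> \<mu> = \<zeta>"
      proof
        assume h: "\<forall>b\<in>B. 0 \<le> g b y - g b \<mu> \<and> g b y - g b \<mu> < 1"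
        have "g b \<mu> = of_int \<lfloor>g b y\<rfloor>" if b: "b \<in> B" for b
        proof -
          have "g b \<mu> \<in> \<int>" using L_iff[OF v\<mu>] \<mu>L b by blast
          then obtain k where k: "g b \<mu> = of_int k" by (auto elim: Ints_cases)
          have "0 \<le> g b y - g b \<mu>" "g b y - g b \<mu> < 1" using h b by auto
          then have "k = \<lfloor>g b y\<rfloor>" unfolding k by linarith
          then show ?thesis using k by simp
        qed
        then have "(\<Sum>b\<in>B. g b \<mu> *\<^sub>R b) = \<zeta>" unfolding \<zeta>_def by (intro sum.cong) auto
        then show "\<mu> = \<zeta>" using expand[OF v\<mu>] by simp
      next
        assume "\<mu> = \<zeta>"
        then have e: "g b \<mu> = of_int \<lfloor>g b y\<rfloor>" if "b \<in> B" for b using g_sum[OF that] by (simp add: \<zeta>_def)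
        show "\<forall>b\<in>B. 0 \<le> g b y - g b \<mu> \<and> g b y - g b \<mu> < 1"
        proof
          fix b assume b: "b \<in> B"
          show "0 \<le> g b y - g b \<mu> \<and> g b y - g b \<mu> < 1" unfolding e[OF b] by linarith
        qed
      qed
      also have "l = \<lfloor>v \<bullet> x\<rfloor> \<and> \<mu> = \<zeta> \<longleftrightarrow> z' = z"
      proof
        assume "l = \<lfloor>v \<bullet> x\<rfloor> \<and> \<mu> = \<zeta>"
        then show "z' = z" using l by (simp add: z_def \<mu>_def algebra_simps)
      next
        assume z: "z' = z"
        have "v \<bullet> \<zeta> = 0" using \<zeta>L by (simp add: L_def)
        then have "v \<bullet> z' = of_int \<lfloor>v \<bullet> x\<rfloor>" using z w(2) by (simp add: z_def inner_add_right)
        then show "l = \<lfloor>v \<bullet> x\<rfloor> \<and> \<mu> = \<zeta>" using l z by (simp add: \<mu>_def z_def)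
      qed
      finally show ?thesis .
    qed
    have "z \<in> int_lattice"
      unfolding z_def using \<zeta>L w(1) by (intro int_lattice_closed(2,5)) (auto simp: L_def)
    then show "\<exists>!z. z \<in> int_lattice \<and> x - z \<in> X" using key by (intro ex1I[of _ z]) auto
  qed
  then have X1: "measure lborel X = 1" by (simp add: measure_def emeasure_fundamental_domain)
  have v0: "norm v > 0" using w by auto
  define n where "n = (1 / norm v) *\<^sub>R v"
  have n: "norm n = 1" "n \<bullet> w = 1 / norm v" using v0 w by (auto simp: n_def)
  have n0: "n \<bullet> x = 0 \<longleftrightarrow> v \<bullet> x = 0" for x using v0 by (auto simp: n_def)
  have "parallel_space D = {x. v \<bullet> x = 0}"
  proof -
    have "B \<subseteq> span D"
    proof
      fix b assume b: "b \<in> B"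
      \<comment> \<open>The half-open parallelepiped omits \<open>b\<close> itself but contains half
        of it.\<close>
      have "(1 / 2) *\<^sub>R b \<in> D" using BL[OF b] b g by (auto simp: D_iff L_def linear_scale)
      then have "2 *\<^sub>R ((1 / 2) *\<^sub>R b) \<in> span D" by (intro span_scale span_base)
      then show "b \<in> span D" by simp
    qed
    moreover have "D \<subseteq> span B" using D_sub spanB by simp
    ultimately have "span D = {x. v \<bullet> x = 0}" using spanB span_eq by metis
    moreover have "affine hull D = span D" using D0 by (intro affine_hull_span_0 hull_inc)
    ultimately have "parallel_space D = {x - y | x y. v \<bullet> x = 0 \<and> v \<bullet> y = 0}" by (simp add: parallel_space_def)
    also have "\<dots> = {x. v \<bullet> x = 0}"
    proof (intro equalityI subsetI)
      fix x assume "x \<in> {x. v \<bullet> x = 0}"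
      then show "x \<in> {x - y | x y. v \<bullet> x = 0 \<and> v \<bullet> y = 0}"
        by (intro CollectI exI[of _ x] exI[of _ 0]) simp
    qed (auto simp: inner_diff_right)
    finally show ?thesis .
  qed
  \<comment> \<open>The unit volume of \<open>X\<close> is the height \<open>1 / norm v\<close>
    times the volume of \<open>D\<close>.\<close>
  then have "measure lborel X = (n \<bullet> w) * affine_volume D"
    unfolding X_def using n v0 D0 D_sub n0 Db Xb
    by (intro measure_skew_cylinder[of n w D 0]) (auto simp: X_def)
  then have "affine_volume D = norm v" using X1 n(2) v0 by simp
  moreover have "lattice_det L = affine_volume D"
    by (simp add: lattice_det_def Let_def B_def[symmetric] D_def)
  ultimately show ?thesis by (simp add: L_def)
qed

text \<open>The lattice determinant is \<open>norm v\<close> and \<open>w\<close> has height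
  \<open>1 / norm v\<close> over the hyperplane, so the relative volume of \<open>F\<close> is the
  volume of the cylinder over \<open>F\<close> along \<open>w\<close>. The cylinder over the dilate
  is \<open>s\<close> times the cylinder over \<open>F\<close> along
  \<open>(1 / s) *\<^sub>R w\<close>, which accounts for the factor s^d / s.\<close>

lemma relative_volume_cylinder:
  fixes v w :: "real ^ 'n"
  assumes v: "v \<in> int_lattice" and w: "w \<in> int_lattice" "v \<bullet> w = 1"
    and F: "F \<in> sets borel" "F \<noteq> {}" "F \<subseteq> {x. v \<bullet> x = \<beta>}" "parallel_space F = {x. v \<bullet> x = 0}"
    and s: "s > 0"
  shows "measure lborel {x + r *\<^sub>R w | x r. (1 / s) *\<^sub>R x \<in> F \<and> 0 \<le> r \<and> r < 1} = relative_volume F * s ^ (CARD('n) - 1)"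
proof -
  have v0: "norm v > 0" using w by auto
  define n where "n = (1 / norm v) *\<^sub>R v"
  have n: "norm n = 1" "n \<bullet> w = 1 / norm v" using v0 w by (auto simp: n_def)
  have n0: "n \<bullet> x = 0 \<longleftrightarrow> v \<bullet> x = 0" for x using v0 by (auto simp: n_def)
  define Y where "Y = {x + r *\<^sub>R ((1 / s) *\<^sub>R w) | x r. x \<in> F \<and> 0 \<le> r \<and> r < 1}"
  have "v \<bullet> ((1 / s) *\<^sub>R w) > 0" using w s by simp
  then have Yb: "Y \<in> sets borel" unfolding Y_def by (rule skew_cylinder_borel[OF F(3) _ F(1)])
  have F': "F \<subseteq> {x. n \<bullet> x = \<beta> / norm v}" using F(3) by (auto simp: n_def)
  have "measure lborel Y = (n \<bullet> ((1 / s) *\<^sub>R w)) * affine_volume F"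
    unfolding Y_def using n v0 s F n0 F' Yb
    by (intro measure_skew_cylinder[of n "(1 / s) *\<^sub>R w" F]) (auto simp: Y_def)
  also have "\<dots> = relative_volume F / s"
    using n lattice_det_hyperplane[OF v w] F(4) by (simp add: relative_volume_def)
  finally have Y: "measure lborel Y = relative_volume F / s" .
  have "{x + r *\<^sub>R w | x r. (1 / s) *\<^sub>R x \<in> F \<and> 0 \<le> r \<and> r < 1} = {x. (1 / s) *\<^sub>R x \<in> Y}" (is "?L = ?R")
  proof
    show "?L \<subseteq> ?R" by (force simp: Y_def scaleR_add_right)
    show "?R \<subseteq> ?L"
    proof
      fix y assume "y \<in> ?R"
      then obtain x r where x: "(1 / s) *\<^sub>R y = x + r *\<^sub>R ((1 / s) *\<^sub>R w)" "x \<in> F" "0 \<le> r" "r < 1"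
        unfolding Y_def by blast
      have "y = s *\<^sub>R ((1 / s) *\<^sub>R y)" using s by simp
      also have "\<dots> = s *\<^sub>R x + r *\<^sub>R w" unfolding x(1) using s by (simp add: scaleR_add_right)
      finally have "y = s *\<^sub>R x + r *\<^sub>R w" .
      moreover have "(1 / s) *\<^sub>R (s *\<^sub>R x) \<in> F" using x s by simp
      ultimately show "y \<in> ?L" using x by blast
    qed
  qed
  then have "measure lborel {x + r *\<^sub>R w | x r. (1 / s) *\<^sub>R x \<in> F \<and> 0 \<le> r \<and> r < 1} = s ^ CARD('n) * (relative_volume F / s)"
    using measure_lborel_dilate[OF Yb s] Y by simp
  also have "\<dots> = relative_volume F * s ^ (CARD('n) - 1)"
    using s by (cases "CARD('n)") (auto simp: field_simps)
  finally show ?thesis .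
qed

section \<open>Lattice points in dilated polyhedra\<close>

lemma exists_nonzero_minor:
  fixes x y :: "real ^ 'n"
  assumes "x \<noteq> 0" "\<And>c. y \<noteq> c *\<^sub>R x"
  obtains a q where "x $ a * y $ q \<noteq> x $ q * y $ a"
proof -
  obtain a where a: "x $ a \<noteq> 0" using assms(1) by (auto simp: vec_eq_iff)
  have "\<exists>q. x $ a * y $ q \<noteq> x $ q * y $ a"
  proof (rule ccontr)
    assume "\<not> ?thesis"
    then have h: "y $ q = (y $ a / x $ a) * x $ q" for q using a by (simp add: field_simps)
    have "y = (y $ a / x $ a) *\<^sub>R x"
      by (simp only: vec_eq_iff vector_scaleR_component real_scaleR_def) (intro allI h)
    then show False using assms(2) by blast
  qed
  then show ?thesis using that by blast
qed

text \<open>A point of the intersection is determined by its coordinates other than \<open>a\<close> and \<open>q\<close>.\<close>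

lemma card_lattice_codim_two:
  fixes x y :: "real ^ 'n"
  assumes minor: "x $ a * y $ q \<noteq> x $ q * y $ a" and "r \<ge> 0"
  shows "real (card {z \<in> int_lattice. norm z \<le> r \<and> x \<bullet> z = k \<and> y \<bullet> z = l}) \<le> (2 * r + 3) ^ (CARD('n) - 2)"
proof -
  let ?T = "{z \<in> int_lattice. norm z \<le> r \<and> x \<bullet> z = k \<and> y \<bullet> z = l}"
  let ?J = "UNIV - {a, q}"
  let ?P = "PiE ?J (\<lambda>_. {- \<lceil>r\<rceil>..\<lceil>r\<rceil>})"
  have aq: "a \<noteq> q" using minor by auto
  have "inj_on (\<lambda>z. \<lambda>i\<in>?J. \<lfloor>z $ i\<rfloor>) ?T"
  proof (rule inj_onI)
    fix z z' assume z: "z \<in> ?T" "z' \<in> ?T" and eq: "(\<lambda>i\<in>?J. \<lfloor>z $ i\<rfloor>) = (\<lambda>i\<in>?J. \<lfloor>z' $ i\<rfloor>)"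
    define d where "d = z - z'"
    have d0: "d $ i = 0" if "i \<in> ?J" for i
    proof -
      have "\<lfloor>z $ i\<rfloor> = \<lfloor>z' $ i\<rfloor>" using fun_cong[OF eq, of i] that by simp
      moreover have "z $ i \<in> \<int>" "z' $ i \<in> \<int>" using z by (auto simp: int_lattice_def)
      ultimately show ?thesis by (auto simp: d_def elim!: Ints_cases)
    qed
    have two: "u \<bullet> d = u $ a * d $ a + u $ q * d $ q" for u :: "real ^ 'n"
    proof -
      have "u \<bullet> d = (\<Sum>i\<in>UNIV. u $ i * d $ i)" by (simp add: inner_vec_def)
      also have "\<dots> = (\<Sum>i\<in>{a, q}. u $ i * d $ i)"
        using d0 by (intro sum.mono_neutral_right) auto
      finally show ?thesis using aq by simp
    qed
    have "x \<bullet> d = 0" "y \<bullet> d = 0" using z by (auto simp: d_def inner_diff_right)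
    then have e: "x $ a * d $ a + x $ q * d $ q = 0" "y $ a * d $ a + y $ q * d $ q = 0"
      by (simp_all add: two)
    \<comment> \<open>Cramer's rule for the two remaining coordinates of the difference.\<close>
    have "(x $ a * y $ q - x $ q * y $ a) * d $ a = 0" "(x $ a * y $ q - x $ q * y $ a) * d $ q = 0"
      using e by algebra+
    then have "d $ a = 0" "d $ q = 0" using minor by auto
    then have "d $ i = 0" for i using d0[of i] by (cases "i = a"; cases "i = q") auto
    then have "d = 0" by (simp add: vec_eq_iff)
    then show "z = z'" by (simp add: d_def)
  qed
  moreover have "(\<lambda>z. \<lambda>i\<in>?J. \<lfloor>z $ i\<rfloor>) ` ?T \<subseteq> ?P"
  proof clarify
    fix z :: "real ^ 'n" assume "norm z \<le> r"
    have "\<lfloor>z $ i\<rfloor> \<in> {- \<lceil>r\<rceil>..\<lceil>r\<rceil>}" for i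
    proof -
      have "\<bar>z $ i\<bar> \<le> r" using component_le_norm_cart[of z i] \<open>norm z \<le> r\<close> by linarith
      then show ?thesis by (simp; linarith)
    qed
    then show "(\<lambda>i\<in>?J. \<lfloor>z $ i\<rfloor>) \<in> ?P" by auto
  qed
  ultimately have "card ?T \<le> card ?P"
    by (intro card_inj_on_le finite_PiE) auto
  also have "card ?P = nat (2 * \<lceil>r\<rceil> + 1) ^ (CARD('n) - 2)"
    using aq by (simp add: card_PiE card_Diff_subset numeral_2_eq_2 algebra_simps)
  finally have "real (card ?T) \<le> real (nat (2 * \<lceil>r\<rceil> + 1)) ^ (CARD('n) - 2)"
    by (simp only: of_nat_power[symmetric] of_nat_le_iff)
  also have "\<dots> \<le> (2 * r + 3) ^ (CARD('n) - 2)"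
  proof (rule power_mono)
    show "real (nat (2 * \<lceil>r\<rceil> + 1)) \<le> 2 * r + 3" using \<open>r \<ge> 0\<close> by (simp add: of_nat_nat; linarith)
  qed simp
  finally show ?thesis .
qed

lemma card_int_near:
  assumes "K \<ge> 0"
  shows "finite {l :: int. \<bar>of_int l - c\<bar> \<le> K}" "real (card {l :: int. \<bar>of_int l - c\<bar> \<le> K}) \<le> 2 * K + 1"
proof -
  have eq: "{l :: int. \<bar>of_int l - c\<bar> \<le> K} = {\<lceil>c - K\<rceil>..\<lfloor>c + K\<rfloor>}"
    by (auto simp: ceiling_le_iff le_floor_iff abs_le_iff)
  show "finite {l :: int. \<bar>of_int l - c\<bar> \<le> K}" unfolding eq by simp
  show "real (card {l :: int. \<bar>of_int l - c\<bar> \<le> K}) \<le> 2 * K + 1"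
    unfolding eq using assms by (simp add: of_nat_nat; linarith)
qed

lemma integral_cell_close:
  fixes f :: "real ^ 'n \<Rightarrow> real"
  assumes int: "integrable cell_measure f" and close: "\<And>u. u \<in> unit_cell \<Longrightarrow> \<bar>f u - a\<bar> \<le> e"
  shows "\<bar>integral\<^sup>L cell_measure f - a\<bar> \<le> e"
proof -
  interpret finite_measure "cell_measure :: (real ^ 'n) measure" by (rule finite_measure_cell_measure)
  have "integral\<^sup>L cell_measure f \<le> integral\<^sup>L (cell_measure :: (real ^ 'n) measure) (\<lambda>_. a + e)"
    using int close by (intro integral_mono) (auto simp: space_cell_measure abs_le_iff algebra_simps)
  moreover have "integral\<^sup>L (cell_measure :: (real ^ 'n) measure) (\<lambda>_. a - e) \<le> integral\<^sup>L cell_measure f"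
    using int close by (intro integral_mono) (auto simp: space_cell_measure abs_le_iff algebra_simps)
  ultimately show ?thesis by (simp add: measure_space_cell_measure abs_le_iff)
qed

text \<open>The facets of P enter the counting only through these data. \<open>\<nu> i\<close> is
  fixed by the volume of the cylinder of unit \<open>v i\<close>-height over the i-th facet of every
  dilate, so volumes within hyperplanes do not occur here. The vectors \<open>w i\<close> express
  primitivity of the normals. The interior point \<open>p\<close> keeps facets with opposite normals
  apart and lets large dilates absorb bounded changes of the bounds.\<close>

locale lattice_halfspaces =
  fixes I :: "'i set" and v w :: "'i \<Rightarrow> real ^ 'n" and b \<nu> :: "'i \<Rightarrow> real" and p :: "real ^ 'n"
  assumes finite_I: "finite I"
    and v_int: "i \<in> I \<Longrightarrow> v i \<in> int_lattice"
    and w_int: "i \<in> I \<Longrightarrow> w i \<in> int_lattice"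
    and vw: "i \<in> I \<Longrightarrow> v i \<bullet> w i = 1"
    and v_inj: "inj_on v I"
    and p: "i \<in> I \<Longrightarrow> v i \<bullet> p < b i"
    and bounded_base: "bounded {x. \<forall>i\<in>I. v i \<bullet> x \<le> b i}"
    and cylinder: "i \<in> I \<Longrightarrow> s > 0 \<Longrightarrow>
      measure lborel {x + r *\<^sub>R w i | x r. (\<forall>j\<in>I. v j \<bullet> x \<le> s * b j) \<and> v i \<bullet> x = s * b i \<and> 0 \<le> r \<and> r < 1} =
        \<nu> i * s ^ (CARD('n) - 1)"
begin

section \<open>Bounds near those of a dilate\<close>

definition near :: "real \<Rightarrow> real \<Rightarrow> ('i \<Rightarrow> real) \<Rightarrow> bool" where
  "near K s \<kappa> \<longleftrightarrow> (\<forall>i\<in>I. \<bar>\<kappa> i - s * b i\<bar> \<le> K)"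

definition points :: "('i \<Rightarrow> real) \<Rightarrow> (real ^ 'n) set" where
  "points \<kappa> = {z \<in> int_lattice. \<forall>i\<in>I. v i \<bullet> z \<le> \<kappa> i}"

definition slice :: "'i \<Rightarrow> ('i \<Rightarrow> real) \<Rightarrow> (real ^ 'n) set" where
  "slice i \<kappa> = {z \<in> int_lattice. v i \<bullet> z = \<kappa> i \<and> (\<forall>j\<in>I - {i}. v j \<bullet> z \<le> \<kappa> j)}"

text \<open>For d \<ge> 2 this is s^(d-2). It is written as a quotient because for d = 1 the
  exponent would be truncated to 0, whereas the error has to be of order 1/s there.\<close>

definition err :: "real \<Rightarrow> real" where
  "err s = s ^ CARD('n) / s\<^sup>2"

lemma err_nonneg: "s \<ge> 0 \<Longrightarrow> err s \<ge> 0"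
  by (simp add: err_def)

lemma slice_subset_points: "slice i \<kappa> \<subseteq> points \<kappa>"
  by (auto simp: slice_def points_def)

lemma near_mono: "near K s \<kappa> \<Longrightarrow> K \<le> K' \<Longrightarrow> near K' s \<kappa>"
  by (force simp: near_def)

lemma margin: "\<exists>\<eta>>0. \<forall>i\<in>I. v i \<bullet> p + \<eta> \<le> b i"
proof (cases "I = {}")
  case True then show ?thesis by (auto intro: exI[of _ 1])
next
  case False
  let ?m = "Min ((\<lambda>i. b i - v i \<bullet> p) ` I)"
  have "?m > 0" using False finite_I p by simp
  moreover have "v i \<bullet> p + ?m \<le> b i" if "i \<in> I" for i
  proof -
    have "?m \<le> b i - v i \<bullet> p" by (rule Min_le) (use that finite_I in auto)
    then show ?thesis by linarith
  qed
  ultimately show ?thesis by blast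
qed

text \<open>Rescaled by 1/s, a bounded change of the bounds is eventually at most the margin of the
  inequalities at \<open>p\<close>. Hence the midpoint \<open>q\<close> of \<open>p\<close> and
  \<open>(1 / s) *\<^sub>R z\<close> lies in the undilated region, and
  \<open>z = s *\<^sub>R (2 *\<^sub>R q - p)\<close> is bounded linearly in \<open>s\<close>.
  \<open>R\<close> does not depend on \<open>K\<close>; only the threshold for \<open>s\<close>
  does.\<close>

lemma radius:
  obtains R where "R > 0" "\<And>K. \<forall>\<^sub>F s in at_top. \<forall>\<kappa> z. near K s \<kappa> \<longrightarrow> (\<forall>i\<in>I. v i \<bullet> z \<le> \<kappa> i) \<longrightarrow> norm z \<le> R * s"
proof -
  obtain r where r: "r > 0" "\<And>x. (\<forall>i\<in>I. v i \<bullet> x \<le> b i) \<Longrightarrow> norm x \<le> r"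
    using bounded_base by (auto simp: bounded_pos)
  obtain \<eta> where \<eta>: "\<eta> > 0" "\<And>i. i \<in> I \<Longrightarrow> v i \<bullet> p + \<eta> \<le> b i" using margin by blast
  define R where "R = 2 * r + norm p"
  have "\<forall>\<^sub>F s in at_top. \<forall>\<kappa> z. near K s \<kappa> \<longrightarrow> (\<forall>i\<in>I. v i \<bullet> z \<le> \<kappa> i) \<longrightarrow> norm z \<le> R * s" for K
    using eventually_ge_at_top[of "max 1 (K / \<eta>)"]
  proof eventually_elim
    case (elim s)
    then have s: "s \<ge> 1" "K \<le> s * \<eta>" using \<eta>(1) by (auto simp: field_simps)
    show ?case
    proof (intro allI impI)
      fix \<kappa> z assume near: "near K s \<kappa>" and z: "\<forall>i\<in>I. v i \<bullet> z \<le> \<kappa> i"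
      define q where "q = (1 / 2) *\<^sub>R (p + (1 / s) *\<^sub>R z)"
      have "v i \<bullet> q \<le> b i" if i: "i \<in> I" for i
      proof -
        have "v i \<bullet> z \<le> s * b i + s * \<eta>" using near z i s unfolding near_def by (smt (verit, best))
        then have "(v i \<bullet> z) / s \<le> b i + \<eta>" using s by (simp add: field_simps)
        then show ?thesis using \<eta>(2)[OF i] by (simp add: q_def inner_add_right)
      qed
      then have "norm q \<le> r" using r(2) by blast
      have "z = s *\<^sub>R (2 *\<^sub>R q - p)" using s by (simp add: q_def)
      then have "norm z = s * norm (2 *\<^sub>R q - p)" using s by (metis abs_of_nonneg norm_scaleR order_trans zero_le_one)
      also have "norm (2 *\<^sub>R q - p) \<le> R"
        using norm_triangle_ineq4[of "2 *\<^sub>R q" p] \<open>norm q \<le> r\<close> by (simp add: R_def)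
      finally show "norm z \<le> R * s" using s by (simp add: mult.commute)
    qed
  qed
  moreover have "R > 0" using r by (simp add: R_def add_pos_nonneg)
  ultimately show ?thesis using that by blast
qed

lemma finite_points: "\<forall>\<^sub>F s in at_top. \<forall>\<kappa>. near K s \<kappa> \<longrightarrow> finite (points \<kappa>)"
proof -
  obtain R where R: "\<And>K. \<forall>\<^sub>F s in at_top. \<forall>\<kappa> z. near K s \<kappa> \<longrightarrow> (\<forall>i\<in>I. v i \<bullet> z \<le> \<kappa> i) \<longrightarrow> norm z \<le> R * s"
    using radius by blast
  from R[of K] show ?thesis
  proof eventually_elim
    case (elim s)
    show ?case
    proof (intro allI impI)
      fix \<kappa> assume "near K s \<kappa>"
      then have "points \<kappa> \<subseteq> {z. z \<in> int_lattice \<and> z \<in> cball 0 (R * s)}" using elim by (auto simp: points_def)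
      then show "finite (points \<kappa>)" using finite_int_lattice_bounded[OF bounded_cball] finite_subset by blast
    qed
  qed
qed

text \<open>Parallel normals are equal or opposite, because pairing with \<open>w i\<close> and
  \<open>w j\<close> makes the factor a unit of the integers. Equality is excluded by injectivity,
  and opposite facets move apart as \<open>s\<close> grows, so no common point is left. Otherwise
  the two equations are independent and leave d - 2 free coordinates.\<close>

lemma two_facet_bound:
  assumes i: "i \<in> I" and j: "j \<in> I" and ij: "i \<noteq> j" and R: "R > 0"
  shows "\<exists>C. \<forall>\<^sub>F s in at_top. \<forall>k l. \<bar>k - s * b i\<bar> \<le> K \<longrightarrow> \<bar>l - s * b j\<bar> \<le> K \<longrightarrow>
    real (card {z \<in> int_lattice. norm z \<le> R * s \<and> v i \<bullet> z = k \<and> v j \<bullet> z = l}) \<le> C * err s"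
proof (cases "\<exists>c. v j = c *\<^sub>R v i")
  case True
  then obtain c where c: "v j = c *\<^sub>R v i" by auto
  have "c = v j \<bullet> w i" using c vw[OF i] by simp
  then have "c \<in> \<int>" using int_lattice_inner v_int[OF j] w_int[OF i] by metis
  then obtain c' where c': "c = of_int c'" by (auto elim: Ints_cases)
  have "v i \<bullet> w j \<in> \<int>" using int_lattice_inner v_int[OF i] w_int[OF j] by metis
  then obtain e' where e': "v i \<bullet> w j = of_int e'" by (auto elim: Ints_cases)
  have "of_int c' * of_int e' = (1 :: real)" using vw[OF j] c c' e' by simp
  then have "c' * e' = 1" by (metis of_int_1 of_int_eq_iff of_int_mult)
  then have "c' = 1 \<or> c' = - 1" using zmult_eq_1_iff by auto
  moreover have "c' \<noteq> 1" using c c' v_inj i j ij by (auto simp: inj_on_def)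
  ultimately have vj: "v j = - v i" using c c' by simp
  \<comment> \<open>The range of \<open>v i\<close> between the two opposite facets of the undilated
    region; \<open>p\<close> makes it positive.\<close>
  define \<delta> where "\<delta> = b i + b j"
  have \<delta>: "\<delta> > 0" using p[OF i] p[OF j] by (simp add: vj \<delta>_def)
  have "\<forall>\<^sub>F s in at_top. \<forall>k l. \<bar>k - s * b i\<bar> \<le> K \<longrightarrow> \<bar>l - s * b j\<bar> \<le> K \<longrightarrow>
    real (card {z \<in> int_lattice. norm z \<le> R * s \<and> v i \<bullet> z = k \<and> v j \<bullet> z = l}) \<le> 0 * err s"
    using eventually_gt_at_top[of "2 * K / \<delta>"]
  proof eventually_elim
    case (elim s)
    then have s: "2 * K < s * b i + s * b j" using \<delta> by (simp add: field_simps \<delta>_def)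
    show ?case
    proof (intro allI impI)
      fix k l assume kl: "\<bar>k - s * b i\<bar> \<le> K" "\<bar>l - s * b j\<bar> \<le> K"
      have "k \<noteq> - l" using kl s by linarith
      then have e: "{z \<in> int_lattice. norm z \<le> R * s \<and> v i \<bullet> z = k \<and> v j \<bullet> z = l} = {}"
        by (auto simp: vj)
      show "real (card {z \<in> int_lattice. norm z \<le> R * s \<and> v i \<bullet> z = k \<and> v j \<bullet> z = l}) \<le> 0 * err s"
        unfolding e by simp
    qed
  qed
  then show ?thesis by blast
next
  case False
  have "v i \<noteq> 0" using vw[OF i] by auto
  then obtain a q where minor: "v i $ a * v j $ q \<noteq> v i $ q * v j $ a"
    using exists_nonzero_minor[of "v i" "v j"] False by metis
  then have aq: "a \<noteq> q" by auto
  \<comment> \<open>With two different coordinates the exponent d - 2 is not truncated and matches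
    \<open>err\<close>.\<close>
  have N: "CARD('n) \<ge> 2" using card_mono[of "UNIV :: 'n set" "{a, q}"] aq by simp
  have "\<forall>\<^sub>F s in at_top. \<forall>k l. \<bar>k - s * b i\<bar> \<le> K \<longrightarrow> \<bar>l - s * b j\<bar> \<le> K \<longrightarrow>
    real (card {z \<in> int_lattice. norm z \<le> R * s \<and> v i \<bullet> z = k \<and> v j \<bullet> z = l}) \<le> (2 * R + 3) ^ (CARD('n) - 2) * err s"
    using eventually_ge_at_top[of 1]
  proof eventually_elim
    case (elim s)
    show ?case
    proof (intro allI impI)
      fix k l
      have "real (card {z \<in> int_lattice. norm z \<le> R * s \<and> v i \<bullet> z = k \<and> v j \<bullet> z = l}) \<le> (2 * (R * s) + 3) ^ (CARD('n) - 2)"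
        using R elim by (intro card_lattice_codim_two[OF minor]) simp
      also have "\<dots> \<le> ((2 * R + 3) * s) ^ (CARD('n) - 2)"
        using R elim by (intro power_mono) (auto simp: algebra_simps)
      also have "\<dots> = (2 * R + 3) ^ (CARD('n) - 2) * err s"
        using N elim by (simp add: power_mult_distrib err_def power_diff)
      finally show "real (card {z \<in> int_lattice. norm z \<le> R * s \<and> v i \<bullet> z = k \<and> v j \<bullet> z = l}) \<le> (2 * R + 3) ^ (CARD('n) - 2) * err s" .
    qed
  qed
  then show ?thesis by blast
qed

text \<open>A point of one slice missing from the other respects the bound \<open>\<kappa> j\<close>
  and violates \<open>\<kappa>' j\<close> for some \<open>j \<noteq> i\<close>. So
  \<open>v j \<bullet> z\<close> is an integer within \<open>K\<close> of \<open>s * b j\<close>,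
  one of at most \<open>2 * K + 1\<close>, and the point lies on two prescribed levels.\<close>

lemma slice_diff_bound:
  assumes i: "i \<in> I" and K: "K \<ge> 0"
  shows "\<exists>C. \<forall>\<^sub>F s in at_top. \<forall>\<kappa> \<kappa>'. near K s \<kappa> \<longrightarrow> near K s \<kappa>' \<longrightarrow> \<kappa> i = \<kappa>' i \<longrightarrow>
    real (card (slice i \<kappa> - slice i \<kappa>')) \<le> C * err s"
proof -
  obtain R where R: "R > 0" "\<And>K. \<forall>\<^sub>F s in at_top. \<forall>\<kappa> z. near K s \<kappa> \<longrightarrow> (\<forall>i\<in>I. v i \<bullet> z \<le> \<kappa> i) \<longrightarrow> norm z \<le> R * s"
    using radius by blast
  define T where "T = (\<lambda>s k j l. {z \<in> int_lattice. norm z \<le> R * s \<and> v i \<bullet> z = k \<and> v j \<bullet> z = l})"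
  have "\<forall>j\<in>I - {i}. \<exists>C. \<forall>\<^sub>F s in at_top. \<forall>k l. \<bar>k - s * b i\<bar> \<le> K \<longrightarrow> \<bar>l - s * b j\<bar> \<le> K \<longrightarrow>
     real (card (T s k j l)) \<le> C * err s"
  proof
    fix j assume "j \<in> I - {i}"
    then show "\<exists>C. \<forall>\<^sub>F s in at_top. \<forall>k l. \<bar>k - s * b i\<bar> \<le> K \<longrightarrow> \<bar>l - s * b j\<bar> \<le> K \<longrightarrow>
       real (card (T s k j l)) \<le> C * err s"
      unfolding T_def by (intro two_facet_bound[OF i _ _ R(1)]) auto
  qed
  from bchoice[OF this] obtain C where
    C: "\<forall>j\<in>I - {i}. \<forall>\<^sub>F s in at_top. \<forall>k l. \<bar>k - s * b i\<bar> \<le> K \<longrightarrow> \<bar>l - s * b j\<bar> \<le> K \<longrightarrow>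
     real (card (T s k j l)) \<le> C j * err s" ..
  have Cb: "\<forall>\<^sub>F s in at_top. \<forall>j\<in>I - {i}. \<forall>k l. \<bar>k - s * b i\<bar> \<le> K \<longrightarrow> \<bar>l - s * b j\<bar> \<le> K \<longrightarrow>
     real (card (T s k j l)) \<le> C j * err s"
    using C finite_I by (intro eventually_ball_finite) auto
  have "\<forall>\<^sub>F s in at_top. \<forall>\<kappa> \<kappa>'. near K s \<kappa> \<longrightarrow> near K s \<kappa>' \<longrightarrow> \<kappa> i = \<kappa>' i \<longrightarrow>
    real (card (slice i \<kappa> - slice i \<kappa>')) \<le> (\<Sum>j\<in>I - {i}. (2 * K + 1) * \<bar>C j\<bar>) * err s"
    using Cb R(2)[of K] eventually_ge_at_top[of 0]
  proof eventually_elim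
    case (elim s)
    show ?case
    proof (intro allI impI)
      fix \<kappa> \<kappa>' assume near: "near K s \<kappa>" "near K s \<kappa>'" and eq: "\<kappa> i = \<kappa>' i"
      define Ls where "Ls = (\<lambda>j. {l :: int. \<bar>of_int l - s * b j\<bar> \<le> K})"
      have ki: "\<bar>\<kappa> i - s * b i\<bar> \<le> K" using near i by (simp add: near_def)
      have Tfin: "finite (T s k j l)" for k j l
        using finite_int_lattice_bounded[OF bounded_cball[of 0 "R * s"]]
        by (rule rev_finite_subset) (auto simp: T_def)
      have Lfin: "finite (Ls j)" for j unfolding Ls_def by (rule card_int_near(1)[OF K])
      have sub: "slice i \<kappa> - slice i \<kappa>' \<subseteq> (\<Union>j\<in>I - {i}. \<Union>l\<in>Ls j. T s (\<kappa> i) j (of_int l))"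
      proof
        fix z assume z: "z \<in> slice i \<kappa> - slice i \<kappa>'"
        then obtain j where j: "j \<in> I - {i}" "v j \<bullet> z > \<kappa>' j" using eq by (auto simp: slice_def not_le)
        have zZ: "z \<in> int_lattice" "v i \<bullet> z = \<kappa> i" and zj: "v j \<bullet> z \<le> \<kappa> j" and "z \<in> points \<kappa>"
          using z j slice_subset_points by (auto simp: slice_def)
        then have "norm z \<le> R * s" using elim(2) near(1) by (auto simp: points_def)
        have "v j \<bullet> z \<in> \<int>" using int_lattice_inner v_int zZ j by auto
        then obtain l where l: "v j \<bullet> z = of_int l" by (auto elim: Ints_cases)
        have "\<bar>\<kappa> j - s * b j\<bar> \<le> K" "\<bar>\<kappa>' j - s * b j\<bar> \<le> K" using near j by (auto simp: near_def)
        then have "l \<in> Ls j" using zj j(2) l by (auto simp: Ls_def)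
        moreover have "z \<in> T s (\<kappa> i) j (of_int l)" using zZ l \<open>norm z \<le> R * s\<close> by (simp add: T_def)
        ultimately show "z \<in> (\<Union>j\<in>I - {i}. \<Union>l\<in>Ls j. T s (\<kappa> i) j (of_int l))" using j by blast
      qed
      have "card (slice i \<kappa> - slice i \<kappa>') \<le> card (\<Union>j\<in>I - {i}. \<Union>l\<in>Ls j. T s (\<kappa> i) j (of_int l))"
        using sub finite_I Lfin Tfin by (intro card_mono) auto
      also have "\<dots> \<le> (\<Sum>j\<in>I - {i}. card (\<Union>l\<in>Ls j. T s (\<kappa> i) j (of_int l)))"
        using finite_I by (intro card_UN_le) auto
      also have "\<dots> \<le> (\<Sum>j\<in>I - {i}. \<Sum>l\<in>Ls j. card (T s (\<kappa> i) j (of_int l)))"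
        by (intro sum_mono card_UN_le Lfin)
      finally have "real (card (slice i \<kappa> - slice i \<kappa>')) \<le> (\<Sum>j\<in>I - {i}. \<Sum>l\<in>Ls j. real (card (T s (\<kappa> i) j (of_int l))))"
        by (simp only: of_nat_sum[symmetric] of_nat_le_iff)
      also have "\<dots> \<le> (\<Sum>j\<in>I - {i}. \<Sum>l\<in>Ls j. \<bar>C j\<bar> * err s)"
      proof (intro sum_mono)
        fix j l assume j: "j \<in> I - {i}" and l: "l \<in> Ls j"
        have "real (card (T s (\<kappa> i) j (of_int l))) \<le> C j * err s"
          using elim(1) j l ki by (auto simp: Ls_def)
        also have "\<dots> \<le> \<bar>C j\<bar> * err s" using err_nonneg[OF elim(3)] by (intro mult_right_mono) auto
        finally show "real (card (T s (\<kappa> i) j (of_int l))) \<le> \<bar>C j\<bar> * err s" .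
      qed
      also have "\<dots> = (\<Sum>j\<in>I - {i}. real (card (Ls j)) * (\<bar>C j\<bar> * err s))" by simp
      also have "\<dots> \<le> (\<Sum>j\<in>I - {i}. (2 * K + 1) * (\<bar>C j\<bar> * err s))"
        using err_nonneg[OF elim(3)] card_int_near(2)[OF K]
        by (intro sum_mono mult_right_mono) (auto simp: Ls_def)
      also have "\<dots> = (\<Sum>j\<in>I - {i}. (2 * K + 1) * \<bar>C j\<bar>) * err s"
        by (simp add: sum_distrib_right mult.assoc)
      finally show "real (card (slice i \<kappa> - slice i \<kappa>')) \<le> (\<Sum>j\<in>I - {i}. (2 * K + 1) * \<bar>C j\<bar>) * err s" .
    qed
  qed
  then show ?thesis by blast
qed

lemma slice_same_level:
  assumes i: "i \<in> I" and K: "K \<ge> 0"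
  shows "\<exists>C. \<forall>\<^sub>F s in at_top. \<forall>\<kappa> \<kappa>'. near K s \<kappa> \<longrightarrow> near K s \<kappa>' \<longrightarrow> \<kappa> i = \<kappa>' i \<longrightarrow>
    \<bar>real (card (slice i \<kappa>)) - real (card (slice i \<kappa>'))\<bar> \<le> C * err s"
proof -
  obtain C where C: "\<forall>\<^sub>F s in at_top. \<forall>\<kappa> \<kappa>'. near K s \<kappa> \<longrightarrow> near K s \<kappa>' \<longrightarrow> \<kappa> i = \<kappa>' i \<longrightarrow>
    real (card (slice i \<kappa> - slice i \<kappa>')) \<le> C * err s"
    using slice_diff_bound[OF assms] by blast
  have "\<forall>\<^sub>F s in at_top. \<forall>\<kappa> \<kappa>'. near K s \<kappa> \<longrightarrow> near K s \<kappa>' \<longrightarrow> \<kappa> i = \<kappa>' i \<longrightarrow>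
    \<bar>real (card (slice i \<kappa>)) - real (card (slice i \<kappa>'))\<bar> \<le> C * err s"
    using C finite_points[of K]
  proof eventually_elim
    case (elim s)
    have one: "real (card (slice i \<kappa>)) \<le> real (card (slice i \<kappa>')) + C * err s"
      if near: "near K s \<kappa>" "near K s \<kappa>'" and eq: "\<kappa> i = \<kappa>' i" for \<kappa> \<kappa>'
    proof -
      have fin: "finite (slice i \<kappa>)" "finite (slice i \<kappa>')"
        using elim(2) near by (auto intro: finite_subset[OF slice_subset_points])
      have "card (slice i \<kappa>) \<le> card (slice i \<kappa>' \<union> (slice i \<kappa> - slice i \<kappa>'))"
        using fin by (intro card_mono) auto
      also have "\<dots> \<le> card (slice i \<kappa>') + card (slice i \<kappa> - slice i \<kappa>')" by (rule card_Un_le)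
      finally have "real (card (slice i \<kappa>)) \<le> real (card (slice i \<kappa>')) + real (card (slice i \<kappa> - slice i \<kappa>'))" by simp
      moreover have "real (card (slice i \<kappa> - slice i \<kappa>')) \<le> C * err s" using elim(1) near eq by blast
      ultimately show ?thesis by linarith
    qed
    show ?case
    proof (intro allI impI)
      fix \<kappa> \<kappa>' assume "near K s \<kappa>" "near K s \<kappa>'" "\<kappa> i = \<kappa>' i"
      then show "\<bar>real (card (slice i \<kappa>)) - real (card (slice i \<kappa>'))\<bar> \<le> C * err s"
        using one[of \<kappa> \<kappa>'] one[of \<kappa>' \<kappa>] by simp
    qed
  qed
  then show ?thesis by blast
qed

section \<open>Slices at different levels and their size\<close>

lemma card_slice_shift:
  assumes i: "i \<in> I" and m: "m \<in> \<int>"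
  shows "card (slice i (\<lambda>j. \<kappa> j - m * (v j \<bullet> w i))) = card (slice i \<kappa>)"
proof -
  have "bij_betw (\<lambda>z. z + m *\<^sub>R w i) (slice i (\<lambda>j. \<kappa> j - m * (v j \<bullet> w i))) (slice i \<kappa>)"
  proof (rule bij_betw_byWitness[where f' = "\<lambda>z. z - m *\<^sub>R w i"])
    have mw: "m *\<^sub>R w i \<in> int_lattice" by (rule int_lattice_closed(5)[OF w_int[OF i] m])
    show "(\<lambda>z. z + m *\<^sub>R w i) ` slice i (\<lambda>j. \<kappa> j - m * (v j \<bullet> w i)) \<subseteq> slice i \<kappa>"
      using int_lattice_closed(2)[OF _ mw] by (auto simp: slice_def inner_add_right algebra_simps)
    show "(\<lambda>z. z - m *\<^sub>R w i) ` slice i \<kappa> \<subseteq> slice i (\<lambda>j. \<kappa> j - m * (v j \<bullet> w i))"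
      using int_lattice_closed(3)[OF _ mw] by (auto simp: slice_def inner_diff_right algebra_simps)
  qed auto
  then show ?thesis by (rule bij_betw_same_card)
qed

text \<open>Translation by a multiple of \<open>w i\<close> moves one slice to the level of the
  other; integrality of both levels makes this a lattice translation. The multiple is at most
  \<open>2 * K\<close> in absolute value, so the other bounds move by at most
  \<open>2 * K * W\<close>, and the comparison at equal levels applies in the larger window
  \<open>K'\<close>.\<close>

lemma slice_stable:
  assumes i: "i \<in> I" and K: "K \<ge> 0"
  shows "\<exists>C. \<forall>\<^sub>F s in at_top. \<forall>\<kappa> \<kappa>'. near K s \<kappa> \<longrightarrow> near K s \<kappa>' \<longrightarrow> \<kappa> i \<in> \<int> \<longrightarrow> \<kappa>' i \<in> \<int> \<longrightarrow>
    \<bar>real (card (slice i \<kappa>)) - real (card (slice i \<kappa>'))\<bar> \<le> C * err s"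
proof -
  define W where "W = (\<Sum>j\<in>I. \<bar>v j \<bullet> w i\<bar>)"
  have W: "\<bar>v j \<bullet> w i\<bar> \<le> W" if "j \<in> I" for j
    unfolding W_def using finite_I that by (intro member_le_sum) auto
  have W0: "W \<ge> 0" by (auto simp: W_def intro: sum_nonneg)
  define K' where "K' = K + 2 * K * W"
  have K': "K' \<ge> K" "K' \<ge> 0" using K W0 by (auto simp: K'_def)
  obtain C where C: "\<forall>\<^sub>F s in at_top. \<forall>\<kappa> \<kappa>'. near K' s \<kappa> \<longrightarrow> near K' s \<kappa>' \<longrightarrow> \<kappa> i = \<kappa>' i \<longrightarrow>
    \<bar>real (card (slice i \<kappa>)) - real (card (slice i \<kappa>'))\<bar> \<le> C * err s"
    using slice_same_level[OF i K'(2)] by blast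
  from C have "\<forall>\<^sub>F s in at_top. \<forall>\<kappa> \<kappa>'. near K s \<kappa> \<longrightarrow> near K s \<kappa>' \<longrightarrow> \<kappa> i \<in> \<int> \<longrightarrow> \<kappa>' i \<in> \<int> \<longrightarrow>
    \<bar>real (card (slice i \<kappa>)) - real (card (slice i \<kappa>'))\<bar> \<le> C * err s"
  proof eventually_elim
    case (elim s)
    show ?case
    proof (intro allI impI)
      fix \<kappa> \<kappa>' assume near: "near K s \<kappa>" "near K s \<kappa>'" and int: "\<kappa> i \<in> \<int>" "\<kappa>' i \<in> \<int>"
      define m where "m = \<kappa>' i - \<kappa> i"
      define \<kappa>'' where "\<kappa>'' = (\<lambda>j. \<kappa>' j - m * (v j \<bullet> w i))"
      have m: "m \<in> \<int>" using int by (auto simp: m_def)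
      have m2: "\<bar>m\<bar> \<le> 2 * K"
      proof -
        have "\<bar>\<kappa> i - s * b i\<bar> \<le> K" "\<bar>\<kappa>' i - s * b i\<bar> \<le> K" using near i by (auto simp: near_def)
        then show ?thesis unfolding m_def by linarith
      qed
      have "near K' s \<kappa>''"
        unfolding near_def
      proof
        fix j assume j: "j \<in> I"
        have "\<bar>m * (v j \<bullet> w i)\<bar> \<le> 2 * K * W"
          unfolding abs_mult using m2 W[OF j] K by (intro mult_mono) auto
        moreover have "\<bar>\<kappa>' j - s * b j\<bar> \<le> K" using near j by (auto simp: near_def)
        ultimately show "\<bar>\<kappa>'' j - s * b j\<bar> \<le> K'" unfolding \<kappa>''_def K'_def by linarith
      qed
      moreover have "near K' s \<kappa>" using near(1) K' near_mono by blast
      moreover have "\<kappa> i = \<kappa>'' i" using vw[OF i] by (simp add: \<kappa>''_def m_def)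
      ultimately have "\<bar>real (card (slice i \<kappa>)) - real (card (slice i \<kappa>''))\<bar> \<le> C * err s" using elim by blast
      then show "\<bar>real (card (slice i \<kappa>)) - real (card (slice i \<kappa>'))\<bar> \<le> C * err s"
        using card_slice_shift[OF i m, of \<kappa>'] by (simp add: \<kappa>''_def)
    qed
  qed
  then show ?thesis by blast
qed

lemma inner_cell_bound:
  assumes "u \<in> unit_cell"
  shows "\<bar>v i \<bullet> u\<bar> \<le> norm (v i) * real CARD('n)"
  using Cauchy_Schwarz_ineq2[of "v i" u] mult_left_mono[OF unit_cell_norm[OF assms] norm_ge_zero[of "v i"]]
  by linarith

definition body :: "real \<Rightarrow> (real ^ 'n) set" where
  "body s = {x. \<forall>i\<in>I. v i \<bullet> x \<le> s * b i}"

lemma bounded_body: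
  assumes "s > 0"
  shows "bounded (body s)"
proof -
  have "body s \<subseteq> (\<lambda>x. s *\<^sub>R x) ` {x. \<forall>i\<in>I. v i \<bullet> x \<le> b i}"
  proof
    fix x assume "x \<in> body s"
    then have "(1 / s) *\<^sub>R x \<in> {x. \<forall>i\<in>I. v i \<bullet> x \<le> b i}"
      using assms by (auto simp: body_def field_simps)
    moreover have "x = s *\<^sub>R ((1 / s) *\<^sub>R x)" using assms by simp
    ultimately show "x \<in> (\<lambda>x. s *\<^sub>R x) ` {x. \<forall>i\<in>I. v i \<bullet> x \<le> b i}" by blast
  qed
  then show ?thesis using bounded_scaling[OF bounded_base] bounded_subset by blast
qed

text \<open>The volume of the cylinder over the facet is the mean number of lattice points in its
  translates. On the half-open cylinder \<open>v i\<close> runs through an interval of length 1, so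
  the lattice points of a translate lie on one integer level and form a slice with bounds near those
  of the dilate. All such slices have the same size up to \<open>err\<close>, so the mean has this
  size too.\<close>

lemma slice_volume:
  assumes i: "i \<in> I" and K: "K \<ge> 0"
  shows "\<exists>C. \<forall>\<^sub>F s in at_top. \<forall>\<kappa>. near K s \<kappa> \<longrightarrow> \<kappa> i \<in> \<int> \<longrightarrow>
    \<bar>\<nu> i * s ^ (CARD('n) - 1) - real (card (slice i \<kappa>))\<bar> \<le> C * err s"
proof -
  \<comment> \<open>The first term bounds \<open>v j \<bullet> u\<close> on the unit cell, the
    second the shift along \<open>w i\<close> inside the cylinder. The extra 1 in \<open>K'\<close>
    pays for rounding the level.\<close>
  define W where "W = (\<lambda>j. norm (v j) * real CARD('n) + \<bar>v j \<bullet> w i\<bar>)"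
  have W0: "W j \<ge> 0" for j by (simp add: W_def)
  define K' where "K' = K + (\<Sum>j\<in>I. W j) + 1"
  have WK: "W j + 1 \<le> K'" if "j \<in> I" for j
  proof -
    have "W j \<le> (\<Sum>j\<in>I. W j)" using finite_I that W0 by (intro member_le_sum) auto
    then show ?thesis using K by (simp add: K'_def)
  qed
  have sumW: "(\<Sum>j\<in>I. W j) \<ge> 0" using W0 by (intro sum_nonneg) auto
  have K': "K' \<ge> K" "K' \<ge> 0" using K sumW by (simp_all add: K'_def)
  obtain C where C: "\<forall>\<^sub>F s in at_top. \<forall>\<kappa> \<kappa>'. near K' s \<kappa> \<longrightarrow> near K' s \<kappa>' \<longrightarrow> \<kappa> i \<in> \<int> \<longrightarrow> \<kappa>' i \<in> \<int> \<longrightarrow>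
    \<bar>real (card (slice i \<kappa>)) - real (card (slice i \<kappa>'))\<bar> \<le> C * err s"
    using slice_stable[OF i K'(2)] by blast
  have "\<forall>\<^sub>F s in at_top. \<forall>\<kappa>. near K s \<kappa> \<longrightarrow> \<kappa> i \<in> \<int> \<longrightarrow>
    \<bar>\<nu> i * s ^ (CARD('n) - 1) - real (card (slice i \<kappa>))\<bar> \<le> C * err s"
    using C eventually_gt_at_top[of 0]
  proof eventually_elim
    case (elim s)
    define X where "X = {x + r *\<^sub>R w i | x r. (\<forall>j\<in>I. v j \<bullet> x \<le> s * b j) \<and> v i \<bullet> x = s * b i \<and> 0 \<le> r \<and> r < 1}"
    have mem_X: "y \<in> X \<longleftrightarrow> 0 \<le> v i \<bullet> y - s * b i \<and> v i \<bullet> y - s * b i < 1 \<and>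
       (\<forall>j\<in>I. v j \<bullet> (y - (v i \<bullet> y - s * b i) *\<^sub>R w i) \<le> s * b j)" (is "_ \<longleftrightarrow> ?R y") for y
    proof
      assume "y \<in> X"
      then obtain x r where x: "y = x + r *\<^sub>R w i" "\<forall>j\<in>I. v j \<bullet> x \<le> s * b j" "v i \<bullet> x = s * b i" "0 \<le> r" "r < 1"
        unfolding X_def by blast
      then have "v i \<bullet> y - s * b i = r" using vw[OF i] by (simp add: inner_add_right)
      then show "?R y" using x by simp
    next
      assume R: "?R y"
      have "v i \<bullet> (y - (v i \<bullet> y - s * b i) *\<^sub>R w i) = s * b i" using vw[OF i] by (simp add: inner_diff_right)
      then show "y \<in> X" unfolding X_def using R
        by (intro CollectI exI[of _ "y - (v i \<bullet> y - s * b i) *\<^sub>R w i"] exI[of _ "v i \<bullet> y - s * b i"]) auto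
    qed
    have Xb: "X \<in> sets borel"
    proof -
      have "{y \<in> space borel. 0 \<le> v i \<bullet> y - s * b i \<and> v i \<bullet> y - s * b i < 1 \<and>
       (\<forall>j\<in>I. v j \<bullet> (y - (v i \<bullet> y - s * b i) *\<^sub>R w i) \<le> s * b j)} \<in> sets borel"
        by (intro sets.sets_Collect_conj sets.sets_Collect_finite_All finite_I; measurable)
      moreover have "X = {y \<in> space borel. 0 \<le> v i \<bullet> y - s * b i \<and> v i \<bullet> y - s * b i < 1 \<and>
       (\<forall>j\<in>I. v j \<bullet> (y - (v i \<bullet> y - s * b i) *\<^sub>R w i) \<le> s * b j)}"
        by (intro set_eqI) (simp only: mem_X mem_Collect_eq space_borel UNIV_I simp_thms)
      ultimately show ?thesis by simp
    qed
    have bX: "bounded X"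
    proof -
      obtain a where a: "\<And>x. x \<in> body s \<Longrightarrow> norm x \<le> a" using bounded_body[OF elim(2)] by (auto simp: bounded_iff)
      have "norm y \<le> a + norm (w i)" if "y \<in> X" for y
      proof -
        from that obtain x r where x: "y = x + r *\<^sub>R w i" "x \<in> body s" "0 \<le> r" "r < 1"
          unfolding X_def body_def by blast
        have "norm y \<le> norm x + norm (r *\<^sub>R w i)" unfolding x(1) by (rule norm_triangle_ineq)
        also have "norm (r *\<^sub>R w i) \<le> 1 * norm (w i)" unfolding norm_scaleR using x by (intro mult_right_mono) auto
        finally show ?thesis using a[OF x(2)] by simp
      qed
      then show ?thesis by (auto simp: bounded_iff)
    qed
    show ?case
    proof (intro allI impI)
      fix \<kappa> assume near: "near K s \<kappa>" and int: "\<kappa> i \<in> \<int>"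
      have near': "near K' s \<kappa>" using near K' near_mono by blast
      have "\<bar>integral\<^sup>L cell_measure (\<lambda>u. real (card {z \<in> int_lattice. z + u \<in> X})) - real (card (slice i \<kappa>))\<bar> \<le> C * err s"
      proof (rule integral_cell_close[OF measure_eq_integral_count(1)[OF Xb bX]])
        fix u :: "real ^ 'n" assume u: "u \<in> unit_cell"
        \<comment> \<open>\<open>k\<close> is the only integer level met by the cylinder translated
          by \<open>- u\<close>, and \<open>\<rho>\<close> is its height above the facet.\<close>
        define k where "k = \<lceil>s * b i - v i \<bullet> u\<rceil>"
        define \<rho> where "\<rho> = of_int k + v i \<bullet> u - s * b i"
        define \<kappa>' where "\<kappa>' = (\<lambda>j. if j = i then of_int k else s * b j - v j \<bullet> u + \<rho> * (v j \<bullet> w i))"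
        have \<rho>: "0 \<le> \<rho>" "\<rho> < 1" unfolding \<rho>_def k_def by linarith+
        have "z + u \<in> X \<longleftrightarrow> z \<in> slice i \<kappa>'" if z: "z \<in> int_lattice" for z
        proof -
          have "v i \<bullet> z \<in> \<int>" using int_lattice_inner[OF v_int[OF i] z] .
          then obtain l where l: "v i \<bullet> z = of_int l" by (auto elim: Ints_cases)
          have lk: "0 \<le> v i \<bullet> (z + u) - s * b i \<and> v i \<bullet> (z + u) - s * b i < 1 \<longleftrightarrow> l = k"
            unfolding inner_add_right l k_def by linarith
          show ?thesis
          proof (cases "l = k")
            case False
            then show ?thesis using lk l by (auto simp: mem_X slice_def \<kappa>'_def)
          next
            case True
            then have r: "v i \<bullet> (z + u) - s * b i = \<rho>" by (simp add: inner_add_right l \<rho>_def)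
            have ii: "v i \<bullet> (z + u - \<rho> *\<^sub>R w i) = s * b i"
              using r vw[OF i] by (simp add: inner_diff_right inner_add_right)
            have "z + u \<in> X \<longleftrightarrow> (\<forall>j\<in>I. v j \<bullet> (z + u - \<rho> *\<^sub>R w i) \<le> s * b j)"
              unfolding mem_X r using \<rho> by simp
            also have "\<dots> \<longleftrightarrow> (\<forall>j\<in>I - {i}. v j \<bullet> (z + u - \<rho> *\<^sub>R w i) \<le> s * b j)"
              using ii by auto
            also have "\<dots> \<longleftrightarrow> (\<forall>j\<in>I - {i}. v j \<bullet> z \<le> \<kappa>' j)"
              by (intro ball_cong refl) (auto simp: \<kappa>'_def inner_diff_right inner_add_right)
            finally show ?thesis using z True l by (simp add: slice_def \<kappa>'_def)
          qed
        qed
        then have eq: "{z \<in> int_lattice. z + u \<in> X} = slice i \<kappa>'" by (auto simp: slice_def)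
        have "near K' s \<kappa>'"
          unfolding near_def
        proof
          fix j assume j: "j \<in> I"
          note bd = inner_cell_bound[OF u, of j]
          show "\<bar>\<kappa>' j - s * b j\<bar> \<le> K'"
          proof (cases "j = i")
            case True
            have "\<bar>of_int k - s * b i\<bar> \<le> \<bar>v i \<bullet> u\<bar> + 1" unfolding k_def by linarith
            then show ?thesis using True bd WK[OF j] by (simp add: \<kappa>'_def W_def)
          next
            case False
            have "\<bar>\<rho> * (v j \<bullet> w i)\<bar> \<le> 1 * \<bar>v j \<bullet> w i\<bar>"
              unfolding abs_mult using \<rho> by (intro mult_right_mono) auto
            then show ?thesis using False bd WK[OF j] by (simp add: \<kappa>'_def W_def)
          qed
        qed
        moreover have "\<kappa>' i \<in> \<int>" by (simp add: \<kappa>'_def)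
        ultimately show "\<bar>real (card {z \<in> int_lattice. z + u \<in> X}) - real (card (slice i \<kappa>))\<bar> \<le> C * err s"
          unfolding eq using elim(1) near' int by blast
      qed
      moreover have "integral\<^sup>L cell_measure (\<lambda>u. real (card {z \<in> int_lattice. z + u \<in> X})) = \<nu> i * s ^ (CARD('n) - 1)"
        using measure_eq_integral_count(2)[OF Xb bX] cylinder[OF i elim(2)] unfolding X_def by simp
      ultimately show "\<bar>\<nu> i * s ^ (CARD('n) - 1) - real (card (slice i \<kappa>))\<bar> \<le> C * err s" by simp
    qed
  qed
  then show ?thesis by blast
qed

section \<open>Dependence of the count on the bounds\<close>

lemma near_upd:
  "near K s \<kappa> \<Longrightarrow> \<bar>a - s * b i\<bar> \<le> K \<Longrightarrow> near K s (\<kappa>(i := a))"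
  by (auto simp: near_def)

text \<open>Raising one bound from \<open>m\<close> to \<open>m'\<close> adds the disjoint slices at
  the integer levels in between. There are at most \<open>2 * K\<close> of them, all inside the
  window because it is an interval, and each has the size given by \<open>slice_volume\<close>.
  Lowering is the same statement with the roles exchanged.\<close>

lemma points_upd:
  assumes i: "i \<in> I" and K: "K \<ge> 0"
  shows "\<exists>C. \<forall>\<^sub>F s in at_top. \<forall>\<kappa> (m :: int) m'. near K s (\<kappa>(i := of_int m)) \<longrightarrow> near K s (\<kappa>(i := of_int m')) \<longrightarrow>
    \<bar>real (card (points (\<kappa>(i := of_int m')))) - real (card (points (\<kappa>(i := of_int m)))) -
      (of_int m' - of_int m) * (\<nu> i * s ^ (CARD('n) - 1))\<bar> \<le> C * err s"
proof -
  obtain C where C: "\<forall>\<^sub>F s in at_top. \<forall>\<kappa>. near K s \<kappa> \<longrightarrow> \<kappa> i \<in> \<int> \<longrightarrow>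
    \<bar>\<nu> i * s ^ (CARD('n) - 1) - real (card (slice i \<kappa>))\<bar> \<le> C * err s"
    using slice_volume[OF assms] by blast
  have "\<forall>\<^sub>F s in at_top. \<forall>\<kappa> (m :: int) m'. near K s (\<kappa>(i := of_int m)) \<longrightarrow> near K s (\<kappa>(i := of_int m')) \<longrightarrow>
    \<bar>real (card (points (\<kappa>(i := of_int m')))) - real (card (points (\<kappa>(i := of_int m)))) -
      (of_int m' - of_int m) * (\<nu> i * s ^ (CARD('n) - 1))\<bar> \<le> (2 * K * \<bar>C\<bar>) * err s"
    using C finite_points[of K] eventually_gt_at_top[of 0]
  proof eventually_elim
    case (elim s)
    let ?f = "\<nu> i * s ^ (CARD('n) - 1)"
    have up: "\<bar>real (card (points (\<kappa>(i := of_int m')))) - real (card (points (\<kappa>(i := of_int m)))) -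
      (of_int m' - of_int m) * ?f\<bar> \<le> (2 * K * \<bar>C\<bar>) * err s"
      if near: "near K s (\<kappa>(i := of_int m))" "near K s (\<kappa>(i := of_int m'))" and le: "m \<le> m'" for \<kappa> and m m' :: int
    proof -
      have nr: "\<bar>of_int m - s * b i\<bar> \<le> K" "\<bar>of_int m' - s * b i\<bar> \<le> K"
        using near i by (auto simp: near_def dest!: bspec[of _ _ i])
      let ?S = "\<lambda>k :: int. slice i (\<kappa>(i := of_int k))"
      have nk: "near K s (\<kappa>(i := of_int k))" if "k \<in> {m<..m'}" for k
      proof -
        have "\<bar>of_int k - s * b i\<bar> \<le> K" using nr that by (auto simp: abs_le_iff)
        then show ?thesis using near_upd[OF near(1), of "of_int k" i] by simp
      qed
      have fin: "finite (points (\<kappa>(i := of_int m)))" "finite (points (\<kappa>(i := of_int m')))" using elim(2) near by auto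
      have finS: "finite (?S k)" if "k \<in> {m<..m'}" for k
        using elim(2) nk[OF that] by (auto intro: finite_subset[OF slice_subset_points])
      have split: "points (\<kappa>(i := of_int m')) = points (\<kappa>(i := of_int m)) \<union> (\<Union>k\<in>{m<..m'}. ?S k)" (is "?L = ?A \<union> ?B")
      proof
        show "?L \<subseteq> ?A \<union> ?B"
        proof
          fix z assume z: "z \<in> ?L"
          then have zZ: "z \<in> int_lattice" by (simp add: points_def)
          have "v i \<bullet> z \<in> \<int>" using int_lattice_inner[OF v_int[OF i] zZ] .
          then obtain l where l: "v i \<bullet> z = of_int l" by (auto elim: Ints_cases)
          have others: "\<forall>j\<in>I - {i}. v j \<bullet> z \<le> \<kappa> j"
          proof
            fix j assume "j \<in> I - {i}"
            moreover from this have "v j \<bullet> z \<le> (\<kappa>(i := of_int m')) j" using z unfolding points_def by blast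
            ultimately show "v j \<bullet> z \<le> \<kappa> j" by simp
          qed
          have "l \<le> m'" using z i l by (auto simp: points_def)
          show "z \<in> ?A \<union> ?B"
          proof (cases "l \<le> m")
            case True
            then have "z \<in> ?A" using zZ others l by (auto simp: points_def)
            then show ?thesis by blast
          next
            case False
            then have "z \<in> ?S l" "l \<in> {m<..m'}" using zZ others l \<open>l \<le> m'\<close> by (auto simp: slice_def)
            then show ?thesis by blast
          qed
        qed
        show "?A \<union> ?B \<subseteq> ?L"
          using le by (auto simp: points_def slice_def)
      qed
      have disj: "?A \<inter> ?B = {}" using i by (auto simp: points_def slice_def)
      have finB: "finite ?B" using finS by auto
      have "card ?L = card ?A + card ?B" unfolding split using fin finB disj by (intro card_Un_disjoint) auto
      also have "card ?B = (\<Sum>k\<in>{m<..m'}. card (?S k))"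
        using finS by (intro card_UN_disjoint) (auto simp: slice_def)
      finally have "real (card ?L) = real (card ?A) + (\<Sum>k\<in>{m<..m'}. real (card (?S k)))"
        by (simp only: of_nat_add of_nat_sum)
      then have cnt: "real (card ?L) - real (card ?A) = (\<Sum>k\<in>{m<..m'}. real (card (?S k)))" by linarith
      have num: "real (card {m<..m'}) = of_int m' - of_int m" using le by simp
      have "(\<Sum>k\<in>{m<..m'}. real (card (?S k))) - (of_int m' - of_int m) * ?f = (\<Sum>k\<in>{m<..m'}. real (card (?S k)) - ?f)"
        by (simp only: sum_subtractf sum_constant num)
      also have "\<bar>\<dots>\<bar> \<le> (\<Sum>k\<in>{m<..m'}. \<bar>real (card (?S k)) - ?f\<bar>)" by (rule sum_abs)
      also have "\<dots> \<le> (\<Sum>k\<in>{m<..m'}. \<bar>C\<bar> * err s)"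
      proof (rule sum_mono)
        fix k assume k: "k \<in> {m<..m'}"
        have "\<bar>?f - real (card (?S k))\<bar> \<le> C * err s" using elim(1) nk[OF k] by simp
        moreover have "C * err s \<le> \<bar>C\<bar> * err s" using err_nonneg[of s] elim(3) by (intro mult_right_mono) auto
        ultimately show "\<bar>real (card (?S k)) - ?f\<bar> \<le> \<bar>C\<bar> * err s" by (simp add: abs_minus_commute)
      qed
      also have "\<dots> = (of_int m' - of_int m) * (\<bar>C\<bar> * err s)" by (simp only: sum_constant num)
      also have "\<dots> \<le> (2 * K) * (\<bar>C\<bar> * err s)"
        using nr err_nonneg[of s] elim(3) by (intro mult_right_mono) auto
      finally show ?thesis unfolding cnt by (simp add: mult.assoc)
    qed
    show ?case
    proof (intro allI impI)
      fix \<kappa> and m m' :: int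
      assume near: "near K s (\<kappa>(i := of_int m))" "near K s (\<kappa>(i := of_int m'))"
      show "\<bar>real (card (points (\<kappa>(i := of_int m')))) - real (card (points (\<kappa>(i := of_int m)))) -
        (of_int m' - of_int m) * ?f\<bar> \<le> (2 * K * \<bar>C\<bar>) * err s"
      proof (cases "m \<le> m'")
        case True then show ?thesis using up near by blast
      next
        case False
        then have h: "\<bar>real (card (points (\<kappa>(i := of_int m)))) - real (card (points (\<kappa>(i := of_int m')))) -
          (of_int m - of_int m') * ?f\<bar> \<le> (2 * K * \<bar>C\<bar>) * err s" using up near by simp
        have "real (card (points (\<kappa>(i := of_int m')))) - real (card (points (\<kappa>(i := of_int m)))) - (of_int m' - of_int m) * ?f =
          - (real (card (points (\<kappa>(i := of_int m)))) - real (card (points (\<kappa>(i := of_int m')))) - (of_int m - of_int m') * ?f)"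
          by (simp add: algebra_simps)
        then show ?thesis using h by (simp only: abs_minus_cancel)
      qed
    qed
  qed
  then show ?thesis by blast
qed

text \<open>The bounds are exchanged one index at a time. Each intermediate system takes its bound
  at every index from \<open>\<kappa>\<close> or from \<open>\<kappa>'\<close>, so it stays in the
  same window, and the errors of the single exchanges add up.\<close>

lemma points_change:
  assumes K: "K \<ge> 0" and "finite J" "J \<subseteq> I"
  shows "\<exists>C. \<forall>\<^sub>F s in at_top. \<forall>(\<kappa> :: 'i \<Rightarrow> int) \<kappa>'. near K s (\<lambda>i. of_int (\<kappa> i)) \<longrightarrow> near K s (\<lambda>i. of_int (\<kappa>' i)) \<longrightarrow>
    \<bar>real (card (points (\<lambda>i. of_int (if i \<in> J then \<kappa>' i else \<kappa> i)))) - real (card (points (\<lambda>i. of_int (\<kappa> i)))) -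
      (\<Sum>i\<in>J. (of_int (\<kappa>' i) - of_int (\<kappa> i)) * (\<nu> i * s ^ (CARD('n) - 1)))\<bar> \<le> C * err s"
  using assms(2,3)
proof (induction J rule: finite_induct)
  case empty
  show ?case
    by (intro exI[of _ 0]) simp
next
  case (insert j J)
  then have j: "j \<in> I" by auto
  obtain C where C: "\<forall>\<^sub>F s in at_top. \<forall>(\<kappa> :: 'i \<Rightarrow> int) \<kappa>'. near K s (\<lambda>i. of_int (\<kappa> i)) \<longrightarrow> near K s (\<lambda>i. of_int (\<kappa>' i)) \<longrightarrow>
    \<bar>real (card (points (\<lambda>i. of_int (if i \<in> J then \<kappa>' i else \<kappa> i)))) - real (card (points (\<lambda>i. of_int (\<kappa> i)))) -
      (\<Sum>i\<in>J. (of_int (\<kappa>' i) - of_int (\<kappa> i)) * (\<nu> i * s ^ (CARD('n) - 1)))\<bar> \<le> C * err s"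
    using insert by auto
  obtain C' where C': "\<forall>\<^sub>F s in at_top. \<forall>\<kappa> (m :: int) m'. near K s (\<kappa>(j := of_int m)) \<longrightarrow> near K s (\<kappa>(j := of_int m')) \<longrightarrow>
    \<bar>real (card (points (\<kappa>(j := of_int m')))) - real (card (points (\<kappa>(j := of_int m)))) -
      (of_int m' - of_int m) * (\<nu> j * s ^ (CARD('n) - 1))\<bar> \<le> C' * err s"
    using points_upd[OF j K] by blast
  have "\<forall>\<^sub>F s in at_top. \<forall>(\<kappa> :: 'i \<Rightarrow> int) \<kappa>'. near K s (\<lambda>i. of_int (\<kappa> i)) \<longrightarrow> near K s (\<lambda>i. of_int (\<kappa>' i)) \<longrightarrow>
    \<bar>real (card (points (\<lambda>i. of_int (if i \<in> insert j J then \<kappa>' i else \<kappa> i)))) - real (card (points (\<lambda>i. of_int (\<kappa> i)))) -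
      (\<Sum>i\<in>insert j J. (of_int (\<kappa>' i) - of_int (\<kappa> i)) * (\<nu> i * s ^ (CARD('n) - 1)))\<bar> \<le> (C + C') * err s"
    using C C'
  proof eventually_elim
    case (elim s)
    show ?case
    proof (intro allI impI)
      fix \<kappa> \<kappa>' :: "'i \<Rightarrow> int"
      assume near: "near K s (\<lambda>i. of_int (\<kappa> i))" "near K s (\<lambda>i. of_int (\<kappa>' i))"
      define \<mu> where "\<mu> = (\<lambda>i. real_of_int (if i \<in> J then \<kappa>' i else \<kappa> i))"
      have 1: "\<mu>(j := of_int (\<kappa> j)) = \<mu>" using insert.hyps by (auto simp: \<mu>_def)
      have 2: "\<mu>(j := of_int (\<kappa>' j)) = (\<lambda>i. of_int (if i \<in> insert j J then \<kappa>' i else \<kappa> i))" by (auto simp: \<mu>_def)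
      have "near K s \<mu>" "near K s (\<mu>(j := of_int (\<kappa>' j)))" using near by (auto simp: near_def \<mu>_def)
      then have "\<bar>real (card (points (\<mu>(j := of_int (\<kappa>' j))))) - real (card (points \<mu>)) -
        (of_int (\<kappa>' j) - of_int (\<kappa> j)) * (\<nu> j * s ^ (CARD('n) - 1))\<bar> \<le> C' * err s"
        using elim(2)[rule_format, of \<mu> "\<kappa> j" "\<kappa>' j"] unfolding 1 by blast
      moreover have "\<bar>real (card (points \<mu>)) - real (card (points (\<lambda>i. of_int (\<kappa> i)))) -
        (\<Sum>i\<in>J. (of_int (\<kappa>' i) - of_int (\<kappa> i)) * (\<nu> i * s ^ (CARD('n) - 1)))\<bar> \<le> C * err s"
        using elim(1) near unfolding \<mu>_def by blast
      moreover have "(\<Sum>i\<in>insert j J. (of_int (\<kappa>' i) - of_int (\<kappa> i)) * (\<nu> i * s ^ (CARD('n) - 1))) =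
        (of_int (\<kappa>' j) - of_int (\<kappa> j)) * (\<nu> j * s ^ (CARD('n) - 1)) +
        (\<Sum>i\<in>J. (of_int (\<kappa>' i) - of_int (\<kappa> i)) * (\<nu> i * s ^ (CARD('n) - 1)))"
        using insert.hyps by (rule sum.insert)
      ultimately show "\<bar>real (card (points (\<lambda>i. of_int (if i \<in> insert j J then \<kappa>' i else \<kappa> i)))) - real (card (points (\<lambda>i. of_int (\<kappa> i)))) -
        (\<Sum>i\<in>insert j J. (of_int (\<kappa>' i) - of_int (\<kappa> i)) * (\<nu> i * s ^ (CARD('n) - 1)))\<bar> \<le> (C + C') * err s"
        unfolding 2[symmetric] distrib_right by linarith
    qed
  qed
  then show ?case by blast
qed

text \<open>Lattice points take integer values under \<open>v i\<close>, so real bounds may be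
  rounded down and only integer bounds have to be compared.\<close>

lemma points_floor: "points (\<lambda>i. of_int \<lfloor>\<kappa> i\<rfloor>) = points \<kappa>"
proof -
  have "v i \<bullet> z \<le> of_int \<lfloor>\<kappa> i\<rfloor> \<longleftrightarrow> v i \<bullet> z \<le> \<kappa> i" if z: "z \<in> int_lattice" and i: "i \<in> I" for z i
  proof -
    have "v i \<bullet> z \<in> \<int>" using int_lattice_inner[OF v_int[OF i] z] .
    then obtain l where "v i \<bullet> z = of_int l" by (auto elim: Ints_cases)
    then show ?thesis by (simp add: le_floor_iff)
  qed
  then show ?thesis by (auto simp: points_def)
qed

lemma points_asymptotics:
  "\<exists>C. \<forall>\<^sub>F s in at_top. \<bar>real (card (points (\<lambda>i. s * b i))) - measure lborel (body s) -
     (\<Sum>i\<in>I. (of_int \<lfloor>s * b i\<rfloor> - s * b i + 1 / 2) * (\<nu> i * s ^ (CARD('n) - 1)))\<bar> \<le> C * err s"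
proof -
  \<comment> \<open>The norm terms bound \<open>v i \<bullet> u\<close> on the unit cell, the 1
    bounds the effect of rounding.\<close>
  define K where "K = (\<Sum>i\<in>I. norm (v i) * real CARD('n)) + 1"
  have KI: "norm (v i) * real CARD('n) + 1 \<le> K" if "i \<in> I" for i
    unfolding K_def using member_le_sum[of i I "\<lambda>i. norm (v i) * real CARD('n)"] finite_I that by simp
  have K: "K \<ge> 0" unfolding K_def by (simp add: add_nonneg_nonneg sum_nonneg)
  obtain C where C: "\<forall>\<^sub>F s in at_top. \<forall>(\<kappa> :: 'i \<Rightarrow> int) \<kappa>'. near K s (\<lambda>i. of_int (\<kappa> i)) \<longrightarrow> near K s (\<lambda>i. of_int (\<kappa>' i)) \<longrightarrow>
    \<bar>real (card (points (\<lambda>i. of_int (if i \<in> I then \<kappa>' i else \<kappa> i)))) - real (card (points (\<lambda>i. of_int (\<kappa> i)))) -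
      (\<Sum>i\<in>I. (of_int (\<kappa>' i) - of_int (\<kappa> i)) * (\<nu> i * s ^ (CARD('n) - 1)))\<bar> \<le> C * err s"
    using points_change[OF K finite_I order_refl] by blast
  have "\<forall>\<^sub>F s in at_top. \<bar>real (card (points (\<lambda>i. s * b i))) - measure lborel (body s) -
     (\<Sum>i\<in>I. (of_int \<lfloor>s * b i\<rfloor> - s * b i + 1 / 2) * (\<nu> i * s ^ (CARD('n) - 1)))\<bar> \<le> C * err s"
    using C eventually_gt_at_top[of 0]
  proof eventually_elim
    case (elim s)
    let ?f = "\<lambda>i. \<nu> i * s ^ (CARD('n) - 1)"
    have bb: "bounded (body s)" by (rule bounded_body[OF elim(2)])
    have Xb: "body s \<in> sets borel"
    proof -
      have "{x \<in> space borel. \<forall>i\<in>I. v i \<bullet> x \<le> s * b i} \<in> sets borel"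
        by (intro sets.sets_Collect_finite_All finite_I; measurable)
      then show ?thesis by (simp add: body_def)
    qed
    define g where "g = (\<lambda>u. real (card {z \<in> int_lattice. z + u \<in> body s}))"
    define h where "h = (\<lambda>i u. real_of_int \<lfloor>s * b i - v i \<bullet> u\<rfloor>)"
    have g_int: "integrable cell_measure g" and g_val: "measure lborel (body s) = integral\<^sup>L cell_measure g"
      unfolding g_def by (rule measure_eq_integral_count[OF Xb bb])+
    have h_int: "integrable cell_measure (h i)" and h_val: "integral\<^sup>L cell_measure (h i) = s * b i - 1 / 2" if "i \<in> I" for i
      unfolding h_def by (rule integral_floor_cell[OF v_int[OF that] w_int[OF that] vw[OF that]])+
    interpret finite_measure "cell_measure :: (real ^ 'n) measure" by (rule finite_measure_cell_measure)
    \<comment> \<open>The first-order correction is applied to each translate before averaging: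
      \<open>G u\<close> equals the count for the dilate itself up to an error uniform in
      \<open>u\<close>, while its mean is explicit.\<close>
    define G where "G = (\<lambda>u. g u + (\<Sum>i\<in>I. (of_int \<lfloor>s * b i\<rfloor> - h i u) * ?f i))"
    have sum_int: "integrable cell_measure (\<lambda>u. (of_int \<lfloor>s * b i\<rfloor> - h i u) * ?f i)" if "i \<in> I" for i
      using h_int[OF that] by (intro integrable_mult_left Bochner_Integration.integrable_diff) simp_all
    have sum_val: "integral\<^sup>L cell_measure (\<lambda>u. (of_int \<lfloor>s * b i\<rfloor> - h i u) * ?f i) =
      (of_int \<lfloor>s * b i\<rfloor> - s * b i + 1 / 2) * ?f i" if "i \<in> I" for i
    proof -
      have "integral\<^sup>L cell_measure (\<lambda>u. of_int \<lfloor>s * b i\<rfloor> - h i u) = of_int \<lfloor>s * b i\<rfloor> - s * b i + 1 / 2"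
        using h_int[OF that] h_val[OF that] by (subst Bochner_Integration.integral_diff) (simp_all add: measure_space_cell_measure)
      then show ?thesis by (simp only: integral_mult_left_zero)
    qed
    have G_int: "integrable cell_measure G"
      unfolding G_def using g_int sum_int by (intro Bochner_Integration.integrable_add Bochner_Integration.integrable_sum)
    have G_val: "integral\<^sup>L cell_measure G =
      measure lborel (body s) + (\<Sum>i\<in>I. (of_int \<lfloor>s * b i\<rfloor> - s * b i + 1 / 2) * ?f i)"
    proof -
      have "integral\<^sup>L cell_measure G = integral\<^sup>L cell_measure g +
        integral\<^sup>L cell_measure (\<lambda>u. \<Sum>i\<in>I. (of_int \<lfloor>s * b i\<rfloor> - h i u) * ?f i)"
        unfolding G_def using g_int sum_int
        by (intro Bochner_Integration.integral_add Bochner_Integration.integrable_sum)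
      also have "integral\<^sup>L cell_measure (\<lambda>u. \<Sum>i\<in>I. (of_int \<lfloor>s * b i\<rfloor> - h i u) * ?f i) =
        (\<Sum>i\<in>I. integral\<^sup>L cell_measure (\<lambda>u. (of_int \<lfloor>s * b i\<rfloor> - h i u) * ?f i))"
        using sum_int by (intro Bochner_Integration.integral_sum)
      also have "\<dots> = (\<Sum>i\<in>I. (of_int \<lfloor>s * b i\<rfloor> - s * b i + 1 / 2) * ?f i)"
        using sum_val by (intro sum.cong refl)
      finally show ?thesis by (simp only: g_val)
    qed
    have "\<bar>integral\<^sup>L cell_measure G - real (card (points (\<lambda>i. s * b i)))\<bar> \<le> C * err s"
    proof (rule integral_cell_close[OF G_int])
      fix u :: "real ^ 'n" assume u: "u \<in> unit_cell"
      have "{z \<in> int_lattice. z + u \<in> body s} = points (\<lambda>i. s * b i - v i \<bullet> u)"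
        by (auto simp: body_def points_def inner_add_right algebra_simps)
      then have g_eq: "g u = real (card (points (\<lambda>i. of_int \<lfloor>s * b i - v i \<bullet> u\<rfloor>)))"
        by (simp only: g_def points_floor)
      have n1: "near K s (\<lambda>i. of_int \<lfloor>s * b i - v i \<bullet> u\<rfloor>)"
        unfolding near_def
      proof
        fix i assume i: "i \<in> I"
        have "\<bar>of_int \<lfloor>s * b i - v i \<bullet> u\<rfloor> - s * b i\<bar> \<le> \<bar>v i \<bullet> u\<bar> + 1" by linarith
        then show "\<bar>of_int \<lfloor>s * b i - v i \<bullet> u\<rfloor> - s * b i\<bar> \<le> K" using inner_cell_bound[OF u, of i] KI[OF i] by linarith
      qed
      have n2: "near K s (\<lambda>i. of_int \<lfloor>s * b i\<rfloor>)"
        unfolding near_def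
      proof
        fix i assume i: "i \<in> I"
        have "\<bar>of_int \<lfloor>s * b i\<rfloor> - s * b i\<bar> \<le> 1" by linarith
        moreover have "norm (v i) * real CARD('n) \<ge> 0" by simp
        ultimately show "\<bar>of_int \<lfloor>s * b i\<rfloor> - s * b i\<bar> \<le> K" using KI[OF i] by linarith
      qed
      \<comment> \<open>Off \<open>I\<close> the bounds may differ, but \<open>points\<close> reads
        them only on \<open>I\<close>.\<close>
      have pe: "points (\<lambda>i. of_int (if i \<in> I then \<lfloor>s * b i\<rfloor> else \<lfloor>s * b i - v i \<bullet> u\<rfloor>)) = points (\<lambda>i. s * b i)"
      proof -
        have "points (\<lambda>i. of_int (if i \<in> I then \<lfloor>s * b i\<rfloor> else \<lfloor>s * b i - v i \<bullet> u\<rfloor>)) = points (\<lambda>i. of_int \<lfloor>s * b i\<rfloor>)"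
          by (auto simp: points_def)
        then show ?thesis by (simp only: points_floor)
      qed
      have "\<bar>real (card (points (\<lambda>i. s * b i))) - g u - (\<Sum>i\<in>I. (of_int \<lfloor>s * b i\<rfloor> - h i u) * ?f i)\<bar> \<le> C * err s"
        using elim(1)[rule_format, OF n1 n2] unfolding pe g_eq h_def .
      then show "\<bar>G u - real (card (points (\<lambda>i. s * b i)))\<bar> \<le> C * err s" unfolding G_def by linarith
    qed
    then show ?case unfolding G_val by linarith
  qed
  then show ?thesis by blast
qed

end

section \<open>Facets of rational polytopes\<close>

lemma sum_in_Rats: "(\<And>x. x \<in> A \<Longrightarrow> f x \<in> \<rat>) \<Longrightarrow> sum f A \<in> \<rat>"
  for f :: "'b \<Rightarrow> 'a::field_char_0"
  by (induction A rule: infinite_finite_induct) auto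

lemma rational_inner: "(\<And>i. y $ i \<in> \<rat>) \<Longrightarrow> (\<And>i. z $ i \<in> \<rat>) \<Longrightarrow> y \<bullet> z \<in> \<rat>"
  for y z :: "real ^ 'n"
  unfolding inner_vec_def by (auto intro: sum_in_Rats)

text \<open>Gram-Schmidt without normalisation, which would introduce square roots. Dependent
  vectors of \<open>X\<close> produce the zero vector in \<open>B\<close>, for which the quotient by
  \<open>b \<bullet> b\<close> is 0 by convention.\<close>

lemma rational_orthogonal_basis:
  fixes X :: "(real ^ 'n) set"
  assumes "finite X" "\<And>x i. x \<in> X \<Longrightarrow> x $ i \<in> \<rat>"
  shows "\<exists>B. finite B \<and> pairwise orthogonal B \<and> (\<forall>b\<in>B. \<forall>i. b $ i \<in> \<rat>) \<and> span B = span X"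
  using assms
proof (induction X rule: finite_induct)
  case empty
  show ?case by (intro exI[of _ "{}"]) auto
next
  case (insert x X)
  then obtain B where B: "finite B" "pairwise orthogonal B" "\<And>b i. b \<in> B \<Longrightarrow> b $ i \<in> \<rat>" "span B = span X"
    by (metis insertI2)
  define x' where "x' = x - (\<Sum>b\<in>B. (b \<bullet> x / (b \<bullet> b)) *\<^sub>R b)"
  have rat: "x' $ i \<in> \<rat>" for i
  proof -
    have "x' $ i = x $ i - (\<Sum>b\<in>B. (b \<bullet> x / (b \<bullet> b)) * b $ i)" by (simp add: x'_def)
    moreover have "(\<Sum>b\<in>B. (b \<bullet> x / (b \<bullet> b)) * b $ i) \<in> \<rat>"
      using B(3) insert.prems by (intro sum_in_Rats Rats_mult Rats_divide rational_inner) auto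
    ultimately show ?thesis using insert.prems by simp
  qed
  have orth: "orthogonal x' b" if "b \<in> B" for b
    using Gram_Schmidt_step[OF B(2), of b x] that by (auto simp: x'_def orthogonal_commute span_base)
  have "(\<Sum>b\<in>B. (b \<bullet> x / (b \<bullet> b)) *\<^sub>R b) \<in> span B"
    by (intro span_sum span_scale span_base)
  then have "span (insert x' B) = span (insert x B)"
    unfolding x'_def by (intro eq_span_insert_eq) (simp add: span_neg)
  also have "\<dots> = span (insert x X)" using B(4) by (simp add: span_insert)
  finally have "span (insert x' B) = span (insert x X)" .
  moreover have "pairwise orthogonal (insert x' B)"
    using B(2) orth by (auto simp: pairwise_insert orthogonal_commute)
  ultimately show ?case
    using B(1,3) rat by (intro exI[of _ "insert x' B"]) auto
qed

text \<open>Take an axis vector on which \<open>a\<close> does not vanish and remove its component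
  in the hyperplane, computed with a rational orthogonal spanning set. The rest \<open>r\<close> is
  rational and a multiple of \<open>a\<close>, and it is nonzero because
  \<open>a \<bullet> r = a $ i\<close>.\<close>

lemma rational_normal:
  fixes a :: "real ^ 'n"
  assumes X: "finite X" "\<And>x i. x \<in> X \<Longrightarrow> x $ i \<in> \<rat>" "span X = {x. a \<bullet> x = 0}" and a: "a \<noteq> 0"
  obtains c where "c \<noteq> 0" "\<And>i. (c *\<^sub>R a) $ i \<in> \<rat>"
proof -
  obtain B where B: "finite B" "pairwise orthogonal B" "\<And>b i. b \<in> B \<Longrightarrow> b $ i \<in> \<rat>" "span B = span X"
    using rational_orthogonal_basis[of X] X by metis
  obtain i where i: "a $ i \<noteq> 0" using a by (auto simp: vec_eq_iff)
  define r :: "real ^ 'n" where "r = axis i 1 - (\<Sum>b\<in>B. (b \<bullet> axis i 1 / (b \<bullet> b)) *\<^sub>R b)"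
  have rat: "r $ j \<in> \<rat>" for j
  proof -
    have "r $ j = axis i 1 $ j - (\<Sum>b\<in>B. (b \<bullet> axis i 1 / (b \<bullet> b)) * b $ j)" by (simp add: r_def)
    moreover have "(\<Sum>b\<in>B. (b \<bullet> axis i 1 / (b \<bullet> b)) * b $ j) \<in> \<rat>"
      using B(3) by (intro sum_in_Rats Rats_mult Rats_divide rational_inner) (auto simp: axis_def)
    moreover have "(axis i 1 :: real ^ 'n) $ j \<in> \<rat>" by (simp add: axis_def)
    ultimately show ?thesis by simp
  qed
  have "orthogonal y r" if "y \<in> span B" for y
    unfolding r_def by (rule Gram_Schmidt_step[OF B(2) that])
  then have orth: "y \<bullet> r = 0" if "a \<bullet> y = 0" for y
    using that B(4) X(3) by (auto simp: orthogonal_def)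
  have aB: "a \<bullet> b = 0" if "b \<in> B" for b
    using that span_base[of b B] B(4) X(3) by auto
  have ar: "a \<bullet> r = a $ i"
    using aB by (simp add: r_def inner_diff_right inner_sum_right inner_axis)
  define c where "c = (a \<bullet> r) / (a \<bullet> a)"
  have "a \<bullet> (r - c *\<^sub>R a) = 0" using a by (simp add: c_def inner_diff_right)
  then have "(r - c *\<^sub>R a) \<bullet> r = 0" "(r - c *\<^sub>R a) \<bullet> a = 0"
    using orth[of "r - c *\<^sub>R a"] by (simp_all only: inner_commute)
  then have "(r - c *\<^sub>R a) \<bullet> (r - c *\<^sub>R a) = 0"
    by (simp only: inner_diff_right inner_scaleR_right mult_zero_right diff_zero)
  then have "r = c *\<^sub>R a" by simp
  moreover have "c \<noteq> 0" using ar i a by (simp add: c_def)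
  ultimately show ?thesis using that rat by metis
qed

lemma hyperplane_normal_unique:
  fixes u u' :: "'a::real_inner"
  assumes "norm u = 1" "norm u' = 1" "\<And>y. u \<bullet> y = 0 \<Longrightarrow> u' \<bullet> y = 0"
  shows "u' = u \<or> u' = - u"
proof -
  define c where "c = u \<bullet> u'"
  have uu: "u \<bullet> u = 1" using assms(1) by (simp add: norm_eq_1)
  have o: "u \<bullet> (u' - c *\<^sub>R u) = 0" using uu by (simp add: c_def inner_diff_right)
  then have "u' \<bullet> (u' - c *\<^sub>R u) = 0" by (rule assms(3))
  then have "(u' - c *\<^sub>R u) \<bullet> (u' - c *\<^sub>R u) = 0" using o by (simp add: inner_diff_left)
  then have e: "u' = c *\<^sub>R u" by simp
  then have "\<bar>c\<bar> = 1" using assms(1,2) by simp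
  then have "c = 1 \<or> c = - 1" by linarith
  then show ?thesis using e by auto
qed

section \<open>Normals of a facet\<close>

locale rational_facet =
  fixes P F :: "(real ^ 'n) set"
  assumes rat: "rational_polytope P" and full: "aff_dim P = int CARD('n)" and facet: "F facet_of P"
begin

lemma polytope_P: "polytope P" and polyhedron_P: "polyhedron P"
  using rat polytope_imp_polyhedron by (auto simp: rational_polytope_def)

lemma face_F: "F face_of P"
  using facet by (rule facet_of_imp_face_of)

lemma F_nonempty: "F \<noteq> {}"
  using facet by (simp add: facet_of_def)

lemma polytope_F: "polytope F"
  using face_of_polytope_polytope[OF polytope_P face_F] .

lemma extreme_point_F: "x extreme_point_of F \<Longrightarrow> x extreme_point_of P"
  using extreme_point_of_face[OF face_F] by blast

lemma supporting_hyperplane: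
  obtains a \<beta> where "a \<noteq> 0" "P \<subseteq> {x. a \<bullet> x \<le> \<beta>}" "F = P \<inter> {x. a \<bullet> x = \<beta>}"
proof -
  have "F exposed_face_of P" using face_F polyhedron_P by (simp add: exposed_face_of_polyhedron)
  then obtain a \<beta> where ab: "P \<subseteq> {x. a \<bullet> x \<le> \<beta>}" "F = P \<inter> {x. a \<bullet> x = \<beta>}"
    by (auto simp: exposed_face_of_def)
  have "a \<noteq> 0"
  proof
    assume "a = 0"
    then have "F = P" using ab F_nonempty by auto
    then show False using facet by simp
  qed
  then show ?thesis using that ab by blast
qed

text \<open>Facet and hyperplane both have dimension d - 1, so the hyperplane is the affine hull of
  \<open>F\<close>.\<close>

lemma parallel_space_facet:
  assumes "a \<noteq> 0" "F \<subseteq> {x. a \<bullet> x = \<beta>}"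
  shows "parallel_space F = {x. a \<bullet> x = 0}"
proof -
  have "affine hull F = {x. a \<bullet> x = \<beta>}"
  proof (rule affine_dim_equal)
    show "affine hull F \<subseteq> {x. a \<bullet> x = \<beta>}" using assms by (intro hull_minimal affine_hyperplane)
    show "aff_dim (affine hull F) = aff_dim {x. a \<bullet> x = \<beta>}"
      using facet full assms(1) by (simp add: facet_of_def)
  qed (use F_nonempty in \<open>auto simp: affine_hyperplane\<close>)
  moreover obtain x0 where x0: "x0 \<in> F" using F_nonempty by auto
  ultimately have "parallel_space F = {x - y | x y. a \<bullet> x = \<beta> \<and> a \<bullet> y = \<beta>}"
    by (simp add: parallel_space_def)
  also have "\<dots> = {x. a \<bullet> x = 0}"
  proof (intro equalityI subsetI)
    fix x assume "x \<in> {x. a \<bullet> x = 0}"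
    then show "x \<in> {x - y | x y. a \<bullet> x = \<beta> \<and> a \<bullet> y = \<beta>}"
      using x0 assms(2) by (intro CollectI exI[of _ "x + x0"] exI[of _ x0]) (auto simp: inner_add_right)
  qed (auto simp: inner_diff_right)
  finally show ?thesis .
qed

text \<open>The direction space of \<open>F\<close> is spanned by differences of vertices of
  \<open>F\<close>, which are vertices of \<open>P\<close> and hence rational.\<close>

lemma rational_facet_normal:
  assumes "a \<noteq> 0" "F \<subseteq> {x. a \<bullet> x = \<beta>}"
  obtains c where "c \<noteq> 0" "\<And>i. (c *\<^sub>R a) $ i \<in> \<rat>"
proof -
  define E where "E = {x. x extreme_point_of F}"
  have F_hull: "F = convex hull E"
    unfolding E_def using polytope_F by (intro Krein_Milman_Minkowski polytope_imp_compact polytope_imp_convex)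
  have finE: "finite E"
    unfolding E_def using polytope_imp_polyhedron[OF polytope_F] by (rule finite_polyhedron_extreme_points)
  have "E \<noteq> {}" using F_hull F_nonempty by auto
  then obtain e where e: "e \<in> E" by blast
  have ratE: "x $ i \<in> \<rat>" if "x \<in> E" for x i
    using that extreme_point_F rat by (auto simp: E_def rational_polytope_def)
  have eF: "e \<in> F" using e by (simp add: E_def extreme_point_of_def)
  have "{x - e | x. x \<in> affine hull F} = parallel_space F"
  proof (intro equalityI subsetI)
    fix y assume "y \<in> {x - e | x. x \<in> affine hull F}"
    then show "y \<in> parallel_space F" using hull_inc[OF eF] by (auto simp: parallel_space_def)
  next
    fix y assume y: "y \<in> parallel_space F"
    then obtain p q where pq: "y = p - q" "p \<in> affine hull F" "q \<in> affine hull F" by (auto simp: parallel_space_def)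
    have "1 *\<^sub>R p + (- 1) *\<^sub>R q + 1 *\<^sub>R e \<in> affine hull F"
      using mem_affine_3[OF affine_affine_hull pq(2,3) hull_inc[OF eF], of 1 "- 1" 1] by simp
    then show "y \<in> {x - e | x. x \<in> affine hull F}"
      using pq(1) by (intro CollectI exI[of _ "p - q + e"]) simp
  qed
  moreover have "affine hull F = affine hull E" by (subst F_hull) (rule affine_hull_convex_hull)
  ultimately have "span {x - e | x. x \<in> E} = {x. a \<bullet> x = 0}"
    using diffs_affine_hull_span[OF e] parallel_space_facet[OF assms] by (simp add: Setcompr_eq_image)
  moreover have "finite {x - e | x. x \<in> E}" using finE by simp
  moreover have "x $ i \<in> \<rat>" if "x \<in> {x - e | x. x \<in> E}" for x i
    using that ratE e by auto
  ultimately show ?thesis using rational_normal[of "{x - e | x. x \<in> E}" a] assms(1) that by blast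
qed

lemma not_subset_hyperplane: "u \<noteq> 0 \<Longrightarrow> \<not> P \<subseteq> {x. u \<bullet> x = \<beta>}"
proof
  assume u: "u \<noteq> 0" and "P \<subseteq> {x. u \<bullet> x = \<beta>}"
  then have "aff_dim P \<le> aff_dim {x. u \<bullet> x = \<beta>}" by (intro aff_dim_subset)
  then show False using u full by simp
qed

text \<open>A competing unit normal is \<open>u\<close> or \<open>- u\<close>, since both are
  orthogonal to the direction space of \<open>F\<close>. For \<open>- u\<close> the two inequalities
  would confine the full-dimensional \<open>P\<close> to a hyperplane.\<close>

lemma outward_unit_normal_eq:
  assumes "norm u = 1" "P \<subseteq> {x. u \<bullet> x \<le> \<beta>}" "F \<subseteq> {x. u \<bullet> x = \<beta>}"
  shows "outward_unit_normal P F = u"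
  unfolding outward_unit_normal_def
proof (rule the_equality)
  show "norm u = 1 \<and> (\<exists>b. P \<subseteq> {x. u \<bullet> x \<le> b} \<and> F \<subseteq> {x. u \<bullet> x = b})" using assms by blast
  fix u' assume "norm u' = 1 \<and> (\<exists>b. P \<subseteq> {x. u' \<bullet> x \<le> b} \<and> F \<subseteq> {x. u' \<bullet> x = b})"
  then obtain b where u': "norm u' = 1" "P \<subseteq> {x. u' \<bullet> x \<le> b}" "F \<subseteq> {x. u' \<bullet> x = b}" by blast
  have "{x. u \<bullet> x = 0} = {x. u' \<bullet> x = 0}"
    using parallel_space_facet[OF _ assms(3)] parallel_space_facet[OF _ u'(3)] assms(1) u'(1) by force
  then have "u' = u \<or> u' = - u"
    using assms(1) u'(1) by (intro hyperplane_normal_unique) auto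
  moreover have "u' \<noteq> - u"
  proof
    assume e: "u' = - u"
    obtain x0 where x0: "x0 \<in> F" using F_nonempty by auto
    then have "b = - \<beta>" using u'(3) assms(3) e by auto
    then have "P \<subseteq> {x. u \<bullet> x = \<beta>}" using assms(2) u'(2) e by (auto intro: antisym)
    moreover have "u \<noteq> 0" using assms(1) by (metis norm_zero zero_neq_one)
    ultimately show False using not_subset_hyperplane by blast
  qed
  ultimately show "u' = u" by simp
qed

lemma primitive_normal:
  defines "v \<equiv> primitive_normal P F"
  shows "primitive_vector v"
    and "\<And>x y. x \<in> F \<Longrightarrow> y \<in> P \<Longrightarrow> v \<bullet> y \<le> v \<bullet> x"
    and "\<And>x. x \<in> F \<Longrightarrow> F = P \<inter> {y. v \<bullet> y = v \<bullet> x}"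
    and "parallel_space F = {x. v \<bullet> x = 0}"
proof -
  obtain a \<beta> where a: "a \<noteq> 0" "P \<subseteq> {x. a \<bullet> x \<le> \<beta>}" "F = P \<inter> {x. a \<bullet> x = \<beta>}" by (rule supporting_hyperplane)
  define u where "u = (1 / norm a) *\<^sub>R a"
  have na: "norm a > 0" using a by simp
  have u: "outward_unit_normal P F = u"
    using na a(2,3) by (intro outward_unit_normal_eq[of u "\<beta> / norm a"]) (auto simp: u_def divide_right_mono)
  have Fa: "F \<subseteq> {x. a \<bullet> x = \<beta>}" using a(3) by auto
  obtain c where c: "c \<noteq> 0" "\<And>i. (c *\<^sub>R a) $ i \<in> \<rat>" using rational_facet_normal[OF a(1) Fa] by blast
  \<comment> \<open>The absolute value keeps the rational multiple of \<open>a\<close> pointing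
    outward.\<close>
  have "(\<bar>c\<bar> *\<^sub>R a) $ i \<in> \<rat>" for i
    using c(2)[of i] Rats_minus_iff[of "c * a $ i"] by (cases "c \<ge> 0") auto
  moreover have "\<bar>c\<bar> *\<^sub>R a \<noteq> 0" using a c by simp
  ultimately obtain k where k: "k > 0" "primitive_vector (k *\<^sub>R (\<bar>c\<bar> *\<^sub>R a))" using primitive_multiple_exists by blast
  define q where "q = k * \<bar>c\<bar>"
  have q: "q > 0" "primitive_vector (q *\<^sub>R a)" using k c by (auto simp: q_def)
  have v: "v = q *\<^sub>R a"
    unfolding v_def primitive_normal_def
  proof (rule the_equality)
    have "q *\<^sub>R a = (q * norm a) *\<^sub>R u" using na by (simp add: u_def)
    moreover have "q * norm a > 0" using q na by simp
    ultimately show "primitive_vector (q *\<^sub>R a) \<and> (\<exists>c>0. q *\<^sub>R a = c *\<^sub>R outward_unit_normal P F)" unfolding u using q by blast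
    fix v' assume "primitive_vector v' \<and> (\<exists>c>0. v' = c *\<^sub>R outward_unit_normal P F)"
    then obtain d where d: "primitive_vector v'" "d > 0" "v' = d *\<^sub>R u" unfolding u by blast
    define f where "f = d / norm a / q"
    have f: "f > 0" "v' = f *\<^sub>R (q *\<^sub>R a)" using d q na by (auto simp: f_def u_def)
    then have "f = 1 \<or> f = - 1" using primitive_vector_parallel[OF q(2) d(1)] by blast
    then show "v' = q *\<^sub>R a" using f by auto
  qed
  show "primitive_vector v" using q v by simp
  have ax: "a \<bullet> x = \<beta>" if "x \<in> F" for x using that a(3) by auto
  show "v \<bullet> y \<le> v \<bullet> x" if "x \<in> F" "y \<in> P" for x y
    using that a(2) q(1) by (auto simp: v ax)
  show "F = P \<inter> {y. v \<bullet> y = v \<bullet> x}" if "x \<in> F" for x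
    using q(1) a(3) by (auto simp: v ax[OF that])
  show "parallel_space F = {x. v \<bullet> x = 0}"
    using parallel_space_facet[OF a(1) Fa] q(1) by (simp add: v)
qed

end

text \<open>If a point \<open>y\<close> outside \<open>P\<close> satisfied all inequalities, the
  segment from an interior point \<open>p\<close> to \<open>y\<close> would meet the boundary of
  \<open>P\<close> in a point \<open>q\<close> of some facet. There the facet inequality is an
  equality, although it is strict at \<open>p\<close>, holds at \<open>y\<close>, and
  \<open>q\<close> gives \<open>p\<close> positive weight.\<close>

lemma polytope_eq_facet_halfspaces:
  fixes P :: "(real ^ 'n) set"
  assumes rat: "rational_polytope P" and full: "aff_dim P = int CARD('n)" and x: "\<And>F. F facet_of P \<Longrightarrow> x F \<in> F"
  obtains p where "\<And>F. F facet_of P \<Longrightarrow> primitive_normal P F \<bullet> p < primitive_normal P F \<bullet> x F"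
    and "P = {y. \<forall>F. F facet_of P \<longrightarrow> primitive_normal P F \<bullet> y \<le> primitive_normal P F \<bullet> x F}"
proof -
  let ?v = "primitive_normal P"
  have polyh: "polyhedron P" using rat polytope_imp_polyhedron by (auto simp: rational_polytope_def)
  have conv: "convex P" and cl: "closed P" using polyh polyhedron_imp_convex polyhedron_imp_closed by auto
  have hull: "affine hull P = UNIV" using full aff_dim_eq_full[of P] by simp
  have ri: "rel_interior P = interior P" using hull by (rule rel_interior_interior)
  have "P \<noteq> {}" using full by auto
  then have "interior P \<noteq> {}" using rel_interior_eq_empty[OF conv] ri by simp
  then obtain p where p: "p \<in> interior P" by blast
  have rf: "rational_facet P F" if "F facet_of P" for F
    using that rat full by unfold_locales
  have strict: "?v F \<bullet> p < ?v F \<bullet> x F" if F: "F facet_of P" for F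
  proof -
    interpret rational_facet P F using rf[OF F] .
    obtain w where "?v F \<bullet> w = 1" using primitive_vector_bezout[OF primitive_normal(1)] by metis
    then have v0: "?v F \<noteq> 0" by auto
    have "P \<subseteq> {y. ?v F \<bullet> y \<le> ?v F \<bullet> x F}" using primitive_normal(2)[OF x[OF F]] by blast
    then have "interior P \<subseteq> interior {y. ?v F \<bullet> y \<le> ?v F \<bullet> x F}" by (rule interior_mono)
    then show ?thesis using p v0 by auto
  qed
  have "P = {y. \<forall>F. F facet_of P \<longrightarrow> ?v F \<bullet> y \<le> ?v F \<bullet> x F}" (is "_ = ?Q")
  proof (intro equalityI subsetI)
    fix y assume "y \<in> P"
    then show "y \<in> ?Q" using rational_facet.primitive_normal(2)[OF rf x] by blast
  next
    fix y assume y: "y \<in> ?Q"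
    show "y \<in> P"
    proof (rule ccontr)
      assume "y \<notin> P"
      have "closed_segment p y \<inter> frontier P \<noteq> {}"
        using p interior_subset \<open>y \<notin> P\<close> by (intro connected_Int_frontier) auto
      then obtain q where q: "q \<in> closed_segment p y" "q \<in> frontier P" by blast
      then have "q \<in> P - rel_interior P" using cl by (simp add: frontier_def ri)
      then obtain F where F: "F facet_of P" "q \<in> F" using rel_boundary_of_polyhedron[OF polyh] by auto
      have "q \<noteq> y" using \<open>y \<notin> P\<close> F(2) facet_of_imp_subset[OF F(1)] by auto
      obtain \<theta> where \<theta>: "0 \<le> \<theta>" "\<theta> \<le> 1" "q = (1 - \<theta>) *\<^sub>R p + \<theta> *\<^sub>R y" using q(1) by (auto simp: in_segment)
      have "\<theta> < 1" using \<open>q \<noteq> y\<close> \<theta> by (cases "\<theta> = 1") auto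
      have "?v F \<bullet> q = ?v F \<bullet> x F" using rational_facet.primitive_normal(3)[OF rf[OF F(1)] x[OF F(1)]] F(2) by blast
      moreover have "(1 - \<theta>) * (?v F \<bullet> p) < (1 - \<theta>) * (?v F \<bullet> x F)"
        using strict[OF F(1)] \<open>\<theta> < 1\<close> by simp
      moreover have "\<theta> * (?v F \<bullet> y) \<le> \<theta> * (?v F \<bullet> x F)" using y F(1) \<theta>(1) by (intro mult_left_mono) auto
      ultimately show False unfolding \<theta>(3) by (simp add: inner_add_right algebra_simps)
    qed
  qed
  then show ?thesis using that strict by blast
qed

section \<open>The denominator of a rational polytope\<close>

lemma extreme_point_of_dilate:
  fixes S :: "'a::euclidean_space set"
  assumes "c > 0"
  shows "(c *\<^sub>R x) extreme_point_of ((\<lambda>y. c *\<^sub>R y) ` S) \<longleftrightarrow> x extreme_point_of S"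
proof -
  have inj: "inj (\<lambda>y :: 'a. c *\<^sub>R y)" using assms by (simp add: inj_on_def)
  have "linear (\<lambda>y :: 'a. c *\<^sub>R y)" by simp
  from open_segment_linear_image[OF this inj]
  show ?thesis using inj by (auto simp: extreme_point_of_def inj_image_mem_iff)
qed

text \<open>The minimum exists because the finitely many vertex coordinates have a common
  denominator; dilation carries vertices to vertices.\<close>

lemma polytope_denom:
  fixes P :: "(real ^ 'n) set"
  assumes rat: "rational_polytope P"
  shows "polytope_denom P > 0" and "x extreme_point_of P \<Longrightarrow> real (polytope_denom P) *\<^sub>R x \<in> int_lattice"
proof -
  define Q where "Q = (\<lambda>m::nat. m > 0 \<and> (\<forall>x. x extreme_point_of ((\<lambda>y. real m *\<^sub>R y) ` P) \<longrightarrow> x \<in> int_lattice))"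
  have "finite {x. x extreme_point_of P}"
    using rat polytope_imp_polyhedron by (intro finite_polyhedron_extreme_points) (auto simp: rational_polytope_def)
  then have "finite ((\<lambda>(x, i). x $ i) ` ({x. x extreme_point_of P} \<times> (UNIV :: 'n set)))" by simp
  then obtain N :: nat where N: "N > 0" "\<And>r. r \<in> (\<lambda>(x, i). x $ i) ` ({x. x extreme_point_of P} \<times> (UNIV :: 'n set)) \<Longrightarrow> real N * r \<in> \<int>"
    by (rule clear_denominators) (use rat in \<open>auto simp: rational_polytope_def\<close>)
  have "Q N"
    unfolding Q_def
  proof (intro conjI N(1) allI impI)
    fix y assume y: "y extreme_point_of ((\<lambda>y. real N *\<^sub>R y) ` P)"
    then obtain x where x: "y = real N *\<^sub>R x" by (auto simp: extreme_point_of_def)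
    then have "x extreme_point_of P" using y N(1) extreme_point_of_dilate[of "real N" x P] by simp
    then show "y \<in> int_lattice" using N(2) unfolding int_lattice_def x by force
  qed
  then have "Q (polytope_denom P)" unfolding polytope_denom_def Q_def[symmetric] by (rule LeastI)
  then show "polytope_denom P > 0" "x extreme_point_of P \<Longrightarrow> real (polytope_denom P) *\<^sub>R x \<in> int_lattice"
    using extreme_point_of_dilate[of "real (polytope_denom P)" x P] by (auto simp: Q_def)
qed

section \<open>The second coefficient\<close>

lemma tendsto_power_quotient:
  assumes "k < N"
  shows "((\<lambda>s::real. s ^ k / s ^ N) \<longlongrightarrow> 0) at_top"
proof -
  have "((\<lambda>s::real. (inverse s) ^ (N - k)) \<longlongrightarrow> 0 ^ (N - k)) at_top"
    by (intro tendsto_power tendsto_inverse_0_at_top filterlim_ident)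
  then have "((\<lambda>s::real. (inverse s) ^ (N - k)) \<longlongrightarrow> 0) at_top" using assms by (simp add: zero_power)
  moreover have "\<forall>\<^sub>F s::real in at_top. (inverse s) ^ (N - k) = s ^ k / s ^ N"
    using eventually_gt_at_top[of 0]
  proof eventually_elim
    case (elim s)
    then show ?case using assms by (simp add: power_diff field_simps)
  qed
  ultimately show ?thesis by (rule Lim_transform_eventually)
qed

text \<open>
  Along an arithmetic progression both sides are polynomials in \<open>s\<close>, so an error of order
  \<open>s ^ (N - 2)\<close> forces the two leading coefficients to agree.
\<close>

lemma second_coefficient_unique:
  fixes d :: "nat \<Rightarrow> real" and s :: "nat \<Rightarrow> real"
  assumes N: "N > 0" and s: "filterlim s at_top sequentially"
    and close: "\<forall>\<^sub>F j in sequentially. \<bar>(\<Sum>k\<le>N. d k * s j ^ k) - V * s j ^ N - R * s j ^ (N - 1)\<bar> \<le> C * (s j ^ N / (s j)\<^sup>2)"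
  shows "d (N - 1) = R"
proof -
  obtain M where M: "N = Suc M" using N by (cases N) auto
  have q: "((\<lambda>j. s j ^ k / s j ^ n) \<longlongrightarrow> 0) sequentially" if "k < n" for k n
    using filterlim_compose[OF tendsto_power_quotient[OF that] s] .
  have pos: "\<forall>\<^sub>F j in sequentially. s j > 0" using s by (simp add: filterlim_at_top_dense)
  define f where "f = (\<lambda>j. (\<Sum>k\<le>N. d k * s j ^ k) - V * s j ^ N - R * s j ^ (N - 1))"
  define low where "low = (\<lambda>j. \<Sum>k<M. d k * s j ^ k)"
  have f_eq: "f j = low j + (d M - R) * s j ^ M + (d N - V) * s j ^ N" for j
    by (simp add: f_def low_def M lessThan_Suc_atMost[symmetric] algebra_simps)
  have low: "((\<lambda>j. low j / s j ^ n) \<longlongrightarrow> 0) sequentially" if "M \<le> n" for n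
  proof -
    have "((\<lambda>j. \<Sum>k<M. d k * (s j ^ k / s j ^ n)) \<longlongrightarrow> (\<Sum>k<M. d k * 0)) sequentially"
      using that by (intro tendsto_intros q) auto
    then show ?thesis by (simp add: low_def sum_divide_distrib)
  qed
  have fM: "((\<lambda>j. f j / s j ^ M) \<longlongrightarrow> 0) sequentially"
  proof (rule tendsto_rabs_zero_cancel, rule tendsto_sandwich)
    show "\<forall>\<^sub>F j in sequentially. 0 \<le> \<bar>f j / s j ^ M\<bar>" by simp
    show "\<forall>\<^sub>F j in sequentially. \<bar>f j / s j ^ M\<bar> \<le> C * (s j ^ 0 / s j ^ 1)"
      using close pos
    proof eventually_elim
      case (elim j)
      then have "\<bar>f j\<bar> \<le> C * (s j ^ N / (s j)\<^sup>2)" by (simp add: f_def)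
      then have "\<bar>f j\<bar> / s j ^ M \<le> C * (s j ^ N / (s j)\<^sup>2) / s j ^ M"
        using elim by (intro divide_right_mono) auto
      also have "\<dots> = C * (s j ^ 0 / s j ^ 1)" using elim by (simp add: M field_simps power2_eq_square)
      finally show ?case using elim by (simp add: abs_divide)
    qed
    show "((\<lambda>j. C * (s j ^ 0 / s j ^ 1)) \<longlongrightarrow> 0) sequentially"
      using tendsto_mult_right_zero[OF q[of 0 1]] by simp
  qed simp
  have fN: "((\<lambda>j. f j / s j ^ N) \<longlongrightarrow> 0) sequentially"
  proof -
    have "((\<lambda>j. (f j / s j ^ M) * (s j ^ 0 / s j ^ 1)) \<longlongrightarrow> 0 * 0) sequentially"
      using fM q[of 0 1] by (intro tendsto_mult) auto
    moreover have "(\<lambda>j. (f j / s j ^ M) * (s j ^ 0 / s j ^ 1)) = (\<lambda>j. f j / s j ^ N)" by (simp add: M fun_eq_iff)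
    ultimately show ?thesis by (simp only: mult_zero_left)
  qed
  \<comment> \<open>The leading coefficients have to be matched first: only when
    \<open>d N = V\<close> does division by \<open>s j ^ M\<close> isolate
    \<open>d M - R\<close>.\<close>
  have lim1: "((\<lambda>j. f j / s j ^ N - low j / s j ^ N - (d M - R) * (s j ^ M / s j ^ N)) \<longlongrightarrow> 0 - 0 - (d M - R) * 0) sequentially"
    using fN low[of N] q[of M N] M by (intro tendsto_intros) auto
  have ev1: "\<forall>\<^sub>F j in sequentially. f j / s j ^ N - low j / s j ^ N - (d M - R) * (s j ^ M / s j ^ N) = d N - V"
    using pos
  proof eventually_elim
    case (elim j)
    have "f j - low j - (d M - R) * s j ^ M = (d N - V) * s j ^ N" by (simp add: f_eq)
    moreover have "f j / s j ^ N - low j / s j ^ N - (d M - R) * (s j ^ M / s j ^ N) = (f j - low j - (d M - R) * s j ^ M) / s j ^ N"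
      by (simp add: diff_divide_distrib)
    ultimately show ?case using elim by simp
  qed
  from Lim_transform_eventually[OF lim1 ev1] have dN: "d N = V" by (simp add: tendsto_const_iff)
  have lim2: "((\<lambda>j. f j / s j ^ M - low j / s j ^ M) \<longlongrightarrow> 0 - 0) sequentially"
    using fM low[of M] by (intro tendsto_intros) auto
  have ev2: "\<forall>\<^sub>F j in sequentially. f j / s j ^ M - low j / s j ^ M = d M - R"
    using pos
  proof eventually_elim
    case (elim j)
    have "f j / s j ^ M - low j / s j ^ M = (f j - low j) / s j ^ M" by (simp add: diff_divide_distrib)
    also have "f j - low j = (d M - R) * s j ^ M" by (simp add: f_eq dN)
    finally show ?case using elim by simp
  qed
  from Lim_transform_eventually[OF lim2 ev2] have "d M = R" by (simp add: tendsto_const_iff)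
  then show ?thesis by (simp add: M)
qed

text \<open>At integers the right-hand limit is -1/2, so one floor formula holds for every
  \<open>x\<close>. This is why the rounding term is expressed by \<open>B1_bar_plus\<close> and not
  by \<open>B1_bar\<close>.\<close>

lemma B1_bar_plus_floor: "B1_bar_plus x = x - of_int \<lfloor>x\<rfloor> - 1 / 2"
  by (auto simp: B1_bar_plus_eq B1_bar_def elim: Ints_cases)

lemma B1_bar_plus_add_int:
  assumes "k \<in> \<int>"
  shows "B1_bar_plus (x + k) = B1_bar_plus x"
  using assms by (auto simp: B1_bar_plus_floor elim!: Ints_cases)

lemma facet_lattice_halfspaces:
  fixes P :: "(real ^ 'n) set"
  assumes rat: "rational_polytope P" and full: "aff_dim P = int CARD('n)" and x: "\<And>F. F facet_of P \<Longrightarrow> x F \<in> F"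
  obtains w p where
    "lattice_halfspaces {F. F facet_of P} (primitive_normal P) w (\<lambda>F. primitive_normal P F \<bullet> x F) relative_volume p"
proof -
  let ?v = "primitive_normal P"
  let ?I = "{F. F facet_of P}"
  have rf: "rational_facet P F" if "F facet_of P" for F
    using that rat full by unfold_locales
  have polyh: "polyhedron P" using rat polytope_imp_polyhedron by (auto simp: rational_polytope_def)
  have bP: "bounded P" using rat polytope_imp_bounded by (auto simp: rational_polytope_def)
  obtain p where p: "\<And>F. F facet_of P \<Longrightarrow> ?v F \<bullet> p < ?v F \<bullet> x F"
    and P: "P = {y. \<forall>F. F facet_of P \<longrightarrow> ?v F \<bullet> y \<le> ?v F \<bullet> x F}"
    using polytope_eq_facet_halfspaces[OF assms] by blast
  have "\<forall>F. \<exists>w. F facet_of P \<longrightarrow> w \<in> int_lattice \<and> ?v F \<bullet> w = 1"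
    using primitive_vector_bezout[OF rational_facet.primitive_normal(1)[OF rf]] by metis
  from choice[OF this] obtain w where w: "\<And>F. F facet_of P \<Longrightarrow> w F \<in> int_lattice" "\<And>F. F facet_of P \<Longrightarrow> ?v F \<bullet> w F = 1" by blast
  have vZ: "?v F \<in> int_lattice" if "F facet_of P" for F
    using rational_facet.primitive_normal(1)[OF rf[OF that]] by (rule primitive_vector_in_int_lattice)
  have "lattice_halfspaces ?I ?v w (\<lambda>F. ?v F \<bullet> x F) relative_volume p"
  proof unfold_locales
    show "finite ?I" using polyh by (rule finite_polyhedron_facets)
    \<comment> \<open>Each chosen facet point lies in \<open>P\<close>, so equal normals force equal
      support values and hence equal facets.\<close>
    show "inj_on ?v ?I"
    proof (rule inj_onI)
      fix F G assume F: "F \<in> ?I" and G: "G \<in> ?I" and eq: "?v F = ?v G"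
      have FP: "x F \<in> P" "x G \<in> P" using F G x facet_of_imp_subset by blast+
      have "?v F \<bullet> x G \<le> ?v F \<bullet> x F" "?v G \<bullet> x F \<le> ?v G \<bullet> x G"
        using rational_facet.primitive_normal(2)[OF rf] F G x FP by blast+
      then have "?v F \<bullet> x F = ?v G \<bullet> x G" using eq by simp
      moreover have "F = P \<inter> {y. ?v F \<bullet> y = ?v F \<bullet> x F}" "G = P \<inter> {y. ?v G \<bullet> y = ?v G \<bullet> x G}"
        using rational_facet.primitive_normal(3)[OF rf x] F G by blast+
      ultimately show "F = G" using eq by simp
    qed
    show "bounded {y. \<forall>F\<in>?I. ?v F \<bullet> y \<le> ?v F \<bullet> x F}"
      using bP by (subst (asm) P) simp
    fix F and s :: real assume F: "F \<in> ?I" and s: "s > 0"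
    then have facet: "F facet_of P" by simp
    interpret rational_facet P F using rf[OF facet] .
    \<comment> \<open>Rescaling identifies the facet of the dilate, described by the inequalities,
      with \<open>F\<close>; the cylinder volume is then the one computed from the relative
      volume.\<close>
    have iff: "(1 / s) *\<^sub>R y \<in> F \<longleftrightarrow> (\<forall>G\<in>?I. ?v G \<bullet> y \<le> s * (?v G \<bullet> x G)) \<and> ?v F \<bullet> y = s * (?v F \<bullet> x F)" for y
    proof -
      have "(1 / s) *\<^sub>R y \<in> F \<longleftrightarrow> (1 / s) *\<^sub>R y \<in> P \<and> ?v F \<bullet> ((1 / s) *\<^sub>R y) = ?v F \<bullet> x F"
        using primitive_normal(3)[OF x[OF facet]] by blast
      also have "(1 / s) *\<^sub>R y \<in> P \<longleftrightarrow> (\<forall>G\<in>?I. ?v G \<bullet> ((1 / s) *\<^sub>R y) \<le> ?v G \<bullet> x G)"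
        by (subst P) simp
      finally show ?thesis using s by (simp add: field_simps)
    qed
    have eq: "{y + r *\<^sub>R w F | y r. (\<forall>G\<in>?I. ?v G \<bullet> y \<le> s * (?v G \<bullet> x G)) \<and> ?v F \<bullet> y = s * (?v F \<bullet> x F) \<and> 0 \<le> r \<and> r < 1} =
      {y + r *\<^sub>R w F | y r. (1 / s) *\<^sub>R y \<in> F \<and> 0 \<le> r \<and> r < 1}" by (simp only: iff conj_assoc)
    have "closed F" using polytope_imp_closed[OF polytope_F] .
    then show "measure lborel {y + r *\<^sub>R w F | y r. (\<forall>G\<in>?I. ?v G \<bullet> y \<le> s * (?v G \<bullet> x G)) \<and> ?v F \<bullet> y = s * (?v F \<bullet> x F) \<and> 0 \<le> r \<and> r < 1} =
      relative_volume F * s ^ (CARD('n) - 1)"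
      unfolding eq using F_nonempty primitive_normal(3)[OF x[OF facet]]
      by (intro relative_volume_cylinder[OF vZ[OF facet] w(1)[OF facet] w(2)[OF facet] _ _ _ primitive_normal(4) s]) auto
  qed (use p w vZ in auto)
  then show ?thesis using that by blast
qed

text \<open>The primitive normal is constant on \<open>F\<close>, so the value may be taken at a
  vertex of \<open>P\<close> in \<open>F\<close>, and the denominator makes that vertex a lattice
  point.\<close>

lemma denom_times_support_int:
  fixes P :: "(real ^ 'n) set"
  assumes "rational_facet P F" "x \<in> F"
  shows "real (polytope_denom P) * (primitive_normal P F \<bullet> x) \<in> \<int>"
proof -
  interpret rational_facet P F by fact
  have "F = convex hull {e. e extreme_point_of F}"
    using polytope_F by (intro Krein_Milman_Minkowski polytope_imp_compact polytope_imp_convex)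
  then have "{e. e extreme_point_of F} \<noteq> {}" using F_nonempty by force
  then obtain e where e: "e extreme_point_of F" by blast
  then have "e \<in> F" by (simp add: extreme_point_of_def)
  then have "primitive_normal P F \<bullet> e = primitive_normal P F \<bullet> x"
    using primitive_normal(3)[OF assms(2)] by blast
  moreover have "primitive_normal P F \<bullet> (real (polytope_denom P) *\<^sub>R e) \<in> \<int>"
    using polytope_denom(2)[OF rat extreme_point_F[OF e]] primitive_vector_in_int_lattice[OF primitive_normal(1)]
    by (rule int_lattice_inner[rotated])
  ultimately show ?thesis by simp
qed

theorem theorem6p3:
  fixes P :: "(real ^ 'n) set"
    and e :: "nat \<Rightarrow> real \<Rightarrow> real"
    and x :: "(real ^ 'n) set \<Rightarrow> real ^ 'n"
    and t :: real
  assumes "rational_polytope P"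
    and "aff_dim P = int CARD('n)"
    and "quasi_coefficients P e"
    and "\<And>F. F facet_of P \<Longrightarrow> x F \<in> F"
    and "t > 0"
  shows "e (CARD('n) - 1) t =
    - (\<Sum>F | F facet_of P.
         relative_volume F * B1_bar_plus ((primitive_normal P F \<bullet> x F) * t))"
proof -
  let ?v = "primitive_normal P"
  let ?I = "{F. F facet_of P}"
  let ?N = "CARD('n)"
  let ?b = "\<lambda>F. ?v F \<bullet> x F"
  define m where "m = real (polytope_denom P)"
  have m: "m > 0" using polytope_denom(1)[OF assms(1)] by (simp add: m_def)
  obtain w p where "lattice_halfspaces ?I ?v w ?b relative_volume p"
    using facet_lattice_halfspaces[OF assms(1,2,4)] by blast
  then interpret H: lattice_halfspaces ?I ?v w ?b relative_volume p .
  obtain q where P: "P = {y. \<forall>F. F facet_of P \<longrightarrow> ?v F \<bullet> y \<le> ?b F}"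
    using polytope_eq_facet_halfspaces[OF assms(1,2,4)] by blast
  have dilate: "(\<lambda>y. s *\<^sub>R y) ` P = H.body s" if s: "s > 0" for s
  proof -
    have "y \<in> (\<lambda>y. s *\<^sub>R y) ` P \<longleftrightarrow> (1 / s) *\<^sub>R y \<in> P" for y
    proof
      assume "(1 / s) *\<^sub>R y \<in> P"
      then have "s *\<^sub>R ((1 / s) *\<^sub>R y) \<in> (\<lambda>y. s *\<^sub>R y) ` P" by (rule imageI)
      then show "y \<in> (\<lambda>y. s *\<^sub>R y) ` P" using s by simp
    qed (use s in auto)
    moreover have "(1 / s) *\<^sub>R y \<in> P \<longleftrightarrow> y \<in> H.body s" for y
      by (subst P) (use s in \<open>simp add: H.body_def field_simps\<close>)
    ultimately show ?thesis by blast
  qed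
  have L: "ehrhart P s = card (H.points (\<lambda>F. s * ?b F))" if "s > 0" for s
  proof -
    have "H.body s \<inter> int_lattice = H.points (\<lambda>F. s * ?b F)" by (auto simp: H.body_def H.points_def)
    then show ?thesis unfolding ehrhart_def dilate[OF that] by simp
  qed
  define V where "V = measure lborel (H.body 1)"
  \<comment> \<open>Homogeneity makes the volume a pure multiple of s^d, so it contributes to the
    leading coefficient alone.\<close>
  have vol: "measure lborel (H.body s) = V * s ^ ?N" if s: "s > 0" for s
  proof -
    have "closed P" using assms(1) polytope_imp_closed by (auto simp: rational_polytope_def)
    then have "H.body 1 \<in> sets borel" using dilate[of 1] by simp
    from measure_lborel_dilate[OF this s] have "measure lborel {y. (1 / s) *\<^sub>R y \<in> H.body 1} = s ^ ?N * V"
      by (simp add: V_def)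
    moreover have "{y. (1 / s) *\<^sub>R y \<in> H.body 1} = H.body s"
      using s by (auto simp: H.body_def field_simps)
    ultimately show ?thesis by (simp add: mult.commute)
  qed
  define R where "R = - (\<Sum>F\<in>?I. relative_volume F * B1_bar_plus (?b F * t))"
  define s where "s = (\<lambda>j. t + real j * m)"
  have s_pos: "s j > 0" for j using assms(5) m by (simp add: s_def add_pos_nonneg)
  have s_top: "filterlim s at_top sequentially"
    unfolding s_def using m
    by (intro filterlim_tendsto_add_at_top[OF tendsto_const] filterlim_at_top_mult_tendsto_pos[OF tendsto_const] filterlim_real_sequentially) auto
  have e_per: "e k (s j) = e k t" if "k \<le> ?N" for k j
  proof (induction j)
    case (Suc j)
    have "e k (s j + m) = e k (s j)" using assms(3) s_pos[of j] that by (simp add: quasi_coefficients_def m_def)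
    moreover have "s (Suc j) = s j + m" by (simp add: s_def algebra_simps)
    ultimately show ?case using Suc by simp
  qed (simp add: s_def)
  obtain C where C: "\<forall>\<^sub>F s in at_top. \<bar>real (card (H.points (\<lambda>F. s * ?b F))) - measure lborel (H.body s) -
     (\<Sum>F\<in>?I. (of_int \<lfloor>s * ?b F\<rfloor> - s * ?b F + 1 / 2) * (relative_volume F * s ^ (?N - 1)))\<bar> \<le> C * H.err s"
    using H.points_asymptotics by blast
  have "e (?N - 1) t = R"
  proof (rule second_coefficient_unique[where d = "\<lambda>k. e k t", OF _ s_top])
    show "\<forall>\<^sub>F j in sequentially. \<bar>(\<Sum>k\<le>?N. e k t * s j ^ k) - V * s j ^ ?N - R * s j ^ (?N - 1)\<bar> \<le> C * (s j ^ ?N / (s j)\<^sup>2)"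
      using eventually_compose_filterlim[OF C s_top]
    proof eventually_elim
      case (elim j)
      have 1: "real (card (H.points (\<lambda>F. s j * ?b F))) = (\<Sum>k\<le>?N. e k t * s j ^ k)"
        using assms(3) s_pos[of j] e_per[of _ j] by (simp add: L[symmetric] quasi_coefficients_def)
      \<comment> \<open>Passing from \<open>t\<close> to \<open>s j\<close> changes
        \<open>?b F * t\<close> by the integer \<open>real j * (m * ?b F)\<close>, so the rounding
        term keeps its value at \<open>t\<close>.\<close>
      have per: "of_int \<lfloor>s j * ?b F\<rfloor> - s j * ?b F + 1 / 2 = - B1_bar_plus (?b F * t)" if F: "F \<in> ?I" for F
      proof -
        have "rational_facet P F" using F assms(1,2) by unfold_locales auto
        then have "real j * (m * ?b F) \<in> \<int>"
          unfolding m_def using F assms(4) by (intro Ints_mult denom_times_support_int) auto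
        then have "B1_bar_plus (?b F * t + real j * (m * ?b F)) = B1_bar_plus (?b F * t)" by (rule B1_bar_plus_add_int)
        moreover have "s j * ?b F = ?b F * t + real j * (m * ?b F)" by (simp add: s_def algebra_simps)
        ultimately show ?thesis using B1_bar_plus_floor[of "s j * ?b F"] by simp
      qed
      have "(\<Sum>F\<in>?I. (of_int \<lfloor>s j * ?b F\<rfloor> - s j * ?b F + 1 / 2) * (relative_volume F * s j ^ (?N - 1))) =
        (\<Sum>F\<in>?I. - (relative_volume F * B1_bar_plus (?b F * t)) * s j ^ (?N - 1))"
        using per by (intro sum.cong refl) (simp only: mult_ac minus_mult_left)
      also have "\<dots> = R * s j ^ (?N - 1)" by (simp only: R_def sum_distrib_right[symmetric] sum_negf)
      finally show ?case using elim unfolding 1 vol[OF s_pos] H.err_def by simp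
    qed
  qed simp
  then show ?thesis by (simp add: R_def)
qed

end
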